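(* Let $X$ be a small category. The reflections ${\downarrow}T$ of atoms $T$ of $\mathbf{Cat}/X$ in discrete fibrations (or equally the reflections ${\downarrow}e$ of idempotent atoms $e$) generate the Cauchy completion of $X$: the full subcategory of $\mathbf{Set}^{X^{\mathrm{op}}}$ that they determine is the Cauchy completion of $X$. Furthermore, given two idempotent arrows $e:x\to x$ and $e':y\to y$ in $X$, $\hom({\downarrow}e,{\downarrow}e')$ is (in natural bijection with) the set of arrows $f:x\to y$ of $X$ such that $f\circ e=f=e'\circ f$. So the Cauchy completion of $X$ is (equivalent to) the Karoubi envelope of $X$.
   Context: $\mathbf{Cat}/X$ is the slice category: objects are functors $\pi:P\to X$ with $P$ small, morphisms are functors commuting with the projections to $X$; $\hom(P,Q)$ is the set of morphisms. Discrete fibrations over $X$ (unique lifting of arrows of $X$ with prescribed codomain) are identified with presheaves in $\mathbf{Set}^{X^{\mathrm{op}}}$ via the category of elements; discrete opfibrations (the dual notion) with functors $X\to\mathbf{Set}$. ${\downarrow}(-)$ is the left adjoint of the full inclusion of discrete fibrations in $\mathbf{Cat}/X$. $\mathrm{ten}(P,Q)$ is the set of connected components of the product $P\times_XQ$ in $\mathbf{Cat}/X$. $P\in\mathbf{Cat}/X$ is an atom if there are bijections $\mathrm{ten}(P,A)\cong\hom(P,A)$ natural in the discrete fibration $A$, and bijections $\mathrm{ten}(P,D)\cong\hom(P,D)$ natural in the discrete opfibration $D$. Let $\mathbf{e}$ be the monoid (one-object category) whose unique non-identity arrow is idempotent; an idempotent arrow $e$ of $X$ is regarded as a functor $\mathbf{e}\to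 X$, hence as an object of $\mathbf{Cat}/X$; these are atoms, called idempotent atoms. The Cauchy completion of $X$ is the full subcategory of $\mathbf{Set}^{X^{\mathrm{op}}}$ generated by the retracts of representable functors. The Karoubi envelope of $X$ has as objects the idempotent arrows of $X$, and as arrows from $e:x\to x$ to $e':y\to y$ the arrows $f:x\to y$ with $f\circ e=f=e'\circ f$. *)

theory Defs
  imports Main "HOL-Library.FuncSet" "HOL-Library.Infinite_Typeclass"
begin

section \<open>Categories, functors, natural transformations\<close>

record ('o, 'a) cat =
  Obj :: "'o set"
  Arr :: "'a set"
  Dom :: "'a \<Rightarrow> 'o"
  Cod :: "'a \<Rightarrow> 'o"
  Ide :: "'o \<Rightarrow> 'a"
  Comp :: "'a \<Rightarrow> 'a \<Rightarrow> 'a"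

text \<open>\<open>Comp C g f\<close> is \<open>g\<close> after \<open>f\<close>; the values of the operations outside the carriers are irrelevant.\<close>

definition Hom :: "('o, 'a) cat \<Rightarrow> 'o \<Rightarrow> 'o \<Rightarrow> 'a set" where
  "Hom C x y = {f \<in> Arr C. Dom C f = x \<and> Cod C f = y}"

definition category :: "('o, 'a) cat \<Rightarrow> bool" where
  "category C \<longleftrightarrow>
     (\<forall>f\<in>Arr C. Dom C f \<in> Obj C \<and> Cod C f \<in> Obj C) \<and>
     (\<forall>x\<in>Obj C. Ide C x \<in> Hom C x x) \<and>
     (\<forall>f\<in>Arr C. \<forall>g\<in>Arr C. Dom C g = Cod C f \<longrightarrow> Comp C g f \<in> Hom C (Dom C f) (Cod C g)) \<and>
     (\<forall>f\<in>Arr C. Comp C f (Ide C (Dom C f)) = f \<and> Comp C (Ide C (Cod C f)) f = f) \<and>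
     (\<forall>f\<in>Arr C. \<forall>g\<in>Arr C. \<forall>h\<in>Arr C. Dom C g = Cod C f \<longrightarrow> Dom C h = Cod C g \<longrightarrow>
        Comp C h (Comp C g f) = Comp C (Comp C h g) f)"

definition iso_objects :: "('o, 'a) cat \<Rightarrow> 'o \<Rightarrow> 'o \<Rightarrow> bool" where
  "iso_objects C x y \<longleftrightarrow>
     (\<exists>f\<in>Hom C x y. \<exists>g\<in>Hom C y x. Comp C g f = Ide C x \<and> Comp C f g = Ide C y)"

definition retract :: "('o, 'a) cat \<Rightarrow> 'o \<Rightarrow> 'o \<Rightarrow> bool" where
  "retract C x y \<longleftrightarrow> (\<exists>s\<in>Hom C x y. \<exists>r\<in>Hom C y x. Comp C r s = Ide C x)"

definition opposite :: "('o, 'a) cat \<Rightarrow> ('o, 'a) cat" where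
  "opposite C = C\<lparr>Dom := Cod C, Cod := Dom C, Comp := \<lambda>g f. Comp C f g\<rparr>"

definition full_subcat :: "('o, 'a) cat \<Rightarrow> 'o set \<Rightarrow> ('o, 'a) cat" where
  "full_subcat C S = C\<lparr>Obj := S, Arr := {f \<in> Arr C. Dom C f \<in> S \<and> Cod C f \<in> S}\<rparr>"

record ('o, 'a, 'p, 'b) funct =
  OnObj :: "'o \<Rightarrow> 'p"
  OnArr :: "'a \<Rightarrow> 'b"

text \<open>Functors are extensional (\<open>undefined\<close> outside the carriers), so that HOL equality of
  functors is equality of functors and sets of functors have the right cardinality.\<close>

definition is_functor ::
  "('o, 'a) cat \<Rightarrow> ('p, 'b) cat \<Rightarrow> ('o, 'a, 'p, 'b) funct \<Rightarrow> bool" where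
  "is_functor C D F \<longleftrightarrow>
     OnObj F \<in> Obj C \<rightarrow>\<^sub>E Obj D \<and> OnArr F \<in> Arr C \<rightarrow>\<^sub>E Arr D \<and>
     (\<forall>f\<in>Arr C. Dom D (OnArr F f) = OnObj F (Dom C f) \<and> Cod D (OnArr F f) = OnObj F (Cod C f)) \<and>
     (\<forall>x\<in>Obj C. OnArr F (Ide C x) = Ide D (OnObj F x)) \<and>
     (\<forall>f\<in>Arr C. \<forall>g\<in>Arr C. Dom C g = Cod C f \<longrightarrow>
        OnArr F (Comp C g f) = Comp D (OnArr F g) (OnArr F f))"

definition id_functor :: "('o, 'a) cat \<Rightarrow> ('o, 'a, 'o, 'a) funct" where
  "id_functor C = \<lparr>OnObj = restrict (\<lambda>x. x) (Obj C), OnArr = restrict (\<lambda>f. f) (Arr C)\<rparr>"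

text \<open>\<open>comp_functor C G F\<close> is \<open>G\<close> after \<open>F\<close>, where \<open>C\<close> is the domain of \<open>F\<close>.\<close>

definition comp_functor ::
  "('o, 'a) cat \<Rightarrow> ('p, 'b, 'q, 'c) funct \<Rightarrow> ('o, 'a, 'p, 'b) funct \<Rightarrow> ('o, 'a, 'q, 'c) funct" where
  "comp_functor C G F =
     \<lparr>OnObj = compose (Obj C) (OnObj G) (OnObj F), OnArr = compose (Arr C) (OnArr G) (OnArr F)\<rparr>"

record ('o, 'a, 'p, 'b) nattr =
  Source :: "('o, 'a, 'p, 'b) funct"
  Target :: "('o, 'a, 'p, 'b) funct"
  At :: "'o \<Rightarrow> 'b"

definition is_nattr ::
  "('o, 'a) cat \<Rightarrow> ('p, 'b) cat \<Rightarrow> ('o, 'a, 'p, 'b) nattr \<Rightarrow> bool" where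
  "is_nattr C D t \<longleftrightarrow>
     is_functor C D (Source t) \<and> is_functor C D (Target t) \<and> At t \<in> Obj C \<rightarrow>\<^sub>E Arr D \<and>
     (\<forall>x\<in>Obj C. At t x \<in> Hom D (OnObj (Source t) x) (OnObj (Target t) x)) \<and>
     (\<forall>f\<in>Arr C. Comp D (At t (Cod C f)) (OnArr (Source t) f) =
                Comp D (OnArr (Target t) f) (At t (Dom C f)))"

definition functor_cat ::
  "('o, 'a) cat \<Rightarrow> ('p, 'b) cat \<Rightarrow> (('o, 'a, 'p, 'b) funct, ('o, 'a, 'p, 'b) nattr) cat" where
  "functor_cat C D =
     \<lparr>Obj = {F. is_functor C D F}, Arr = {t. is_nattr C D t},
      Dom = Source, Cod = Target,
      Ide = \<lambda>F. \<lparr>Source = F, Target = F, At = restrict (\<lambda>x. Ide D (OnObj F x)) (Obj C)\<rparr>,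
      Comp = \<lambda>t s. \<lparr>Source = Source s, Target = Target t,
                     At = restrict (\<lambda>x. Comp D (At t x) (At s x)) (Obj C)\<rparr>\<rparr>"

definition equivalent_cats :: "('o, 'a) cat \<Rightarrow> ('p, 'b) cat \<Rightarrow> bool" where
  "equivalent_cats C D \<longleftrightarrow>
     (\<exists>F G. is_functor C D F \<and> is_functor D C G \<and>
        iso_objects (functor_cat C C) (comp_functor C G F) (id_functor C) \<and>
        iso_objects (functor_cat D D) (comp_functor D F G) (id_functor D))"

section \<open>Sets and presheaves\<close>

text \<open>The type \<open>'u\<close> (taken to be infinite in the theorem, so that it is closed under pairing up to
  bijection) is the universe of the small: small sets are the subsets of \<open>'u\<close>, and small categories
  have their objects and arrows in \<open>'u\<close>.\<close>

record 'u set_map =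
  SDom :: "'u set"
  SCod :: "'u set"
  SFun :: "'u \<Rightarrow> 'u"

definition set_cat :: "('u set, 'u set_map) cat" where
  "set_cat =
     \<lparr>Obj = UNIV, Arr = {m. SFun m \<in> SDom m \<rightarrow>\<^sub>E SCod m}, Dom = SDom, Cod = SCod,
      Ide = \<lambda>A. \<lparr>SDom = A, SCod = A, SFun = restrict (\<lambda>a. a) A\<rparr>,
      Comp = \<lambda>n m. \<lparr>SDom = SDom m, SCod = SCod n, SFun = compose (SDom m) (SFun n) (SFun m)\<rparr>\<rparr>"

type_synonym ('o, 'a, 'u) presheaf = "('o, 'a, 'u set, 'u set_map) funct"
type_synonym ('o, 'a, 'u) presheaf_map = "('o, 'a, 'u set, 'u set_map) nattr"

definition presheaves ::
  "('o, 'a) cat \<Rightarrow> (('o, 'a, 'u) presheaf, ('o, 'a, 'u) presheaf_map) cat" where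
  "presheaves X = functor_cat (opposite X) set_cat"

definition yoneda :: "('o, 'u) cat \<Rightarrow> 'o \<Rightarrow> ('o, 'u, 'u) presheaf" where
  "yoneda X x =
     \<lparr>OnObj = restrict (\<lambda>z. Hom X z x) (Obj X),
      OnArr = restrict (\<lambda>f. \<lparr>SDom = Hom X (Cod X f) x, SCod = Hom X (Dom X f) x,
                             SFun = restrict (\<lambda>g. Comp X g f) (Hom X (Cod X f) x)\<rparr>) (Arr X)\<rparr>"

definition representable :: "('o, 'u) cat \<Rightarrow> ('o, 'u, 'u) presheaf \<Rightarrow> bool" where
  "representable X A \<longleftrightarrow> A \<in> Obj (presheaves X) \<and>
     (\<exists>x\<in>Obj X. iso_objects (presheaves X) A (yoneda X x))"

definition cauchy_completion ::
  "('o, 'u) cat \<Rightarrow> (('o, 'u, 'u) presheaf, ('o, 'u, 'u) presheaf_map) cat" where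
  "cauchy_completion X = full_subcat (presheaves X)
     {A \<in> Obj (presheaves X). \<exists>B. representable X B \<and> retract (presheaves X) A B}"

section \<open>Categories over a base\<close>

record ('p, 'b, 'o, 'a) over =
  Tot :: "('p, 'b) cat"
  Proj :: "('p, 'b, 'o, 'a) funct"

definition is_over :: "('o, 'a) cat \<Rightarrow> ('p, 'b, 'o, 'a) over \<Rightarrow> bool" where
  "is_over X P \<longleftrightarrow> category (Tot P) \<and> is_functor (Tot P) X (Proj P)"

definition over_hom ::
  "('p, 'b, 'o, 'a) over \<Rightarrow> ('q, 'c, 'o, 'a) over \<Rightarrow> ('p, 'b, 'q, 'c) funct set" where
  "over_hom P Q =
     {F. is_functor (Tot P) (Tot Q) F \<and> comp_functor (Tot P) (Proj Q) F = Proj P}"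

definition over_iso :: "('p, 'b, 'o, 'a) over \<Rightarrow> ('q, 'c, 'o, 'a) over \<Rightarrow> bool" where
  "over_iso P Q \<longleftrightarrow>
     (\<exists>F\<in>over_hom P Q. \<exists>G\<in>over_hom Q P.
        comp_functor (Tot P) G F = id_functor (Tot P) \<and>
        comp_functor (Tot Q) F G = id_functor (Tot Q))"

definition discrete_fibration :: "('o, 'a) cat \<Rightarrow> ('p, 'b, 'o, 'a) over \<Rightarrow> bool" where
  "discrete_fibration X A \<longleftrightarrow> is_over X A \<and>
     (\<forall>a\<in>Obj (Tot A). \<forall>f\<in>Arr X. Cod X f = OnObj (Proj A) a \<longrightarrow>
        (\<exists>!t. t \<in> Arr (Tot A) \<and> Cod (Tot A) t = a \<and> OnArr (Proj A) t = f))"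

definition discrete_opfibration :: "('o, 'a) cat \<Rightarrow> ('p, 'b, 'o, 'a) over \<Rightarrow> bool" where
  "discrete_opfibration X A \<longleftrightarrow> is_over X A \<and>
     (\<forall>a\<in>Obj (Tot A). \<forall>f\<in>Arr X. Dom X f = OnObj (Proj A) a \<longrightarrow>
        (\<exists>!t. t \<in> Arr (Tot A) \<and> Dom (Tot A) t = a \<and> OnArr (Proj A) t = f))"

text \<open>In the category of elements of \<open>A\<close>, the pair \<open>(f, b)\<close> is the arrow over \<open>f\<close> with codomain
  \<open>(Cod X f, b)\<close>.\<close>

definition elements ::
  "('o, 'a) cat \<Rightarrow> ('o, 'a, 'u) presheaf \<Rightarrow> ('o \<times> 'u, 'a \<times> 'u, 'o, 'a) over" where
  "elements X A =
     (let Ob = Sigma (Obj X) (OnObj A); Ar = Sigma (Arr X) (\<lambda>f. OnObj A (Cod X f)) in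
      \<lparr>Tot = \<lparr>Obj = Ob, Arr = Ar,
              Dom = \<lambda>(f, b). (Dom X f, SFun (OnArr A f) b),
              Cod = \<lambda>(f, b). (Cod X f, b),
              Ide = \<lambda>(x, a). (Ide X x, a),
              Comp = \<lambda>(g, c) (f, b). (Comp X g f, c)\<rparr>,
       Proj = \<lparr>OnObj = restrict fst Ob, OnArr = restrict fst Ar\<rparr>\<rparr>)"

text \<open>The total category of the product \<open>P \<times>\<^sub>X Q\<close> in the slice.\<close>

definition fibre_product ::
  "('p, 'b, 'o, 'a) over \<Rightarrow> ('q, 'c, 'o, 'a) over \<Rightarrow> ('p \<times> 'q, 'b \<times> 'c) cat" where
  "fibre_product P Q =
     \<lparr>Obj = {(p, q). p \<in> Obj (Tot P) \<and> q \<in> Obj (Tot Q) \<and> OnObj (Proj P) p = OnObj (Proj Q) q},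
      Arr = {(s, t). s \<in> Arr (Tot P) \<and> t \<in> Arr (Tot Q) \<and> OnArr (Proj P) s = OnArr (Proj Q) t},
      Dom = map_prod (Dom (Tot P)) (Dom (Tot Q)),
      Cod = map_prod (Cod (Tot P)) (Cod (Tot Q)),
      Ide = map_prod (Ide (Tot P)) (Ide (Tot Q)),
      Comp = \<lambda>(s', t') (s, t). (Comp (Tot P) s' s, Comp (Tot Q) t' t)\<rparr>"

definition connected_rel :: "('o, 'a) cat \<Rightarrow> ('o \<times> 'o) set" where
  "connected_rel C =
     (let R = (\<lambda>f. (Dom C f, Cod C f)) ` Arr C in (R \<union> R\<inverse>)\<^sup>* \<inter> Obj C \<times> Obj C)"

definition components :: "('o, 'a) cat \<Rightarrow> 'o set set" where
  "components C = Obj C // connected_rel C"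

definition ten ::
  "('p, 'b, 'o, 'a) over \<Rightarrow> ('q, 'c, 'o, 'a) over \<Rightarrow> ('p \<times> 'q) set set" where
  "ten P Q = components (fibre_product P Q)"

text \<open>The action of \<open>ten P\<close> on \<open>G : A \<rightarrow> B\<close>: the image of a component \<open>c\<close> meets exactly one
  component of \<open>P \<times>\<^sub>X B\<close>.\<close>

definition ten_map ::
  "('p, 'b, 'o, 'a) over \<Rightarrow> ('r, 'd, 'o, 'a) over \<Rightarrow> ('q, 'c, 'r, 'd) funct \<Rightarrow>
   ('p \<times> 'q) set \<Rightarrow> ('p \<times> 'r) set" where
  "ten_map P B G c = connected_rel (fibre_product P B) `` (map_prod (\<lambda>p. p) (OnObj G) ` c)"

text \<open>\<open>ten_iso_hom P F\<close>: there are bijections between \<open>ten P A\<close> and \<open>hom P A\<close> natural in \<open>A\<close>, where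
  \<open>A\<close> ranges over the full subcategory of the slice on the objects satisfying \<open>F\<close>.\<close>

definition ten_iso_hom ::
  "('p, 'b, 'o, 'a) over \<Rightarrow> (('q, 'c, 'o, 'a) over \<Rightarrow> bool) \<Rightarrow> bool" where
  "ten_iso_hom P F \<longleftrightarrow>
     (\<exists>\<phi>. (\<forall>A. F A \<longrightarrow> bij_betw (\<phi> A) (ten P A) (over_hom P A)) \<and>
          (\<forall>A B. F A \<longrightarrow> F B \<longrightarrow> (\<forall>G\<in>over_hom A B. \<forall>c\<in>ten P A.
             \<phi> B (ten_map P B G c) = comp_functor (Tot P) G (\<phi> A c))))"

definition atom :: "('u, 'u) cat \<Rightarrow> ('p, 'b, 'u, 'u) over \<Rightarrow> bool" where
  "atom X P \<longleftrightarrow> is_over X P \<and>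
     ten_iso_hom P (discrete_fibration X :: ('u, 'u, 'u, 'u) over \<Rightarrow> bool) \<and>
     ten_iso_hom P (discrete_opfibration X :: ('u, 'u, 'u, 'u) over \<Rightarrow> bool)"

text \<open>The left adjoint of the inclusion of discrete fibrations, by its universal property:
  \<open>\<eta>\<close> is a universal arrow from \<open>P\<close> to a discrete fibration \<open>R\<close>. For small \<open>P\<close> and \<open>X\<close>, with \<open>'u\<close>
  infinite, such a pair always exists, so the choice below is a choice of reflections and units.\<close>

definition is_reflection ::
  "('u, 'u) cat \<Rightarrow> ('p, 'b, 'u, 'u) over \<Rightarrow> ('u, 'u, 'u, 'u) over \<Rightarrow> ('p, 'b, 'u, 'u) funct \<Rightarrow> bool"
  where
  "is_reflection X P R \<eta> \<longleftrightarrow> discrete_fibration X R \<and> \<eta> \<in> over_hom P R \<and>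
     (\<forall>A :: ('u, 'u, 'u, 'u) over. discrete_fibration X A \<longrightarrow>
        (\<forall>F\<in>over_hom P A. \<exists>!G. G \<in> over_hom R A \<and> comp_functor (Tot P) G \<eta> = F))"

definition down :: "('u, 'u) cat \<Rightarrow> ('p, 'b, 'u, 'u) over \<Rightarrow> ('u, 'u, 'u, 'u) over" where
  "down X P = fst (SOME (R, \<eta>). is_reflection X P R \<eta>)"

definition down_unit :: "('u, 'u) cat \<Rightarrow> ('p, 'b, 'u, 'u) over \<Rightarrow> ('p, 'b, 'u, 'u) funct" where
  "down_unit X P = snd (SOME (R, \<eta>). is_reflection X P R \<eta>)"

section \<open>Idempotents\<close>

definition idempotent :: "('o, 'a) cat \<Rightarrow> 'a \<Rightarrow> bool" where
  "idempotent X e \<longleftrightarrow> e \<in> Arr X \<and> Dom X e = Cod X e \<and> Comp X e e = e"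

text \<open>The free idempotent: \<open>True\<close> is the identity and \<open>False\<close> the idempotent.\<close>

definition free_idempotent :: "(unit, bool) cat" where
  "free_idempotent =
     \<lparr>Obj = UNIV, Arr = UNIV, Dom = \<lambda>_. (), Cod = \<lambda>_. (), Ide = \<lambda>_. True, Comp = (\<and>)\<rparr>"

definition idem_over :: "('o, 'a) cat \<Rightarrow> 'a \<Rightarrow> (unit, bool, 'o, 'a) over" where
  "idem_over X e =
     \<lparr>Tot = free_idempotent,
      Proj = \<lparr>OnObj = \<lambda>_. Dom X e, OnArr = \<lambda>b. if b then Ide X (Dom X e) else e\<rparr>\<rparr>"

definition idem_hom :: "('o, 'a) cat \<Rightarrow> 'a \<Rightarrow> 'a \<Rightarrow> 'a set" where
  "idem_hom X e e' = {f \<in> Hom X (Dom X e) (Dom X e'). Comp X f e = f \<and> Comp X e' f = f}"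

text \<open>An arrow \<open>f\<close> from \<open>e\<close> to \<open>e'\<close> is tagged with its ends, since \<open>f\<close> does not determine them.\<close>

definition karoubi :: "('o, 'a) cat \<Rightarrow> ('a, 'a \<times> 'a \<times> 'a) cat" where
  "karoubi X =
     \<lparr>Obj = {e. idempotent X e},
      Arr = {(e, f, e'). idempotent X e \<and> idempotent X e' \<and> f \<in> idem_hom X e e'},
      Dom = \<lambda>(e, f, e'). e, Cod = \<lambda>(e, f, e'). e', Ide = \<lambda>e. (e, e, e),
      Comp = \<lambda>(e', g, e'') (e, f, e'). (e, Comp X g f, e'')\<rparr>"

end

theory Submission
  imports Defs
begin

text \<open>
  A discrete fibration \<open>R\<close> over \<open>X\<close> is a right action of \<open>X\<close>, and morphisms into it are equivariant maps
  of objects. Everything is controlled by the relation \<open>free_on X e R a\<close>: \<open>R\<close> is free on one generator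
  \<open>a\<close> subject to \<open>a \<cdot> e = a\<close>, so that maps \<open>R \<rightarrow> B\<close> are the \<open>b\<close> in \<open>B\<close> with \<open>b \<cdot> e = b\<close>. The slice
  \<open>X/x\<close> is free on the identity of \<open>x\<close>, its retracts are exactly the fibrations free on some idempotent
  of \<open>x\<close>, and \<open>\<down>e\<close> is free on \<open>e\<close>.

  For an atom \<open>T\<close> with reflection unit \<open>\<eta> : T \<rightarrow> R\<close>, the component in \<open>ten T R\<close> that corresponds to \<open>\<eta>\<close>
  contains some \<open>(t, a)\<close>, with \<open>a\<close> over \<open>x\<close>. The component of \<open>(t, id)\<close> in \<open>ten T (X/x)\<close> gives a morphism
  \<open>T \<rightarrow> X/x\<close>, and naturality along \<open>a : X/x \<rightarrow> R\<close> says that \<open>\<eta>\<close> factors as \<open>T \<rightarrow> X/x \<rightarrow> R\<close>; hence \<open>R\<close> is a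
  retract of \<open>X/x\<close>.
\<close>

section \<open>Discrete fibrations as right actions\<close>

text \<open>Two things shape the development. \<open>down\<close> is obtained by a choice, so
  nothing is known about it until some reflection has been constructed with carriers in
  \<open>'u\<close>: for an idempotent atom this is the explicit \<open>idem_fib\<close>, while an
  arbitrary atom needs a general construction by components of comma categories, coded in the
  infinite type \<open>'u\<close>. Moreover, the fibrations to be compared live on different types:
  \<open>down\<close> and \<open>atom\<close> refer to fibrations with carriers in
  \<open>'u\<close>, whereas \<open>elements X A\<close> consists of pairs. A property such as
  \<open>is_reflection\<close> quantifies over fibrations of one fixed type and cannot be carried
  across. This is why \<open>free_on\<close> is stated by normal forms (every object is
  \<open>act R a f\<close> for exactly one \<open>f\<close> into \<open>Dom X e\<close> with
  \<open>Comp X e f = f\<close>) instead of by maps: it makes sense for every carrier type, its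
  mapping property becomes a polymorphic lemma, and it moves along isomorphisms between different
  types. Each class of presheaves in the statement then turns into the class of those
  \<open>A\<close> for which \<open>elements X A\<close> is free on some idempotent.\<close>

locale base_cat =
  fixes X :: "('o, 'a) cat"
  assumes category: "category X"
begin

lemma dom_obj [simp]: "f \<in> Arr X \<Longrightarrow> Dom X f \<in> Obj X"
  and cod_obj [simp]: "f \<in> Arr X \<Longrightarrow> Cod X f \<in> Obj X"
  and ide_arr [simp]: "x \<in> Obj X \<Longrightarrow> Ide X x \<in> Arr X"
  and dom_ide [simp]: "x \<in> Obj X \<Longrightarrow> Dom X (Ide X x) = x"
  and cod_ide [simp]: "x \<in> Obj X \<Longrightarrow> Cod X (Ide X x) = x"
  and comp_arr [simp]: "f \<in> Arr X \<Longrightarrow> g \<in> Arr X \<Longrightarrow> Dom X g = Cod X f \<Longrightarrow> Comp X g f \<in> Arr X"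
  and dom_comp [simp]: "f \<in> Arr X \<Longrightarrow> g \<in> Arr X \<Longrightarrow> Dom X g = Cod X f \<Longrightarrow> Dom X (Comp X g f) = Dom X f"
  and cod_comp [simp]: "f \<in> Arr X \<Longrightarrow> g \<in> Arr X \<Longrightarrow> Dom X g = Cod X f \<Longrightarrow> Cod X (Comp X g f) = Cod X g"
  and comp_ide [simp]: "f \<in> Arr X \<Longrightarrow> Dom X f = x \<Longrightarrow> Comp X f (Ide X x) = f"
  and ide_comp [simp]: "f \<in> Arr X \<Longrightarrow> Cod X f = y \<Longrightarrow> Comp X (Ide X y) f = f"
  and comp_assoc: "f \<in> Arr X \<Longrightarrow> g \<in> Arr X \<Longrightarrow> h \<in> Arr X \<Longrightarrow> Dom X g = Cod X f \<Longrightarrow> Dom X h = Cod X g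
    \<Longrightarrow> Comp X (Comp X h g) f = Comp X h (Comp X g f)"
  using category by (auto simp: category_def Hom_def)

end

section \<open>Functors and morphisms over the base\<close>

lemma functor_eqI:
  assumes "is_functor C D F" "is_functor C D G"
    and "\<And>x. x \<in> Obj C \<Longrightarrow> OnObj F x = OnObj G x" "\<And>f. f \<in> Arr C \<Longrightarrow> OnArr F f = OnArr G f"
  shows "F = G"
proof -
  have "OnObj F = OnObj G"
    using assms by (intro PiE_ext[of _ "Obj C" "\<lambda>_. Obj D"]) (auto simp: is_functor_def)
  moreover have "OnArr F = OnArr G"
    using assms by (intro PiE_ext[of _ "Arr C" "\<lambda>_. Arr D"]) (auto simp: is_functor_def)
  ultimately show ?thesis by (cases F; cases G) simp
qed

lemma is_functor_id: "category C \<Longrightarrow> is_functor C C (id_functor C)"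
  by (auto simp: is_functor_def id_functor_def category_def Hom_def)

lemma is_functor_comp:
  assumes "category C" "is_functor C D F" "is_functor D E G"
  shows "is_functor C E (comp_functor C G F)"
  using assms unfolding is_functor_def comp_functor_def category_def Hom_def
  by (auto simp: compose_def PiE_iff)

lemma comp_functor_at [simp]:
  "x \<in> Obj C \<Longrightarrow> OnObj (comp_functor C G F) x = OnObj G (OnObj F x)"
  "f \<in> Arr C \<Longrightarrow> OnArr (comp_functor C G F) f = OnArr G (OnArr F f)"
  by (auto simp: comp_functor_def compose_def)

lemma id_functor_at [simp]:
  "x \<in> Obj C \<Longrightarrow> OnObj (id_functor C) x = x"
  "f \<in> Arr C \<Longrightarrow> OnArr (id_functor C) f = f"
  by (auto simp: id_functor_def)

abbreviation (input) ob :: "('p, 'b, 'o, 'a) over \<Rightarrow> 'p set" where "ob P \<equiv> Obj (Tot P)"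
abbreviation (input) ar :: "('p, 'b, 'o, 'a) over \<Rightarrow> 'b set" where "ar P \<equiv> Arr (Tot P)"
abbreviation (input) pob :: "('p, 'b, 'o, 'a) over \<Rightarrow> 'p \<Rightarrow> 'o" where "pob P \<equiv> OnObj (Proj P)"
abbreviation (input) par :: "('p, 'b, 'o, 'a) over \<Rightarrow> 'b \<Rightarrow> 'a" where "par P \<equiv> OnArr (Proj P)"

lemma over_hom_comp:
  assumes "is_over X P" "F \<in> over_hom P Q" "G \<in> over_hom Q R"
  shows "comp_functor (Tot P) G F \<in> over_hom P R"
proof -
  have 1: "is_functor (Tot P) (Tot R) (comp_functor (Tot P) G F)"
    using assms by (auto simp: is_over_def over_hom_def intro: is_functor_comp)
  have "comp_functor (Tot P) (Proj R) (comp_functor (Tot P) G F)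
    = comp_functor (Tot P) (comp_functor (Tot Q) (Proj R) G) F"
    using assms(2) compose_assoc[of "OnObj F" "ob P" "ob Q" "pob R" "OnObj G"]
      compose_assoc[of "OnArr F" "ar P" "ar Q" "par R" "OnArr G"]
    by (simp add: over_hom_def is_functor_def comp_functor_def PiE_def)
  then show ?thesis using 1 assms by (auto simp: over_hom_def)
qed

lemma over_hom_id:
  assumes "is_over X P"
  shows "id_functor (Tot P) \<in> over_hom P P"
proof -
  have "comp_functor (Tot P) (Proj P) (id_functor (Tot P)) = Proj P"
    using assms by (intro functor_eqI[of "Tot P" X])
      (auto simp: is_over_def intro: is_functor_comp is_functor_id)
  then show ?thesis using assms by (auto simp: over_hom_def is_over_def intro: is_functor_id)
qed

lemma over_homD:
  assumes "F \<in> over_hom P Q"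
  shows "is_functor (Tot P) (Tot Q) F"
    and "p \<in> ob P \<Longrightarrow> OnObj F p \<in> ob Q" and "t \<in> ar P \<Longrightarrow> OnArr F t \<in> ar Q"
    and "p \<in> ob P \<Longrightarrow> pob Q (OnObj F p) = pob P p" and "t \<in> ar P \<Longrightarrow> par Q (OnArr F t) = par P t"
    and "t \<in> ar P \<Longrightarrow> Dom (Tot Q) (OnArr F t) = OnObj F (Dom (Tot P) t)"
    and "t \<in> ar P \<Longrightarrow> Cod (Tot Q) (OnArr F t) = OnObj F (Cod (Tot P) t)"
proof -
  have "comp_functor (Tot P) (Proj Q) F = Proj P" using assms by (auto simp: over_hom_def)
  then show "p \<in> ob P \<Longrightarrow> pob Q (OnObj F p) = pob P p" "t \<in> ar P \<Longrightarrow> par Q (OnArr F t) = par P t"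
    by (metis comp_functor_at(1), metis comp_functor_at(2))
qed (use assms in \<open>auto simp: over_hom_def is_functor_def\<close>)

lemma over_homI:
  assumes "is_over X P" "is_over X Q" "is_functor (Tot P) (Tot Q) F"
    and "\<And>p. p \<in> ob P \<Longrightarrow> pob Q (OnObj F p) = pob P p" "\<And>t. t \<in> ar P \<Longrightarrow> par Q (OnArr F t) = par P t"
  shows "F \<in> over_hom P Q"
proof -
  have "comp_functor (Tot P) (Proj Q) F = Proj P"
    using assms by (intro functor_eqI[of "Tot P" X]) (auto simp: is_over_def intro: is_functor_comp)
  then show ?thesis using assms by (auto simp: over_hom_def)
qed

section \<open>Unique lifts and equivariant maps\<close>

definition lift :: "('p, 'b, 'o, 'a) over \<Rightarrow> 'a \<Rightarrow> 'p \<Rightarrow> 'b" where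
  "lift A f a = (THE t. t \<in> ar A \<and> Cod (Tot A) t = a \<and> par A t = f)"

definition act :: "('p, 'b, 'o, 'a) over \<Rightarrow> 'p \<Rightarrow> 'a \<Rightarrow> 'p" where
  "act A a f = Dom (Tot A) (lift A f a)"

text \<open>The object part of a morphism into a discrete fibration. Arrows of \<open>A\<close> are
  determined by codomain and projection, so equivariance on objects is enough; \<open>P\<close> may
  be any category over \<open>X\<close>, and \<open>mor\<close> fills in the arrows by
  lifting.\<close>

definition compat :: "('p, 'b, 'o, 'a) over \<Rightarrow> ('q, 'c, 'o, 'a) over \<Rightarrow> ('p \<Rightarrow> 'q) \<Rightarrow> bool" where
  "compat P A h \<longleftrightarrow> (\<forall>p\<in>ob P. h p \<in> ob A \<and> pob A (h p) = pob P p) \<and>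
     (\<forall>u\<in>ar P. h (Dom (Tot P) u) = act A (h (Cod (Tot P) u)) (par P u))"

definition mor :: "('p, 'b, 'o, 'a) over \<Rightarrow> ('q, 'c, 'o, 'a) over \<Rightarrow> ('p \<Rightarrow> 'q) \<Rightarrow> ('p, 'b, 'q, 'c) funct" where
  "mor P A h = \<lparr>OnObj = restrict h (ob P),
     OnArr = restrict (\<lambda>u. lift A (par P u) (h (Cod (Tot P) u))) (ar P)\<rparr>"

lemma mor_at [simp]: "p \<in> ob P \<Longrightarrow> OnObj (mor P A h) p = h p"
  by (simp add: mor_def)

lemma is_overD:
  assumes "is_over X P"
  shows "base_cat (Tot P)"
    and "p \<in> ob P \<Longrightarrow> pob P p \<in> Obj X" and "t \<in> ar P \<Longrightarrow> par P t \<in> Arr X"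
    and "t \<in> ar P \<Longrightarrow> pob P (Dom (Tot P) t) = Dom X (par P t)"
    and "t \<in> ar P \<Longrightarrow> pob P (Cod (Tot P) t) = Cod X (par P t)"
    and "t \<in> ar P \<Longrightarrow> Dom (Tot P) t \<in> ob P"
    and "t \<in> ar P \<Longrightarrow> Cod (Tot P) t \<in> ob P"
    and "p \<in> ob P \<Longrightarrow> par P (Ide (Tot P) p) = Ide X (pob P p)"
    and "t \<in> ar P \<Longrightarrow> s \<in> ar P \<Longrightarrow> Dom (Tot P) s = Cod (Tot P) t \<Longrightarrow>
      par P (Comp (Tot P) s t) = Comp X (par P s) (par P t)"
  using assms by (auto simp: is_over_def is_functor_def base_cat_def category_def)

context base_cat
begin

context
  fixes A :: "('q, 'c, 'o, 'a) over"
  assumes A: "discrete_fibration X A"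
begin

lemma fib_over: "is_over X A"
  using A by (simp add: discrete_fibration_def)

lemma lift:
  assumes "a \<in> ob A" "f \<in> Arr X" "Cod X f = pob A a"
  shows "lift A f a \<in> ar A" "Cod (Tot A) (lift A f a) = a" "par A (lift A f a) = f"
proof -
  have "\<exists>!t. t \<in> ar A \<and> Cod (Tot A) t = a \<and> par A t = f"
    using A assms by (simp add: discrete_fibration_def)
  from theI'[OF this, folded lift_def]
  show "lift A f a \<in> ar A" "Cod (Tot A) (lift A f a) = a" "par A (lift A f a) = f"
    by simp_all
qed

lemma lift_eq:
  assumes "t \<in> ar A" "Cod (Tot A) t = a" "par A t = f"
  shows "lift A f a = t"
proof -
  have "\<exists>!t. t \<in> ar A \<and> Cod (Tot A) t = a \<and> par A t = f"
    using A assms(3) is_overD(3,5,7)[OF fib_over assms(1)] unfolding assms(2)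
    by (simp add: discrete_fibration_def)
  then show ?thesis unfolding lift_def by (rule the1_equality) (simp add: assms)
qed

lemma act_eq: "t \<in> ar A \<Longrightarrow> act A (Cod (Tot A) t) (par A t) = Dom (Tot A) t"
  by (simp add: act_def lift_eq)

lemma act:
  assumes "a \<in> ob A" "f \<in> Arr X" "Cod X f = pob A a"
  shows "act A a f \<in> ob A" "pob A (act A a f) = Dom X f"
  using lift[OF assms] is_overD[OF fib_over] by (auto simp: act_def)

lemma act_ide:
  assumes "a \<in> ob A" "x = pob A a"
  shows "act A a (Ide X x) = a"
proof -
  interpret A: base_cat "Tot A" using is_overD[OF fib_over] by simp
  show ?thesis using assms act_eq[of "Ide (Tot A) a"] is_overD[OF fib_over] by simp
qed

text \<open>The lift of \<open>f\<close> at \<open>a\<close> composed with the lift of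
  \<open>g\<close> at its domain lies over \<open>Comp X f g\<close> and ends at \<open>a\<close>,
  so it is the lift of the composite.\<close>

lemma act_comp:
  assumes "a \<in> ob A" "f \<in> Arr X" "Cod X f = pob A a" "g \<in> Arr X" "Cod X g = Dom X f"
  shows "act A a (Comp X f g) = act A (act A a f) g"
proof -
  interpret A: base_cat "Tot A" using is_overD[OF fib_over] by simp
  note l = lift[OF assms(1-3)]
  have b: "act A a f \<in> ob A" "pob A (act A a f) = Dom X f" using act[OF assms(1-3)] by auto
  have k: "lift A g (act A a f) \<in> ar A" "Cod (Tot A) (lift A g (act A a f)) = act A a f"
    "par A (lift A g (act A a f)) = g" using lift[of "act A a f" g] assms(4,5) b by simp_all
  have d: "Dom (Tot A) (lift A f a) = act A a f" by (simp add: act_def)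
  let ?u = "lift A f a" and ?v = "lift A g (act A a f)"
  have uv: "Dom (Tot A) ?u = Cod (Tot A) ?v" using k d by simp
  have "par A (Comp (Tot A) ?u ?v) = Comp X f g"
    unfolding is_overD(9)[OF fib_over k(1) l(1) uv] l(3) k(3) ..
  moreover have "Cod (Tot A) (Comp (Tot A) ?u ?v) = a" "Dom (Tot A) (Comp (Tot A) ?u ?v) = act A (act A a f) g"
    unfolding A.cod_comp[OF k(1) l(1) uv] A.dom_comp[OF k(1) l(1) uv] by (simp_all add: l act_def)
  ultimately show ?thesis
    using act_eq[OF A.comp_arr[OF k(1) l(1) uv]] by simp
qed

lemma hom_compat:
  assumes F: "F \<in> over_hom P A"
  shows "compat P A (OnObj F)"
proof -
  have "OnObj F (Dom (Tot P) u) = act A (OnObj F (Cod (Tot P) u)) (par P u)" if "u \<in> ar P" for u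
    using act_eq[OF over_homD(3)[OF F that]] that by (simp add: over_homD[OF F])
  then show ?thesis by (simp add: compat_def over_homD[OF F])
qed

text \<open>Arrows are recovered from objects as lifts.\<close>

lemma hom_eqI:
  assumes P: "is_over X P" and F: "F \<in> over_hom P A" and G: "G \<in> over_hom P A"
    and eq: "\<And>p. p \<in> ob P \<Longrightarrow> OnObj F p = OnObj G p"
  shows "F = G"
proof (rule functor_eqI[OF over_homD(1)[OF F] over_homD(1)[OF G] eq])
  fix t assume t: "t \<in> ar P"
  have "lift A (par P t) (OnObj F (Cod (Tot P) t)) = OnArr F t"
    using t by (intro lift_eq) (simp_all add: over_homD[OF F])
  moreover have "lift A (par P t) (OnObj G (Cod (Tot P) t)) = OnArr G t"
    using t by (intro lift_eq) (simp_all add: over_homD[OF G])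
  ultimately show "OnArr F t = OnArr G t"
    using t eq is_overD(7)[OF P] by simp
qed

text \<open>Functoriality comes from uniqueness of lifts: identities and composites in
  \<open>A\<close> have the codomain and projection that define the lifts assigned to identities and
  composites of \<open>P\<close>.\<close>

lemma mor_hom:
  assumes P: "is_over X P" and h: "compat P A h"
  shows "mor P A h \<in> over_hom P A"
proof (rule over_homI[OF P fib_over])
  interpret P: base_cat "Tot P" using is_overD[OF P] by simp
  interpret A: base_cat "Tot A" using is_overD[OF fib_over] by simp
  let ?l = "\<lambda>u. lift A (par P u) (h (Cod (Tot P) u))"
  have l: "?l u \<in> ar A" "Cod (Tot A) (?l u) = h (Cod (Tot P) u)" "par A (?l u) = par P u"
    "Dom (Tot A) (?l u) = h (Dom (Tot P) u)" if "u \<in> ar P" for u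
    using lift[of "h (Cod (Tot P) u)" "par P u"] that h is_overD[OF P]
    by (auto simp: compat_def act_def)
  show "is_functor (Tot P) (Tot A) (mor P A h)"
    unfolding is_functor_def
  proof (intro conjI ballI impI)
    show "OnObj (mor P A h) \<in> ob P \<rightarrow>\<^sub>E ob A" "OnArr (mor P A h) \<in> ar P \<rightarrow>\<^sub>E ar A"
      using h l by (auto simp: mor_def compat_def)
  next
    fix x assume x: "x \<in> ob P"
    show "OnArr (mor P A h) (Ide (Tot P) x) = Ide (Tot A) (OnObj (mor P A h) x)"
      using x h is_overD[OF P] is_overD[OF fib_over]
      by (auto simp: mor_def compat_def intro!: lift_eq)
  next
    fix f g assume fg: "f \<in> ar P" "g \<in> ar P" "Dom (Tot P) g = Cod (Tot P) f"
    show "OnArr (mor P A h) (Comp (Tot P) g f) = Comp (Tot A) (OnArr (mor P A h) g) (OnArr (mor P A h) f)"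
      using fg l[of f] l[of g] is_overD(9)[OF P] is_overD(9)[OF fib_over]
      by (auto simp: mor_def compat_def intro!: lift_eq)
  qed (use l in \<open>auto simp: mor_def\<close>)
  show "\<And>t. t \<in> ar P \<Longrightarrow> par A (OnArr (mor P A h) t) = par P t"
    using l by (simp add: mor_def)
qed (use h in \<open>auto simp: compat_def\<close>)

end

lemma hom_act:
  assumes A: "discrete_fibration X A" and B: "discrete_fibration X B" and F: "F \<in> over_hom A B"
    and "a \<in> ob A" "f \<in> Arr X" "Cod X f = pob A a"
  shows "OnObj F (act A a f) = act B (OnObj F a) f"
  using hom_compat[OF B F] lift[OF A assms(4-6)] unfolding compat_def act_def by metis

end

text \<open>Up to isomorphism this is the presheaf of arrows \<open>f\<close> into
  \<open>Dom X e\<close> with \<open>Comp X e f = f\<close>, that is, the image of the idempotent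
  that \<open>e\<close> induces on the representable at \<open>Dom X e\<close>. The last two clauses
  make such an \<open>f\<close> the normal form of \<open>act R a f\<close>.\<close>

definition free_on :: "('o, 'a) cat \<Rightarrow> 'a \<Rightarrow> ('p, 'b, 'o, 'a) over \<Rightarrow> 'p \<Rightarrow> bool" where
  "free_on X e R a \<longleftrightarrow> idempotent X e \<and> discrete_fibration X R \<and>
     a \<in> ob R \<and> pob R a = Dom X e \<and> act R a e = a \<and>
     (\<forall>r\<in>ob R. \<exists>f\<in>Arr X. Cod X f = Dom X e \<and> Comp X e f = f \<and> act R a f = r) \<and>
     (\<forall>f\<in>Arr X. \<forall>g\<in>Arr X. Cod X f = Dom X e \<longrightarrow> Cod X g = Dom X e \<longrightarrow>
        Comp X e f = f \<longrightarrow> Comp X e g = g \<longrightarrow> act R a f = act R a g \<longrightarrow> f = g)"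

lemma free_onD:
  assumes "free_on X e R a"
  shows "idempotent X e" "discrete_fibration X R" "a \<in> ob R" "pob R a = Dom X e" "act R a e = a"
  using assms by (simp_all add: free_on_def)

lemma free_on_exists:
  assumes "free_on X e R a" "r \<in> ob R"
  obtains f where "f \<in> Arr X" "Cod X f = Dom X e" "Comp X e f = f" "act R a f = r"
  using assms unfolding free_on_def by blast

lemma free_on_unique:
  assumes "free_on X e R a" "f \<in> Arr X" "g \<in> Arr X" "Cod X f = Dom X e" "Cod X g = Dom X e"
    "Comp X e f = f" "Comp X e g = g" "act R a f = act R a g"
  shows "f = g"
  using assms unfolding free_on_def by blast

lemma idempotentD:
  assumes "idempotent X e"
  shows "e \<in> Arr X" "Cod X e = Dom X e" "Comp X e e = e"
  using assms by (auto simp: idempotent_def)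

context base_cat
begin

lemma idempotent_ide: "x \<in> Obj X \<Longrightarrow> idempotent X (Ide X x)"
  by (simp add: idempotent_def)

lemma free_on_hom_eqI:
  assumes R: "free_on X e R a" and B: "discrete_fibration X B"
    and F: "F \<in> over_hom R B" and G: "G \<in> over_hom R B" and eq: "OnObj F a = OnObj G a"
  shows "F = G"
proof (rule hom_eqI[OF B fib_over[OF free_onD(2)[OF R]] F G])
  fix r assume "r \<in> ob R"
  then obtain f where f: "f \<in> Arr X" "Cod X f = Dom X e" "act R a f = r"
    using free_on_exists[OF R] by metis
  have "OnObj F (act R a f) = act B (OnObj F a) f" "OnObj G (act R a f) = act B (OnObj G a) f"
    using f hom_act[OF free_onD(2)[OF R] B F free_onD(3)[OF R] f(1)]
      hom_act[OF free_onD(2)[OF R] B G free_onD(3)[OF R] f(1)] free_onD(4)[OF R] by simp_all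
  then show "OnObj F r = OnObj G r" using eq f by simp
qed

text \<open>Send the object with normal form \<open>f\<close> to \<open>act B b f\<close>.
  Equivariance holds because normal forms are compatible with the action, and the generator goes to
  \<open>b\<close> because \<open>b\<close> is fixed by \<open>e\<close>.\<close>

lemma free_on_hom:
  assumes R: "free_on X e R a" and B: "discrete_fibration X B"
    and b: "b \<in> ob B" "pob B b = Dom X e" "act B b e = b"
  obtains G where "G \<in> over_hom R B" "OnObj G a = b"
proof -
  note e = idempotentD[OF free_onD(1)[OF R]]
  define c where "c r = (SOME f. f \<in> Arr X \<and> Cod X f = Dom X e \<and> Comp X e f = f \<and> act R a f = r)" for r
  have c: "c r \<in> Arr X" "Cod X (c r) = Dom X e" "Comp X e (c r) = c r" "act R a (c r) = r" if "r \<in> ob R" for r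
  proof -
    have "\<exists>f. f \<in> Arr X \<and> Cod X f = Dom X e \<and> Comp X e f = f \<and> act R a f = r"
      using free_on_exists[OF R that] by metis
    from someI_ex[OF this] show "c r \<in> Arr X" "Cod X (c r) = Dom X e" "Comp X e (c r) = c r" "act R a (c r) = r"
      by (simp_all add: c_def)
  qed
  have dc: "Dom X (c r) = pob R r" if "r \<in> ob R" for r
    using act(2)[OF free_onD(2,3)[OF R] c(1)[OF that]] c(2,4)[OF that] free_onD(4)[OF R] by simp
  \<comment> \<open>The normal form of the generator is \<open>e\<close> and not the identity of
    \<open>Dom X e\<close>, which in general violates \<open>Comp X e f = f\<close>.\<close>
  have ca: "c a = e"
    using c[OF free_onD(3)[OF R]] e free_onD(5)[OF R] by - (rule free_on_unique[OF R], simp_all)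
  let ?h = "\<lambda>r. act B b (c r)"
  have "compat R B ?h"
    unfolding compat_def
  proof (intro conjI ballI)
    fix r assume r: "r \<in> ob R"
    show "?h r \<in> ob B" "pob B (?h r) = pob R r"
      using act[OF B b(1) c(1)[OF r]] c(2)[OF r] dc[OF r] b(2) by simp_all
  next
    fix u assume u: "u \<in> ar R"
    note Ro = is_overD[OF fib_over[OF free_onD(2)[OF R]]]
    define r where "r = Cod (Tot R) u"
    have r: "r \<in> ob R" "pob R r = Cod X (par R u)" "par R u \<in> Arr X"
      using u Ro by (simp_all add: r_def)
    have d: "Dom (Tot R) u = act R r (par R u)"
      using act_eq[OF free_onD(2)[OF R] u] by (simp add: r_def)
    have "act R a (Comp X (c r) (par R u)) = act R (act R a (c r)) (par R u)"
      using c[OF r(1)] r dc[OF r(1)] free_onD(2-4)[OF R] by (intro act_comp) simp_all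
    also have "\<dots> = Dom (Tot R) u" using c(4)[OF r(1)] d by simp
    finally have 1: "act R a (Comp X (c r) (par R u)) = act R a (c (Dom (Tot R) u))"
      using c(4) Ro(6)[OF u] by simp
    \<comment> \<open>Both sides are normal forms of the same object.\<close>
    have cu: "c (Dom (Tot R) u) = Comp X (c r) (par R u)"
    proof (rule free_on_unique[OF R])
      show "Comp X e (Comp X (c r) (par R u)) = Comp X (c r) (par R u)"
        using c[OF r(1)] r dc[OF r(1)] e by (simp add: comp_assoc[symmetric])
    qed (use 1 c[OF r(1)] c[OF Ro(6)[OF u]] r dc[OF r(1)] in simp_all)
    show "?h (Dom (Tot R) u) = act B (?h (Cod (Tot R) u)) (par R u)"
      unfolding cu r_def[symmetric] using c[OF r(1)] r dc[OF r(1)] b by (intro act_comp[OF B]) simp_all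
  qed
  then have "mor R B ?h \<in> over_hom R B"
    by (intro mor_hom[OF B fib_over[OF free_onD(2)[OF R]]])
  moreover have "OnObj (mor R B ?h) a = b"
    using free_onD(3)[OF R] ca b by simp
  ultimately show ?thesis using that by blast
qed

lemma over_isoE:
  assumes "over_iso A B"
  obtains F G where "F \<in> over_hom A B" "G \<in> over_hom B A"
    "\<And>a. a \<in> ob A \<Longrightarrow> OnObj G (OnObj F a) = a" "\<And>b. b \<in> ob B \<Longrightarrow> OnObj F (OnObj G b) = b"
  using assms unfolding over_iso_def by (metis comp_functor_at(1) id_functor_at(1))

text \<open>The generators determine morphisms in both directions, and each composite fixes a
  generator, so it is an identity.\<close>

lemma free_on_over_iso:
  assumes R: "free_on X e R a" and S: "free_on X e S b"
  shows "over_iso R S"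
proof -
  note R' = free_onD[OF R] and S' = free_onD[OF S]
  note Ro = fib_over[OF R'(2)] and So = fib_over[OF S'(2)]
  obtain F where F: "F \<in> over_hom R S" "OnObj F a = b" using free_on_hom[OF R S'(2,3,4,5)] .
  obtain G where G: "G \<in> over_hom S R" "OnObj G b = a" using free_on_hom[OF S R'(2,3,4,5)] .
  have "comp_functor (Tot R) G F = id_functor (Tot R)"
    using R'(3) F G
    by (intro free_on_hom_eqI[OF R R'(2) over_hom_comp[OF Ro F(1) G(1)] over_hom_id[OF Ro]]) simp
  moreover have "comp_functor (Tot S) F G = id_functor (Tot S)"
    using S'(3) F G
    by (intro free_on_hom_eqI[OF S S'(2) over_hom_comp[OF So G(1) F(1)] over_hom_id[OF So]]) simp
  ultimately show ?thesis using F G by (auto simp: over_iso_def)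
qed

text \<open>The idempotent \<open>e\<close> is read off from \<open>q \<cdot> e = s (h q)\<close>.\<close>

lemma retract_free_on:
  assumes Q: "free_on X (Ide X x) Q q" and x: "x \<in> Obj X" and R: "discrete_fibration X R"
    and s: "s \<in> over_hom R Q" and h: "h \<in> over_hom Q R"
    and hs: "\<And>r. r \<in> ob R \<Longrightarrow> OnObj h (OnObj s r) = r"
  obtains e where "act Q q e = OnObj s (OnObj h q)" "e \<in> Arr X" "Cod X e = x" "free_on X e R (OnObj h q)"
proof -
  note Q' = free_onD[OF Q]
  have q: "q \<in> ob Q" "pob Q q = x" using Q' x by simp_all
  have a: "OnObj h q \<in> ob R" "pob R (OnObj h q) = x" using over_homD[OF h] q by simp_all
  obtain e where e: "e \<in> Arr X" "Cod X e = x" "act Q q e = OnObj s (OnObj h q)"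
    using free_on_exists[OF Q over_homD(2)[OF s a(1)]] x by auto
  have dom: "Dom X e = x"
    using act(2)[OF Q'(2) q(1) e(1)] e q a over_homD(4)[OF s a(1)] by simp
  have inj: "f = g" if "f \<in> Arr X" "g \<in> Arr X" "Cod X f = x" "Cod X g = x" "act Q q f = act Q q g" for f g
    using that x by - (rule free_on_unique[OF Q], simp_all)
  have sh: "OnObj s (OnObj h (act Q q f)) = act Q (act Q q e) f" "OnObj h (act Q q f) = act R (OnObj h q) f"
    if "f \<in> Arr X" "Cod X f = x" for f
    using that e a q hom_act[OF Q'(2) R h q(1) that(1)] hom_act[OF R Q'(2) s a(1) that(1)] by simp_all
  have qe: "act Q q (Comp X e f) = act Q (act Q q e) f" if "f \<in> Arr X" "Cod X f = x" for f
    using act_comp[OF Q'(2) q(1) e(1)] that e q dom by simp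
  \<comment> \<open>On normal forms, \<open>s\<close> after \<open>h\<close> is composition with
    \<open>e\<close>, and it fixes every object in the image of \<open>s\<close>. With
    \<open>e\<close> itself as \<open>f\<close> this gives idempotence.\<close>
  have fixed: "Comp X e f = f" if f: "f \<in> Arr X" "Cod X f = x" "act Q q f = OnObj s r" "r \<in> ob R" for f r
    using inj[of "Comp X e f" f] f e dom qe[OF f(1,2)] sh(1)[OF f(1,2)] hs[OF f(4)] by simp
  have ee: "Comp X e e = e" using fixed[OF e(1,2,3) a(1)] .
  have "free_on X e R (OnObj h q)"
    unfolding free_on_def dom
  proof (intro conjI ballI impI)
    show "idempotent X e" using e dom ee by (simp add: idempotent_def)
    show "act R (OnObj h q) e = OnObj h q" using sh(2)[OF e(1,2)] hs[OF a(1)] e(3) by simp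
  next
    fix r assume r: "r \<in> ob R"
    obtain f where f: "f \<in> Arr X" "Cod X f = x" "act Q q f = OnObj s r"
      using free_on_exists[OF Q over_homD(2)[OF s r]] x by auto
    then show "\<exists>f\<in>Arr X. Cod X f = x \<and> Comp X e f = f \<and> act R (OnObj h q) f = r"
      using fixed[OF f r] sh(2)[OF f(1,2)] hs[OF r] by auto
  next
    fix f g assume fg: "f \<in> Arr X" "g \<in> Arr X" "Cod X f = x" "Cod X g = x"
      "Comp X e f = f" "Comp X e g = g" "act R (OnObj h q) f = act R (OnObj h q) g"
    then have "act Q q (Comp X e f) = act Q q (Comp X e g)"
      using sh[OF fg(1,3)] sh[OF fg(2,4)] qe[OF fg(1,3)] qe[OF fg(2,4)] by simp
    then show "f = g" using inj[of f g] fg by simp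
  qed (use R a in auto)
  then show ?thesis using that e by blast
qed

text \<open>Transport along an isomorphism whose ends may have different carrier types, as is the
  case between \<open>down\<close> and \<open>elements\<close>.\<close>

lemma over_iso_free_on:
  assumes iso: "over_iso R S" and S: "discrete_fibration X S" and R: "free_on X e R a"
  obtains b where "free_on X e S b"
proof -
  note R' = free_onD[OF R]
  obtain F G where F: "F \<in> over_hom R S" and G: "G \<in> over_hom S R"
    and GF: "\<And>a. a \<in> ob R \<Longrightarrow> OnObj G (OnObj F a) = a" and FG: "\<And>b. b \<in> ob S \<Longrightarrow> OnObj F (OnObj G b) = b"
    using over_isoE[OF iso] by metis
  have Fa: "OnObj F (act R a f) = act S (OnObj F a) f" if "f \<in> Arr X" "Cod X f = Dom X e" for f
    using hom_act[OF R'(2) S F R'(3) that(1)] that R' by simp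
  have "free_on X e S (OnObj F a)"
    unfolding free_on_def
  proof (intro conjI ballI impI)
    show "act S (OnObj F a) e = OnObj F a" using Fa[of e] R' idempotentD[OF R'(1)] by simp
  next
    fix s assume s: "s \<in> ob S"
    show "\<exists>f\<in>Arr X. Cod X f = Dom X e \<and> Comp X e f = f \<and> act S (OnObj F a) f = s"
      using free_on_exists[OF R over_homD(2)[OF G s]] Fa FG[OF s] by metis
  next
    fix f g assume fg: "f \<in> Arr X" "g \<in> Arr X" "Cod X f = Dom X e" "Cod X g = Dom X e"
      "Comp X e f = f" "Comp X e g = g" "act S (OnObj F a) f = act S (OnObj F a) g"
    then have "OnObj F (act R a f) = OnObj F (act R a g)" by (simp add: Fa)
    then have "act R a f = act R a g"
      using GF act(1)[OF R'(2,3)] fg R'(4) by metis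
    then show "f = g" using free_on_unique[OF R] fg by blast
  qed (use R' S over_homD[OF F] in auto)
  then show ?thesis using that by blast
qed

end

section \<open>Small discrete fibrations and reflections\<close>

text \<open>Arrows of a fibration built from an action are pairs, but \<open>down\<close> and
  \<open>atom\<close> speak of fibrations with arrows in \<open>'u\<close>; an injective coding of
  pairs brings them there.\<close>

definition enc :: "'u::infinite \<times> 'u \<Rightarrow> 'u" where
  "enc = (SOME f. inj f)"

definition dec :: "'u::infinite \<Rightarrow> 'u \<times> 'u" where
  "dec = inv enc"

text \<open>An injection to choose from exists because an infinite set is equipotent with its
  square.\<close>

lemma dec_enc [simp]: "dec (enc c) = (c :: 'u::infinite \<times> 'u)"
proof -
  have "\<exists>f :: 'u \<times> 'u \<Rightarrow> 'u. bij_betw f (UNIV \<times> UNIV) UNIV"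
    using card_of_Times_same_infinite[of "UNIV :: 'u set"] infinite_UNIV card_of_ordIso by blast
  then have "\<exists>f :: 'u \<times> 'u \<Rightarrow> 'u. inj f" by (auto simp: bij_betw_def)
  then have "inj (enc :: 'u \<times> 'u \<Rightarrow> 'u)" unfolding enc_def by (rule someI_ex)
  then show ?thesis by (simp add: dec_def)
qed

text \<open>Converse to \<open>act\<close>: \<open>E\<close> is the set of objects, \<open>p\<close>
  their projection, \<open>m\<close> a right action, and the code of \<open>(f, b)\<close> serves as
  the lift of \<open>f\<close> at \<open>b\<close>.\<close>

definition fib :: "('u::infinite, 'u) cat \<Rightarrow> 'u set \<Rightarrow> ('u \<Rightarrow> 'u) \<Rightarrow> ('u \<Rightarrow> 'u \<Rightarrow> 'u) \<Rightarrow> ('u, 'u, 'u, 'u) over"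
  where
  "fib X E p m =
     (let Ar = enc ` {(f, b). f \<in> Arr X \<and> b \<in> E \<and> Cod X f = p b} in
      \<lparr>Tot = \<lparr>Obj = E, Arr = Ar,
              Dom = \<lambda>t. m (snd (dec t)) (fst (dec t)),
              Cod = \<lambda>t. snd (dec t),
              Ide = \<lambda>b. enc (Ide X (p b), b),
              Comp = \<lambda>t s. enc (Comp X (fst (dec t)) (fst (dec s)), snd (dec t))\<rparr>,
       Proj = \<lparr>OnObj = restrict p E, OnArr = restrict (\<lambda>t. fst (dec t)) Ar\<rparr>\<rparr>)"

locale small_cat = base_cat X for X :: "('u::infinite, 'u) cat"
begin

lemma fib_fibration:
  assumes p: "\<And>b. b \<in> E \<Longrightarrow> p b \<in> Obj X"
    and m: "\<And>b f. b \<in> E \<Longrightarrow> f \<in> Arr X \<Longrightarrow> Cod X f = p b \<Longrightarrow> m b f \<in> E"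
    and pm: "\<And>b f. b \<in> E \<Longrightarrow> f \<in> Arr X \<Longrightarrow> Cod X f = p b \<Longrightarrow> p (m b f) = Dom X f"
    and ide: "\<And>b. b \<in> E \<Longrightarrow> m b (Ide X (p b)) = b"
    and comp: "\<And>b f g. b \<in> E \<Longrightarrow> f \<in> Arr X \<Longrightarrow> Cod X f = p b \<Longrightarrow> g \<in> Arr X \<Longrightarrow> Cod X g = Dom X f \<Longrightarrow>
      m b (Comp X f g) = m (m b f) g"
  defines "A \<equiv> fib X E p m"
  shows "discrete_fibration X A" and "ob A = E" and "b \<in> E \<Longrightarrow> pob A b = p b"
    and "b \<in> E \<Longrightarrow> f \<in> Arr X \<Longrightarrow> Cod X f = p b \<Longrightarrow> act A b f = m b f"
proof -
  show obA: "ob A = E" and pobA: "\<And>b. b \<in> E \<Longrightarrow> pob A b = p b"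
    by (simp_all add: A_def fib_def Let_def)
  have "category (Tot A)"
    using assms(1-4) comp[symmetric] by (auto simp: A_def fib_def Let_def category_def Hom_def comp_assoc)
  moreover have "is_functor (Tot A) X (Proj A)"
    using assms(1-4) by (auto simp: A_def fib_def Let_def is_functor_def)
  ultimately have over: "is_over X A" by (simp add: is_over_def)
  have lift_ex: "enc (f, b) \<in> ar A" "Cod (Tot A) (enc (f, b)) = b" "par A (enc (f, b)) = f"
    "Dom (Tot A) (enc (f, b)) = m b f"
    if "b \<in> E" "f \<in> Arr X" "Cod X f = p b" for b f
    using that by (auto simp: A_def fib_def Let_def)
  have lift_un: "t = enc (par A t, Cod (Tot A) t)" if "t \<in> ar A" for t
    using that by (auto simp: A_def fib_def Let_def)
  show fibA: "discrete_fibration X A"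
    unfolding discrete_fibration_def
  proof (intro conjI ballI impI over)
    fix a f assume "a \<in> ob A" "f \<in> Arr X" "Cod X f = pob A a"
    then show "\<exists>!t. t \<in> ar A \<and> Cod (Tot A) t = a \<and> par A t = f"
      using lift_ex[of a f] lift_un obA pobA by (intro ex1I[of _ "enc (f, a)"]) auto
  qed
  show "act A b f = m b f" if "b \<in> E" "f \<in> Arr X" "Cod X f = p b"
    using lift_ex[OF that] act_eq[OF fibA] by metis
qed

text \<open>For an identity this is the slice over its object; for general \<open>e\<close> it is
  the part of the slice fixed by composition with \<open>e\<close>.\<close>

definition idem_fib :: "'u \<Rightarrow> ('u, 'u, 'u, 'u) over" where
  "idem_fib e = fib X {f \<in> Arr X. Cod X f = Dom X e \<and> Comp X e f = f} (Dom X) (Comp X)"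

text \<open>The generator is \<open>e\<close> itself: acting on it by a normal form \<open>f\<close>
  gives \<open>Comp X e f\<close>, which is \<open>f\<close>.\<close>

lemma free_on_idem_fib:
  assumes "idempotent X e"
  shows "free_on X e (idem_fib e) e"
proof -
  note e = idempotentD[OF assms]
  let ?E = "{f \<in> Arr X. Cod X f = Dom X e \<and> Comp X e f = f}"
  have mE: "Comp X b f \<in> ?E" if "b \<in> ?E" "f \<in> Arr X" "Cod X f = Dom X b" for b f
    using that e comp_assoc[of f b e, symmetric] by simp
  note A = fib_fibration[of ?E "Dom X" "Comp X", folded idem_fib_def, OF _ mE]
  have 1: "discrete_fibration X (idem_fib e)" and 2: "ob (idem_fib e) = ?E"
    and 3: "\<And>b. b \<in> ?E \<Longrightarrow> pob (idem_fib e) b = Dom X b"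
    and 4: "\<And>b f. b \<in> ?E \<Longrightarrow> f \<in> Arr X \<Longrightarrow> Cod X f = Dom X b \<Longrightarrow> act (idem_fib e) b f = Comp X b f"
    by (rule A; simp add: comp_assoc)+
  show ?thesis
    unfolding free_on_def
  proof (intro conjI ballI impI assms 1)
    show "e \<in> ob (idem_fib e)" "pob (idem_fib e) e = Dom X e" "act (idem_fib e) e e = e"
      using e 3[of e] 4[of e e] by (simp_all add: 2)
  next
    fix r assume "r \<in> ob (idem_fib e)"
    then have r: "r \<in> Arr X" "Cod X r = Dom X e" "Comp X e r = r" by (simp_all add: 2)
    then have "act (idem_fib e) e r = r" using e 4[of e r] by simp
    then show "\<exists>f\<in>Arr X. Cod X f = Dom X e \<and> Comp X e f = f \<and> act (idem_fib e) e f = r" using r by blast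
  next
    fix f g assume "f \<in> Arr X" "g \<in> Arr X" "Cod X f = Dom X e" "Cod X g = Dom X e" "Comp X e f = f"
      "Comp X e g = g" "act (idem_fib e) e f = act (idem_fib e) e g"
    then show "f = g" using e 4[of e f] 4[of e g] by simp
  qed
qed

end

text \<open>A common description of two presentations of the idempotent atom:
  \<open>idem_over\<close>, on the types \<open>unit\<close> and \<open>bool\<close>, and a copy
  with carriers in the universe of \<open>X\<close>. Only the image of the arrows is prescribed, so
  both arrows of \<open>idem_over\<close> may lie over an identity.\<close>

definition idem_like :: "('o, 'a) cat \<Rightarrow> 'a \<Rightarrow> ('p, 'b, 'o, 'a) over \<Rightarrow> 'p \<Rightarrow> bool" where
  "idem_like X e P u \<longleftrightarrow> is_over X P \<and> ob P = {u} \<and> pob P u = Dom X e \<and> par P ` ar P = {Ide X (Dom X e), e}"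

lemma is_reflectionD:
  fixes A :: "('u, 'u, 'u, 'u) over"
  assumes "is_reflection X P R \<eta>"
  shows "discrete_fibration X R" "\<eta> \<in> over_hom P R"
    and "discrete_fibration X A \<Longrightarrow> F \<in> over_hom P A \<Longrightarrow> \<exists>!G. G \<in> over_hom R A \<and> comp_functor (Tot P) G \<eta> = F"
  using assms by (simp_all add: is_reflection_def)

text \<open>\<open>down\<close> and \<open>down_unit\<close> are the two halves of one and the same
  choice, so the existence of any reflection yields the universal property for the pair.\<close>

lemma down_reflection:
  assumes "is_reflection X P R \<eta>"
  shows "is_reflection X P (down X P) (down_unit X P)"
proof -
  have "\<exists>c. case c of (R, \<eta>) \<Rightarrow> is_reflection X P R \<eta>" using assms by auto
  from someI_ex[OF this] show ?thesis
    unfolding down_def down_unit_def by (cases "SOME (R, \<eta>). is_reflection X P R \<eta>") simp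
qed

context base_cat
begin

lemma idem_likeD:
  assumes "idem_like X e P u"
  shows "is_over X P" "ob P = {u}" "pob P u = Dom X e" "t \<in> ar P \<Longrightarrow> Dom (Tot P) t = u"
    "t \<in> ar P \<Longrightarrow> Cod (Tot P) t = u" "t \<in> ar P \<Longrightarrow> par P t = Ide X (Dom X e) \<or> par P t = e"
    "\<exists>t\<in>ar P. par P t = e" "\<exists>t\<in>ar P. par P t = Ide X (Dom X e)"
proof -
  show P: "is_over X P" and obP: "ob P = {u}" and "pob P u = Dom X e"
    using assms by (simp_all add: idem_like_def)
  have i: "par P ` ar P = {Ide X (Dom X e), e}"
    using assms by (simp_all add: idem_like_def)
  show "t \<in> ar P \<Longrightarrow> Dom (Tot P) t = u" "t \<in> ar P \<Longrightarrow> Cod (Tot P) t = u"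
    using is_overD(6,7)[OF P] obP by auto
  show "t \<in> ar P \<Longrightarrow> par P t = Ide X (Dom X e) \<or> par P t = e" using i by blast
  have "e \<in> par P ` ar P" "Ide X (Dom X e) \<in> par P ` ar P" using i by simp_all
  then show "\<exists>t\<in>ar P. par P t = e" "\<exists>t\<in>ar P. par P t = Ide X (Dom X e)" by auto
qed

lemma idem_like_idem_over:
  assumes "idempotent X e"
  shows "idem_like X e (idem_over X e) ()"
proof -
  note e = idempotentD[OF assms]
  have "category free_idempotent"
    by (auto simp: category_def free_idempotent_def Hom_def)
  moreover have "is_functor free_idempotent X (Proj (idem_over X e))"
    using e by (auto simp: is_functor_def free_idempotent_def idem_over_def)
  ultimately show ?thesis
    by (auto simp: idem_like_def is_over_def idem_over_def free_idempotent_def)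
qed

text \<open>An arrow of \<open>P\<close> over \<open>e\<close> is a loop at \<open>u\<close>, so
  equivariance makes the image of \<open>u\<close> a fixed point of \<open>e\<close>. As
  \<open>idem_like_mor\<close> gives the converse, \<open>P\<close> has the same maps into
  fibrations as a fibration free on \<open>e\<close>, which is therefore its reflection.\<close>

lemma idem_like_hom:
  assumes P: "idem_like X e P u" and A: "discrete_fibration X A" and F: "F \<in> over_hom P A"
  shows "OnObj F u \<in> ob A" "pob A (OnObj F u) = Dom X e" "act A (OnObj F u) e = OnObj F u"
proof -
  note P' = idem_likeD[OF P]
  show "OnObj F u \<in> ob A" "pob A (OnObj F u) = Dom X e"
    using over_homD(2,4)[OF F] P' by auto
  obtain t where "t \<in> ar P" "par P t = e" using P'(7) by blast
  then show "act A (OnObj F u) e = OnObj F u"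
    using hom_compat[OF A F] P' unfolding compat_def by metis
qed

lemma idem_like_mor:
  assumes P: "idem_like X e P u" and A: "discrete_fibration X A"
    and b: "b \<in> ob A" "pob A b = Dom X e" "act A b e = b"
  shows "mor P A (\<lambda>_. b) \<in> over_hom P A" "OnObj (mor P A (\<lambda>_. b)) u = b"
proof -
  note P' = idem_likeD[OF P]
  have "compat P A (\<lambda>_. b)"
    using P'(2-6) b act_ide[OF A b(1)] unfolding compat_def by fastforce
  then show "mor P A (\<lambda>_. b) \<in> over_hom P A" by (rule mor_hom[OF A P'(1)])
  show "OnObj (mor P A (\<lambda>_. b)) u = b" using P'(2) by simp
qed

lemma idem_like_eqI:
  assumes P: "idem_like X e P u" and A: "discrete_fibration X A"
    and "F \<in> over_hom P A" "G \<in> over_hom P A" "OnObj F u = OnObj G u"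
  shows "F = G"
  using assms(5) idem_likeD(2)[OF P] by (intro hom_eqI[OF A idem_likeD(1)[OF P] assms(3,4)]) simp

end

context small_cat
begin

lemma free_on_reflection:
  assumes P: "idem_like X e P u" and R: "free_on X e R a"
  shows "is_reflection X P R (mor P R (\<lambda>_. a))"
proof -
  note R' = free_onD[OF R] and P' = idem_likeD[OF P]
  note m = idem_like_mor[OF P R'(2-5)]
  show ?thesis
    unfolding is_reflection_def
  proof (intro conjI allI impI ballI R'(2) m(1))
    fix A :: "('u, 'u, 'u, 'u) over" and F
    assume A: "discrete_fibration X A" and F: "F \<in> over_hom P A"
    obtain G where G: "G \<in> over_hom R A" "OnObj G a = OnObj F u"
      using free_on_hom[OF R A idem_like_hom[OF P A F]] .
    show "\<exists>!G. G \<in> over_hom R A \<and> comp_functor (Tot P) G (mor P R (\<lambda>_. a)) = F"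
    proof (rule ex1I[of _ G])
      have "comp_functor (Tot P) G (mor P R (\<lambda>_. a)) = F"
        using P'(2) m G
        by (intro idem_like_eqI[OF P A over_hom_comp[OF P'(1) m(1) G(1)] F]) simp
      with G show "G \<in> over_hom R A \<and> comp_functor (Tot P) G (mor P R (\<lambda>_. a)) = F" by simp
    next
      fix G' assume G': "G' \<in> over_hom R A \<and> comp_functor (Tot P) G' (mor P R (\<lambda>_. a)) = F"
      then have "OnObj G' a = OnObj F u" using m(2) P'(2) by auto
      then show "G' = G" using G G' free_on_hom_eqI[OF R A] by simp
    qed
  qed
qed

lemma reflection_hom:
  fixes A :: "('u, 'u, 'u, 'u) over"
  assumes R: "is_reflection X P R \<eta>" and A: "discrete_fibration X A" and F: "F \<in> over_hom P A"
  obtains G where "G \<in> over_hom R A" "comp_functor (Tot P) G \<eta> = F"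
  using is_reflectionD(3)[OF R A F] by blast

lemma reflection_id:
  assumes P: "is_over X P" and R: "is_reflection X P R \<eta>" and G: "G \<in> over_hom R R"
    and "comp_functor (Tot P) G \<eta> = \<eta>" and "r \<in> ob R"
  shows "OnObj G r = r"
proof -
  note R' = is_reflectionD[OF R]
  have Ro: "is_over X R" by (rule fib_over[OF R'(1)])
  have "\<eta> = comp_functor (Tot P) (id_functor (Tot R)) \<eta>"
    using over_homD(2)[OF R'(2)]
    by (intro hom_eqI[OF R'(1) P R'(2) over_hom_comp[OF P R'(2) over_hom_id[OF Ro]]]) simp
  then have "G = id_functor (Tot R)"
    using is_reflectionD(3)[OF R R'(1,2)] G assms(4) over_hom_id[OF Ro] by metis
  then show ?thesis using assms(5) by simp
qed

text \<open>Let \<open>q\<close> generate the slice over \<open>x\<close>. The unit point of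
  \<open>R\<close> gives \<open>h\<close> out of the slice, the fixed point \<open>act Q q e\<close>
  gives \<open>s\<close> back through the universal property, and \<open>h\<close> after
  \<open>s\<close> fixes the unit; hence it is the identity and \<open>R\<close> is a retract of the
  slice.\<close>

lemma reflection_free_on:
  assumes e: "idempotent X e" and P: "idem_like X e P u" and R: "is_reflection X P R \<eta>"
  shows "free_on X e R (OnObj \<eta> u)"
proof -
  note R' = is_reflectionD[OF R] and P' = idem_likeD[OF P] and e' = idempotentD[OF e]
  note a = idem_like_hom[OF P R'(1,2)]
  define x where "x = Dom X e"
  have x: "x \<in> Obj X" using e' by (simp add: x_def)
  define Q where "Q = idem_fib (Ide X x)"
  define q where "q = Ide X x"
  have Q: "free_on X (Ide X x) Q q" unfolding Q_def q_def by (rule free_on_idem_fib[OF idempotent_ide[OF x]])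
  note Q' = free_onD[OF Q]
  have q: "q \<in> ob Q" "pob Q q = x" using Q' x by simp_all
  have ae: "act R (OnObj \<eta> u) (Ide X x) = OnObj \<eta> u" using act_ide[OF R'(1) a(1)] a x_def by simp
  obtain h where h: "h \<in> over_hom Q R" "OnObj h q = OnObj \<eta> u"
    by (rule free_on_hom[OF Q R'(1) a(1)]) (use ae a x in \<open>simp_all add: x_def\<close>)
  have qe: "act Q q e \<in> ob Q" "pob Q (act Q q e) = Dom X e"
    using act[OF Q'(2) q(1) e'(1)] e' q by (simp_all add: x_def)
  have "act Q (act Q q e) e = act Q q e"
    using act_comp[OF Q'(2) q(1) e'(1) _ e'(1)] e' q by (simp add: x_def)
  note m = idem_like_mor[OF P Q'(2) qe this]
  obtain s where s: "s \<in> over_hom R Q" "comp_functor (Tot P) s \<eta> = mor P Q (\<lambda>_. act Q q e)"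
    using reflection_hom[OF R Q'(2) m(1)] .
  have sa: "OnObj s (OnObj \<eta> u) = act Q q e" using s(2) m(2) P'(2)
    by (metis comp_functor_at(1) insertI1)
  have hq: "OnObj h (act Q q e) = OnObj \<eta> u"
    using hom_act[OF Q'(2) R'(1) h(1) q(1) e'(1)] h(2) a(3) q e' by (simp add: x_def)
  have Ro: "is_over X R" by (rule fib_over[OF R'(1)])
  have "comp_functor (Tot P) (comp_functor (Tot R) h s) \<eta> = \<eta>"
    using P'(2) sa hq a(1)
    by (intro idem_like_eqI[OF P R'(1) over_hom_comp[OF P'(1) R'(2) over_hom_comp[OF Ro s(1) h(1)]] R'(2)]) simp
  then have hs: "OnObj h (OnObj s r) = r" if "r \<in> ob R" for r
    using reflection_id[OF P'(1) R over_hom_comp[OF Ro s(1) h(1)]] that by simp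
  obtain e1 where e1: "act Q q e1 = OnObj s (OnObj h q)" "e1 \<in> Arr X" "Cod X e1 = x" "free_on X e1 R (OnObj h q)"
    using retract_free_on[OF Q x R'(1) s(1) h(1) hs] .
  \<comment> \<open>The idempotent of the retract and \<open>e\<close> are normal forms of the same
    object \<open>act Q q e\<close> of the slice.\<close>
  have "e1 = e"
    using e1 e' x h(2) sa by - (rule free_on_unique[OF Q], simp_all add: x_def)
  then show ?thesis using e1 h(2) by simp
qed

lemma free_on_down:
  assumes e: "idempotent X e" and P: "idem_like X e P u"
  shows "free_on X e (down X P) (OnObj (down_unit X P) u)"
  using reflection_free_on[OF e P down_reflection[OF free_on_reflection[OF P free_on_idem_fib[OF e]]]] .

end

section \<open>Reflections built from comma categories\<close>

context small_cat
begin

context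
  fixes P :: "('u, 'u, 'u, 'u) over"
  assumes P: "is_over X P"
begin

text \<open>\<open>(p, f)\<close> is an object of the comma category \<open>x/P\<close> with
  \<open>x = Dom X f\<close>. All \<open>x\<close> are treated at once, since the arrows recorded by
  \<open>comma_step\<close> leave \<open>x\<close> unchanged.\<close>

definition comma :: "('u \<times> 'u) set" where
  "comma = {(p, f). p \<in> ob P \<and> f \<in> Arr X \<and> Cod X f = pob P p}"

definition comma_step :: "(('u \<times> 'u) \<times> ('u \<times> 'u)) set" where
  "comma_step = {((Dom (Tot P) u, f), (Cod (Tot P) u, Comp X (par P u) f)) | u f.
     u \<in> ar P \<and> f \<in> Arr X \<and> Cod X f = pob P (Dom (Tot P) u)}"

definition comma_conn :: "(('u \<times> 'u) \<times> ('u \<times> 'u)) set" where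
  "comma_conn = (comma_step \<union> comma_step\<inverse>)\<^sup>*"

lemma comma_conn_refl: "(c, c) \<in> comma_conn"
  by (simp add: comma_conn_def)

lemma comma_conn_sym: "(c, d) \<in> comma_conn \<Longrightarrow> (d, c) \<in> comma_conn"
  unfolding comma_conn_def by (rule symD[OF sym_rtrancl]) (auto simp: sym_def)

lemma comma_conn_trans: "(c, d) \<in> comma_conn \<Longrightarrow> (d, d') \<in> comma_conn \<Longrightarrow> (c, d') \<in> comma_conn"
  unfolding comma_conn_def by (rule rtrancl_trans)

text \<open>The reflection of \<open>P\<close> has as objects over \<open>x\<close> the components of the comma category \<open>x/P\<close>; chosen
  representatives, coded in \<open>'u\<close>, stand for the components.\<close>

definition comma_rep :: "'u \<times> 'u \<Rightarrow> 'u" where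
  "comma_rep c = enc (SOME d. (c, d) \<in> comma_conn)"

lemma comma_conn_rep: "(c, dec (comma_rep c)) \<in> comma_conn"
  unfolding comma_rep_def dec_enc by (rule someI[of "\<lambda>d. (c, d) \<in> comma_conn", OF comma_conn_refl])

text \<open>The choice is made from the whole component, so it depends on the component
  alone.\<close>

lemma comma_rep_eq:
  assumes "(c, d) \<in> comma_conn"
  shows "comma_rep c = comma_rep d"
proof -
  have "(c, d') \<in> comma_conn \<longleftrightarrow> (d, d') \<in> comma_conn" for d'
    using assms comma_conn_sym comma_conn_trans by blast
  then show ?thesis by (simp add: comma_rep_def)
qed

lemma comma_stepE:
  assumes "(c, d) \<in> comma_step"
  obtains u f where "c = (Dom (Tot P) u, f)" "d = (Cod (Tot P) u, Comp X (par P u) f)" "u \<in> ar P" "f \<in> Arr X"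
    "Cod X f = Dom X (par P u)" "par P u \<in> Arr X" "Cod X (par P u) = pob P (Cod (Tot P) u)"
    "Dom (Tot P) u \<in> ob P" "Cod (Tot P) u \<in> ob P"
  using assms is_overD[OF P] unfolding comma_step_def by auto

lemma comma_step_comma:
  assumes "(c, d) \<in> comma_step"
  shows "c \<in> comma" "d \<in> comma" "Dom X (snd c) = Dom X (snd d)"
  using assms by (auto elim!: comma_stepE simp: comma_def is_overD[OF P])

lemma comma_conn_comma:
  assumes "(c, d) \<in> comma_conn" "c \<in> comma"
  shows "d \<in> comma \<and> Dom X (snd d) = Dom X (snd c)"
  using assms(1) unfolding comma_conn_def
proof (induction rule: rtrancl_induct)
  case (step y z)
  then show ?case using comma_step_comma[of y z] comma_step_comma[of z y] by auto
qed (use assms in simp)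

definition comma_act :: "'u \<times> 'u \<Rightarrow> 'u \<Rightarrow> 'u \<times> 'u" where
  "comma_act c g = (fst c, Comp X (snd c) g)"

lemma comma_act:
  assumes "c \<in> comma" "g \<in> Arr X" "Cod X g = Dom X (snd c)"
  shows "comma_act c g \<in> comma" "Dom X (snd (comma_act c g)) = Dom X g"
  using assms by (auto simp: comma_def comma_act_def)

text \<open>Precomposition with \<open>g\<close> turns an arrow of one comma category into an arrow
  of another with the same underlying arrow of \<open>P\<close>, so it preserves zigzags.\<close>

lemma comma_conn_act:
  assumes "(c, d) \<in> comma_conn" "c \<in> comma" and g: "g \<in> Arr X" "Cod X g = Dom X (snd c)"
  shows "(comma_act c g, comma_act d g) \<in> comma_conn"
  using assms(1) unfolding comma_conn_def
proof (induction rule: rtrancl_induct)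
  case (step y z)
  have y: "y \<in> comma" "Dom X (snd y) = Dom X (snd c)"
    using comma_conn_comma[OF _ assms(2), of y] step(1) by (auto simp: comma_conn_def)
  have s: "(comma_act a g, comma_act b g) \<in> comma_step"
    if "(a, b) \<in> comma_step" "Cod X g = Dom X (snd a)" for a b
    using that(1)
  proof (cases rule: comma_stepE)
    case (1 u f)
    have "comma_act a g = (Dom (Tot P) u, Comp X f g)" "comma_act b g = (Cod (Tot P) u, Comp X (par P u) (Comp X f g))"
      using 1 g that(2) by (simp_all add: comma_act_def comp_assoc)
    moreover have "Comp X f g \<in> Arr X" "Cod X (Comp X f g) = pob P (Dom (Tot P) u)"
      using 1 g that(2) is_overD(4)[OF P 1(3)] by simp_all
    ultimately show ?thesis using 1(3) unfolding comma_step_def by blast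
  qed
  have "(comma_act y g, comma_act z g) \<in> comma_step \<union> comma_step\<inverse>"
    using step(2) s[of y z] s[of z y] y g comma_step_comma(3)[of z y] by auto
  then show ?case using step.IH by (rule rtrancl_into_rtrancl[rotated])
qed simp

text \<open>As a presheaf it sends \<open>x\<close> to the components of \<open>x/P\<close>, which
  is the colimit over \<open>P\<close> of the representables at the objects \<open>pob P p\<close>;
  the action is precomposition on representatives.\<close>

definition down_fib :: "('u, 'u, 'u, 'u) over" where
  "down_fib = fib X (comma_rep ` comma) (\<lambda>y. Dom X (snd (dec y))) (\<lambda>y g. comma_rep (comma_act (dec y) g))"

lemma comma_rep:
  assumes "c \<in> comma"
  shows "dec (comma_rep c) \<in> comma" "Dom X (snd (dec (comma_rep c))) = Dom X (snd c)"
  using comma_conn_comma[OF comma_conn_rep assms] by simp_all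

lemma comma_rep_act:
  assumes "c \<in> comma" "g \<in> Arr X" "Cod X g = Dom X (snd c)"
  shows "comma_rep (comma_act (dec (comma_rep c)) g) = comma_rep (comma_act c g)"
  using comma_rep_eq[OF comma_conn_act[OF comma_conn_rep assms]] by simp

lemma down_fib:
  shows "discrete_fibration X down_fib" "ob down_fib = comma_rep ` comma"
    and "c \<in> comma \<Longrightarrow> pob down_fib (comma_rep c) = Dom X (snd c)"
    and "c \<in> comma \<Longrightarrow> g \<in> Arr X \<Longrightarrow> Cod X g = Dom X (snd c) \<Longrightarrow>
      act down_fib (comma_rep c) g = comma_rep (comma_act c g)"
proof -
  let ?E = "comma_rep ` comma" and ?p = "\<lambda>y. Dom X (snd (dec y))" and ?m = "\<lambda>y g. comma_rep (comma_act (dec y) g)"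
  have arr: "snd c \<in> Arr X" if "c \<in> comma" for c using that by (auto simp: comma_def)
  have 1: "?p b \<in> Obj X" if "b \<in> ?E" for b
    using that comma_rep arr by auto
  have 2: "?m b f \<in> ?E" "?p (?m b f) = Dom X f" if b: "b \<in> ?E" "f \<in> Arr X" "Cod X f = ?p b" for b f
  proof -
    obtain c where c: "b = comma_rep c" "c \<in> comma" using b(1) by blast
    have a: "comma_act (dec b) f \<in> comma" "Dom X (snd (comma_act (dec b) f)) = Dom X f"
      using comma_act[OF comma_rep(1)[OF c(2)] b(2)] b(3) c(1) by simp_all
    then show "?m b f \<in> ?E" "?p (?m b f) = Dom X f" using comma_rep[OF a(1)] by simp_all
  qed
  have 3: "?m b (Ide X (?p b)) = b" if b: "b \<in> ?E" for b
  proof -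
    obtain c where c: "b = comma_rep c" "c \<in> comma" using b by blast
    have "comma_act (dec b) (Ide X (?p b)) = dec b"
      using arr[OF comma_rep(1)[OF c(2)]] c(1) by (simp add: comma_act_def)
    then show ?thesis using comma_rep_eq[OF comma_conn_rep, of c] c by simp
  qed
  have 4: "?m b (Comp X f g) = ?m (?m b f) g"
    if b: "b \<in> ?E" and f: "f \<in> Arr X" "Cod X f = ?p b" and g: "g \<in> Arr X" "Cod X g = Dom X f" for b f g
  proof -
    obtain c where c: "b = comma_rep c" "c \<in> comma" using b by blast
    have a: "comma_act (dec b) f \<in> comma" "Dom X (snd (comma_act (dec b) f)) = Dom X f"
      using comma_act[OF comma_rep(1)[OF c(2)] f(1)] f(2) c(1) by simp_all
    have "comma_act (dec b) (Comp X f g) = comma_act (comma_act (dec b) f) g"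
      using arr[OF comma_rep(1)[OF c(2)]] c f g by (simp add: comma_act_def comp_assoc)
    then show ?thesis using comma_rep_act[OF a(1) g(1)] g(2) a(2) by simp
  qed
  note F = fib_fibration[of ?E ?p ?m, folded down_fib_def, OF 1 2 3 4]
  show "discrete_fibration X down_fib" by (rule F(1); assumption)
  show "ob down_fib = ?E" by (rule F(2); assumption)
  assume c: "c \<in> comma"
  have "pob down_fib (comma_rep c) = ?p (comma_rep c)" by (rule F(3); (assumption | rule imageI[OF c]))
  then show "pob down_fib (comma_rep c) = Dom X (snd c)" by (simp only: comma_rep(2)[OF c])
  assume g: "g \<in> Arr X" "Cod X g = Dom X (snd c)"
  have "act down_fib (comma_rep c) g = ?m (comma_rep c) g"
    by (rule F(4); (assumption | simp only: comma_rep(2)[OF c] g imageI[OF c]))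
  then show "act down_fib (comma_rep c) g = comma_rep (comma_act c g)"
    by (simp only: comma_rep_act[OF c g])
qed

definition down_fib_unit :: "('u, 'u, 'u, 'u) funct" where
  "down_fib_unit = mor P down_fib (\<lambda>p. comma_rep (p, Ide X (pob P p)))"

lemma comma_ide: "p \<in> ob P \<Longrightarrow> (p, Ide X (pob P p)) \<in> comma"
  by (simp add: comma_def is_overD[OF P])

text \<open>A morphism \<open>F\<close> into \<open>A\<close> extends by
  \<open>k (p, f) = act A (OnObj F p) f\<close>. Equivariance of \<open>F\<close> makes
  \<open>k\<close> constant along \<open>comma_step\<close>, and the extension is forced because the
  component of \<open>(p, f)\<close> is the unit at \<open>p\<close> acted on by
  \<open>f\<close>.\<close>

lemma down_fib_reflection: "is_reflection X P down_fib down_fib_unit"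
proof -
  let ?h = "\<lambda>p. comma_rep (p, Ide X (pob P p))"
  note D = down_fib(1)
  have "compat P down_fib ?h"
    unfolding compat_def
  proof (intro conjI ballI)
    fix p assume "p \<in> ob P"
    then show "?h p \<in> ob down_fib" "pob down_fib (?h p) = pob P p"
      using comma_ide[of p] down_fib(2,3) is_overD(2)[OF P] by auto
  next
    fix u assume u: "u \<in> ar P"
    note o = is_overD[OF P]
    \<comment> \<open>The arrow \<open>u\<close> joins its domain, paired with an identity, to its
      codomain, paired with the projection of \<open>u\<close>; this single step is the equivariance
      of the unit.\<close>
    have "((Dom (Tot P) u, Ide X (Dom X (par P u))), (Cod (Tot P) u, Comp X (par P u) (Ide X (Dom X (par P u))))) \<in> comma_step"
      unfolding comma_step_def by (rule CollectI, rule exI, rule exI, intro conjI, rule refl) (simp_all add: u o)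
    then have "((Dom (Tot P) u, Ide X (Dom X (par P u))), (Cod (Tot P) u, par P u)) \<in> comma_conn"
      unfolding comma_conn_def by (intro r_into_rtrancl UnI1) (simp add: o(3)[OF u])
    then have "?h (Dom (Tot P) u) = comma_rep (Cod (Tot P) u, par P u)"
      using comma_rep_eq o(4) u by simp
    also have "\<dots> = act down_fib (?h (Cod (Tot P) u)) (par P u)"
      using down_fib(4)[OF comma_ide, of "Cod (Tot P) u" "par P u"] u o by (simp add: comma_act_def)
    finally show "?h (Dom (Tot P) u) = act down_fib (?h (Cod (Tot P) u)) (par P u)" .
  qed
  then have m: "down_fib_unit \<in> over_hom P down_fib" unfolding down_fib_unit_def by (rule mor_hom[OF D P])
  have unit: "OnObj down_fib_unit p = ?h p" if "p \<in> ob P" for p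
    using that by (simp add: down_fib_unit_def)
  show ?thesis
    unfolding is_reflection_def
  proof (intro conjI allI impI ballI D m)
    fix A :: "('u, 'u, 'u, 'u) over" and F
    assume A: "discrete_fibration X A" and F: "F \<in> over_hom P A"
    define k where "k c = act A (OnObj F (fst c)) (snd c)" for c
    have k_step: "k c = k d" if "(c, d) \<in> comma_step" for c d
      using that
    proof (cases rule: comma_stepE)
      case (1 u f)
      have Fu: "OnObj F (Cod (Tot P) u) \<in> ob A" "pob A (OnObj F (Cod (Tot P) u)) = Cod X (par P u)"
        using over_homD(2,4)[OF F 1(9)] 1 by simp_all
      have "OnObj F (Dom (Tot P) u) = act A (OnObj F (Cod (Tot P) u)) (par P u)"
        using hom_compat[OF A F] 1(3) by (simp add: compat_def)
      then show ?thesis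
        using act_comp[OF A Fu(1) 1(6) _ 1(4)] 1 Fu(2) by (simp add: k_def)
    qed
    have k_conn: "k d = k c" if "(c, d) \<in> comma_conn" for c d
      using that unfolding comma_conn_def
      by (induction rule: rtrancl_induct) (auto dest: k_step)
    have k_rep: "k (dec (comma_rep c)) = k c" for c
      by (rule k_conn[OF comma_conn_rep])
    have F_ob: "OnObj F (fst c) \<in> ob A" "pob A (OnObj F (fst c)) = Cod X (snd c)" "snd c \<in> Arr X"
      if "c \<in> comma" for c
      using that over_homD(2,4)[OF F] by (auto simp: comma_def)
    have k_ob: "k c \<in> ob A" "pob A (k c) = Dom X (snd c)" if "c \<in> comma" for c
      using act[OF A] F_ob[OF that] by (simp_all add: k_def)
    have k_act: "k (comma_act c g) = act A (k c) g" if c: "c \<in> comma" "g \<in> Arr X" "Cod X g = Dom X (snd c)" for c g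
      using act_comp[OF A] F_ob[OF c(1)] c by (simp add: k_def comma_act_def)
    have G: "compat down_fib A (\<lambda>y. k (dec y))"
      unfolding compat_def
    proof (intro conjI ballI)
      fix y assume "y \<in> ob down_fib"
      then obtain c where c: "y = comma_rep c" "c \<in> comma" by (auto simp: down_fib(2))
      then show "k (dec y) \<in> ob A" "pob A (k (dec y)) = pob down_fib y"
        using k_ob[OF c(2)] down_fib(3)[OF c(2)] by (simp_all add: k_rep)
    next
      fix u assume u: "u \<in> ar down_fib"
      note o = is_overD[OF fib_over[OF D]]
      obtain c where c: "Cod (Tot down_fib) u = comma_rep c" "c \<in> comma"
        using o(7)[OF u] by (auto simp: down_fib(2))
      have g: "par down_fib u \<in> Arr X" "Cod X (par down_fib u) = Dom X (snd c)"
        using o(3,5)[OF u] down_fib(3)[OF c(2)] c(1) by simp_all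
      have "Dom (Tot down_fib) u = comma_rep (comma_act c (par down_fib u))"
        using act_eq[OF D u] down_fib(4)[OF c(2) g] c(1) by simp
      then show "k (dec (Dom (Tot down_fib) u)) = act A (k (dec (Cod (Tot down_fib) u))) (par down_fib u)"
        using k_act[OF c(2) g] c(1) by (simp add: k_rep)
    qed
    let ?G = "mor down_fib A (\<lambda>y. k (dec y))"
    have G: "?G \<in> over_hom down_fib A" by (rule mor_hom[OF A fib_over[OF D] G])
    have Gc: "OnObj ?G (comma_rep c) = k c" if "c \<in> comma" for c
      using that by (simp add: down_fib(2) k_rep)
    show "\<exists>!G. G \<in> over_hom down_fib A \<and> comp_functor (Tot P) G down_fib_unit = F"
    proof (rule ex1I[of _ ?G])
      have "OnObj (comp_functor (Tot P) ?G down_fib_unit) p = OnObj F p" if p: "p \<in> ob P" for p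
      proof -
        have "k (p, Ide X (pob P p)) = OnObj F p"
          using act_ide[OF A over_homD(2)[OF F p]] over_homD(4)[OF F p] by (simp add: k_def)
        then show ?thesis using p Gc[OF comma_ide[OF p]] unit[OF p] by simp
      qed
      then have "comp_functor (Tot P) ?G down_fib_unit = F"
        by (intro hom_eqI[OF A P over_hom_comp[OF P m G] F])
      with G show "?G \<in> over_hom down_fib A \<and> comp_functor (Tot P) ?G down_fib_unit = F" by simp
    next
      fix G' assume G': "G' \<in> over_hom down_fib A \<and> comp_functor (Tot P) G' down_fib_unit = F"
      show "G' = ?G"
      proof (rule hom_eqI[OF A fib_over[OF D] conjunct1[OF G'] G])
        fix y assume "y \<in> ob down_fib"
        then obtain p f where c: "y = comma_rep (p, f)" "(p, f) \<in> comma" by (auto simp: down_fib(2))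
        then have pf: "p \<in> ob P" "f \<in> Arr X" "Cod X f = pob P p" by (simp_all add: comma_def)
        note ci = comma_ide[OF pf(1)]
        have a: "act down_fib (?h p) f = y"
          using down_fib(4)[OF ci pf(2)] pf c(1) is_overD(2)[OF P pf(1)] by (simp add: comma_act_def)
        have F': "OnObj F p = OnObj G' (?h p)" using G' pf(1) unit by auto
        have hp: "?h p \<in> ob down_fib" "pob down_fib (?h p) = pob P p"
          using down_fib(2,3) ci is_overD(2)[OF P pf(1)] by auto
        have "OnObj G' y = act A (OnObj G' (?h p)) f"
          using hom_act[OF D A conjunct1[OF G'] hp(1) pf(2)] pf hp a by simp
        then show "OnObj G' y = OnObj ?G y" using Gc[OF c(2)] c(1) F' by (simp add: k_def)
      qed
    qed
  qed
qed

end

end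

section \<open>Atoms\<close>

lemma connected_rel_equiv: "equiv (Obj C) (connected_rel C)"
proof -
  let ?R = "(\<lambda>f. (Dom C f, Cod C f)) ` Arr C"
  have "sym ((?R \<union> ?R\<inverse>)\<^sup>*)" by (rule sym_rtrancl) (auto simp: sym_def)
  then show ?thesis
    unfolding connected_rel_def Let_def
    by (intro equivI) (auto simp: refl_on_def sym_def intro!: transI intro: rtrancl_trans)
qed

lemma connected_relI:
  assumes "f \<in> Arr C" "Dom C f \<in> Obj C" "Cod C f \<in> Obj C"
  shows "(Dom C f, Cod C f) \<in> connected_rel C"
  using assms by (auto simp: connected_rel_def Let_def)

text \<open>Stating the step as an equivalence handles both directions of a zigzag at once.\<close>

lemma connected_rel_induct [consumes 1, case_names refl step]:
  assumes "(x, y) \<in> connected_rel C"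
    and "P x"
    and "\<And>f. f \<in> Arr C \<Longrightarrow> P (Dom C f) \<longleftrightarrow> P (Cod C f)"
  shows "P y"
proof -
  let ?R = "(\<lambda>f. (Dom C f, Cod C f)) ` Arr C"
  have "(x, y) \<in> (?R \<union> ?R\<inverse>)\<^sup>*" using assms(1) by (simp add: connected_rel_def Let_def)
  then show ?thesis
    by (induction rule: rtrancl_induct) (use assms(2,3) in auto)
qed

lemma ten_class:
  assumes "d \<in> Obj (fibre_product P A)"
  shows "connected_rel (fibre_product P A) `` {d} \<in> ten P A"
  using assms unfolding ten_def components_def by (rule quotientI)

lemma tenE:
  assumes "c \<in> ten P A"
  obtains d where "d \<in> Obj (fibre_product P A)" "c = connected_rel (fibre_product P A) `` {d}"
  using assms unfolding ten_def components_def by (rule quotientE)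

lemma fibre_product_simps:
  "(p, q) \<in> Obj (fibre_product P Q) \<longleftrightarrow> p \<in> ob P \<and> q \<in> ob Q \<and> pob P p = pob Q q"
  "(s, t) \<in> Arr (fibre_product P Q) \<longleftrightarrow> s \<in> ar P \<and> t \<in> ar Q \<and> par P s = par Q t"
  "Dom (fibre_product P Q) (s, t) = (Dom (Tot P) s, Dom (Tot Q) t)"
  "Cod (fibre_product P Q) (s, t) = (Cod (Tot P) s, Cod (Tot Q) t)"
  by (auto simp: fibre_product_def)

text \<open>\<open>ten_map\<close> saturates the image of a whole component. Applying
  \<open>G\<close> to the arrows of a zigzag shows that this image is connected, so a single
  representative computes it.\<close>

lemma ten_map_class:
  assumes G: "G \<in> over_hom A B" and d: "(p, a) \<in> Obj (fibre_product P A)"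
    and P: "is_over X P" and A: "is_over X A"
  shows "ten_map P B G (connected_rel (fibre_product P A) `` {(p, a)})
    = connected_rel (fibre_product P B) `` {(p, OnObj G a)}"
proof -
  let ?RA = "connected_rel (fibre_product P A)" and ?RB = "connected_rel (fibre_product P B)"
  let ?g = "map_prod (\<lambda>p. p) (OnObj G)"
  note eqB = connected_rel_equiv[of "fibre_product P B"]
  have g: "?g d \<in> Obj (fibre_product P B)" if "d \<in> Obj (fibre_product P A)" for d
    using that over_homD(2,4)[OF G] by (cases d) (auto simp: fibre_product_simps)
  have conn: "?RB `` {?g d} = ?RB `` {?g (p, a)}" if "((p, a), d) \<in> ?RA" for d
    using that
  proof (induction rule: connected_rel_induct)
    case (step u)
    obtain s t where u: "u = (s, t)" "s \<in> ar P" "t \<in> ar A" "par P s = par A t"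
      using step by (cases u) (auto simp: fibre_product_simps)
    let ?u = "(s, OnArr G t)"
    have "?u \<in> Arr (fibre_product P B)"
      using u over_homD[OF G] by (simp add: fibre_product_simps)
    moreover have e: "Dom (fibre_product P B) ?u = ?g (Dom (fibre_product P A) u)"
      "Cod (fibre_product P B) ?u = ?g (Cod (fibre_product P A) u)"
      using u over_homD(6,7)[OF G u(3)] by (simp_all add: fibre_product_simps)
    moreover have "Dom (fibre_product P A) u \<in> Obj (fibre_product P A)"
      "Cod (fibre_product P A) u \<in> Obj (fibre_product P A)"
      using u is_overD(4-7)[OF P u(2)] is_overD(4-7)[OF A u(3)] by (simp_all add: fibre_product_simps)
    ultimately have "(?g (Dom (fibre_product P A) u), ?g (Cod (fibre_product P A) u)) \<in> ?RB"
      using connected_relI[of ?u "fibre_product P B"] g by simp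
    then show ?case using equiv_class_eq[OF eqB] by simp
  qed simp
  have self: "((p, a), (p, a)) \<in> ?RA"
    using d connected_rel_equiv[of "fibre_product P A"] by (auto simp: equiv_def refl_on_def)
  have "?RB `` (?g ` (?RA `` {(p, a)})) = (\<Union>d\<in>?RA `` {(p, a)}. ?RB `` {?g d})"
    by (subst Image_eq_UN) (simp only: image_image)
  also have "\<dots> = (\<Union>d\<in>?RA `` {(p, a)}. ?RB `` {?g (p, a)})" using conn by simp
  also have "\<dots> = ?RB `` {?g (p, a)}" using self by auto
  finally show ?thesis by (simp add: ten_map_def)
qed

section \<open>Reflections of atoms are free on idempotents\<close>

lemma (in small_cat) atom_free_on:
  fixes T :: "('u, 'u, 'u, 'u) over"
  assumes "atom X T"
  obtains e a where "free_on X e (down X T) a"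
proof -
  have T: "is_over X T" using assms by (simp add: atom_def)
  define R where "R = down X T"
  define \<eta> where "\<eta> = down_unit X T"
  have refl: "is_reflection X T R \<eta>"
    unfolding R_def \<eta>_def by (rule down_reflection[OF down_fib_reflection[OF T]])
  note R = is_reflectionD(1)[OF refl] and \<eta> = is_reflectionD(2)[OF refl]
  have Ro: "is_over X R" by (rule fib_over[OF R])
  have "ten_iso_hom T (discrete_fibration X :: ('u, 'u, 'u, 'u) over \<Rightarrow> bool)"
    using assms by (simp add: atom_def)
  then obtain \<phi> where \<phi>: "(\<forall>A :: ('u, 'u, 'u, 'u) over. discrete_fibration X A \<longrightarrow>
        bij_betw (\<phi> A) (ten T A) (over_hom T A)) \<and>
      (\<forall>(A :: ('u, 'u, 'u, 'u) over) B :: ('u, 'u, 'u, 'u) over. discrete_fibration X A \<longrightarrow> discrete_fibration X B \<longrightarrow>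
        (\<forall>G\<in>over_hom A B. \<forall>c\<in>ten T A. \<phi> B (ten_map T B G c) = comp_functor (Tot T) G (\<phi> A c)))"
    unfolding ten_iso_hom_def by (elim exE)
  note bij = conjunct1[OF \<phi>, rule_format] and nat = conjunct2[OF \<phi>, rule_format]
  obtain c where c: "c \<in> ten T R" "\<phi> R c = \<eta>"
    using \<eta> unfolding bij_betw_imp_surj_on[OF bij[OF R], symmetric] by (metis imageE)
  obtain t a where ta: "(t, a) \<in> Obj (fibre_product T R)" "c = connected_rel (fibre_product T R) `` {(t, a)}"
    using tenE[OF c(1)] by (metis surj_pair)
  define x where "x = pob R a"
  have a: "t \<in> ob T" "a \<in> ob R" "pob T t = x" "pob R a = x"
    using ta(1) by (auto simp: fibre_product_simps x_def)
  have x: "x \<in> Obj X" using is_overD(2)[OF T a(1)] a(3) by simp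
  define Q where "Q = idem_fib (Ide X x)"
  define q where "q = Ide X x"
  have Q: "free_on X (Ide X x) Q q" unfolding Q_def q_def by (rule free_on_idem_fib[OF idempotent_ide[OF x]])
  note Q' = free_onD[OF Q]
  have q: "q \<in> ob Q" "pob Q q = x" using Q' x by simp_all
  obtain h where h: "h \<in> over_hom Q R" "OnObj h q = a"
    by (rule free_on_hom[OF Q R a(2)]) (use a x act_ide[OF R a(2)] in simp_all)
  have tq: "(t, q) \<in> Obj (fibre_product T Q)" using a q by (simp add: fibre_product_simps)
  define d where "d = connected_rel (fibre_product T Q) `` {(t, q)}"
  have d: "d \<in> ten T Q" unfolding d_def by (rule ten_class[OF tq])
  have "ten_map T R h d = c"
    using ten_map_class[OF h(1) tq T fib_over[OF Q'(2)]] h(2) ta(2) by (simp add: d_def)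
  then have s0: "comp_functor (Tot T) h (\<phi> Q d) = \<eta>"
    using nat[OF Q'(2) R h(1) d] c(2) by simp
  have s0h: "\<phi> Q d \<in> over_hom T Q"
    using bij[OF Q'(2)] d by (auto simp: bij_betw_def)
  \<comment> \<open>The factorization of the unit found so far starts at \<open>T\<close>. Extending
    its first factor along the unit gives \<open>s\<close> on \<open>R\<close>, and \<open>h\<close>
    after \<open>s\<close> then fixes the unit.\<close>
  obtain s where s: "s \<in> over_hom R Q" "comp_functor (Tot T) s \<eta> = \<phi> Q d"
    using reflection_hom[OF refl Q'(2) s0h] .
  have hsh: "comp_functor (Tot R) h s \<in> over_hom R R" by (rule over_hom_comp[OF Ro s(1) h(1)])
  have "OnObj (comp_functor (Tot T) (comp_functor (Tot R) h s) \<eta>) p = OnObj \<eta> p" if p: "p \<in> ob T" for p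
  proof -
    have "OnObj s (OnObj \<eta> p) = OnObj (\<phi> Q d) p" unfolding s(2)[symmetric] using p by simp
    moreover have "OnObj h (OnObj (\<phi> Q d) p) = OnObj (comp_functor (Tot T) h (\<phi> Q d)) p" using p by simp
    ultimately show ?thesis using p over_homD(2)[OF \<eta> p] unfolding s0 by simp
  qed
  then have "comp_functor (Tot T) (comp_functor (Tot R) h s) \<eta> = \<eta>"
    by (intro hom_eqI[OF R T over_hom_comp[OF T \<eta> hsh] \<eta>])
  then have hs: "OnObj h (OnObj s r) = r" if "r \<in> ob R" for r
    using reflection_id[OF T refl hsh] that by simp
  obtain e where "free_on X e R (OnObj h q)"
    using retract_free_on[OF Q x R s(1) h(1) hs] .
  then show ?thesis using that by (simp add: R_def)
qed

text \<open>The hypotheses are self-dual, so that they cover discrete fibrations (with \<open>\<kappa> a = a \<cdot> e\<close>) and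
  discrete opfibrations (with \<open>\<kappa> a = e \<cdot> a\<close>) alike. A functor from the idempotent atom picks a fixed
  point of \<open>\<kappa>\<close>, and a component of the tensor is a fibre of \<open>\<kappa>\<close>.\<close>

definition over_fibre :: "('p, 'b, 'o, 'a) over \<Rightarrow> 'o \<Rightarrow> 'p set" where
  "over_fibre A x = {a \<in> ob A. pob A a = x}"

definition fibre_retraction ::
  "('o, 'a) cat \<Rightarrow> 'a \<Rightarrow> (('p, 'b, 'o, 'a) over \<Rightarrow> bool) \<Rightarrow> (('p, 'b, 'o, 'a) over \<Rightarrow> 'p \<Rightarrow> 'p) \<Rightarrow> bool" where
  "fibre_retraction X e \<F> \<kappa> \<longleftrightarrow>
     (\<forall>A. \<F> A \<longrightarrow> is_over X A \<and>
       (\<forall>a\<in>over_fibre A (Dom X e). \<kappa> A a \<in> over_fibre A (Dom X e) \<and> \<kappa> A (\<kappa> A a) = \<kappa> A a \<and>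
         (\<exists>t\<in>ar A. par A t = e \<and> {Dom (Tot A) t, Cod (Tot A) t} = {a, \<kappa> A a}) \<and>
         (\<kappa> A a = a \<longrightarrow> (\<forall>f\<in>{Ide X (Dom X e), e}.
            \<exists>!t. t \<in> ar A \<and> par A t = f \<and> Dom (Tot A) t = a \<and> Cod (Tot A) t = a))) \<and>
       (\<forall>t\<in>ar A. par A t \<in> {Ide X (Dom X e), e} \<longrightarrow> \<kappa> A (Dom (Tot A) t) = \<kappa> A (Cod (Tot A) t)) \<and>
       (\<forall>t\<in>ar A. par A t = e \<longrightarrow> Dom (Tot A) t = Cod (Tot A) t \<longrightarrow>
          \<kappa> A (Dom (Tot A) t) = Dom (Tot A) t)) \<and>
     (\<forall>A B G. \<F> A \<longrightarrow> \<F> B \<longrightarrow> G \<in> over_hom A B \<longrightarrow>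
       (\<forall>a\<in>over_fibre A (Dom X e). OnObj G (\<kappa> A a) = \<kappa> B (OnObj G a)))"

lemma fibre_retractionD:
  assumes "fibre_retraction X e \<F> \<kappa>" "\<F> A"
  shows "is_over X A"
    and "a \<in> over_fibre A (Dom X e) \<Longrightarrow> \<kappa> A a \<in> over_fibre A (Dom X e)"
    and "a \<in> over_fibre A (Dom X e) \<Longrightarrow> \<kappa> A (\<kappa> A a) = \<kappa> A a"
    and "a \<in> over_fibre A (Dom X e) \<Longrightarrow> \<exists>t\<in>ar A. par A t = e \<and> {Dom (Tot A) t, Cod (Tot A) t} = {a, \<kappa> A a}"
    and "a \<in> over_fibre A (Dom X e) \<Longrightarrow> \<kappa> A a = a \<Longrightarrow> f \<in> {Ide X (Dom X e), e} \<Longrightarrow>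
      \<exists>!t. t \<in> ar A \<and> par A t = f \<and> Dom (Tot A) t = a \<and> Cod (Tot A) t = a"
    and "t \<in> ar A \<Longrightarrow> par A t \<in> {Ide X (Dom X e), e} \<Longrightarrow> \<kappa> A (Dom (Tot A) t) = \<kappa> A (Cod (Tot A) t)"
    and "t \<in> ar A \<Longrightarrow> par A t = e \<Longrightarrow> Dom (Tot A) t = Cod (Tot A) t \<Longrightarrow> \<kappa> A (Dom (Tot A) t) = Dom (Tot A) t"
    and "\<F> B \<Longrightarrow> G \<in> over_hom A B \<Longrightarrow> a \<in> over_fibre A (Dom X e) \<Longrightarrow> OnObj G (\<kappa> A a) = \<kappa> B (OnObj G a)"
proof -
  note D = assms(1)[unfolded fibre_retraction_def, THEN conjunct1, rule_format, OF assms(2)]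
  note E = D[THEN conjunct2, THEN conjunct1, rule_format]
  show "is_over X A" by (rule D[THEN conjunct1])
  show "t \<in> ar A \<Longrightarrow> par A t \<in> {Ide X (Dom X e), e} \<Longrightarrow> \<kappa> A (Dom (Tot A) t) = \<kappa> A (Cod (Tot A) t)"
    by (rule D[THEN conjunct2, THEN conjunct2, THEN conjunct1, rule_format])
  show "t \<in> ar A \<Longrightarrow> par A t = e \<Longrightarrow> Dom (Tot A) t = Cod (Tot A) t \<Longrightarrow> \<kappa> A (Dom (Tot A) t) = Dom (Tot A) t"
    by (rule D[THEN conjunct2, THEN conjunct2, THEN conjunct2, rule_format])
  show "\<F> B \<Longrightarrow> G \<in> over_hom A B \<Longrightarrow> a \<in> over_fibre A (Dom X e) \<Longrightarrow> OnObj G (\<kappa> A a) = \<kappa> B (OnObj G a)"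
    by (rule assms(1)[unfolded fibre_retraction_def, THEN conjunct2, rule_format, OF assms(2)])
  assume a: "a \<in> over_fibre A (Dom X e)"
  show "\<kappa> A a \<in> over_fibre A (Dom X e)" "\<kappa> A (\<kappa> A a) = \<kappa> A a"
    "\<exists>t\<in>ar A. par A t = e \<and> {Dom (Tot A) t, Cod (Tot A) t} = {a, \<kappa> A a}"
    using E[OF a] by simp_all
  show "\<kappa> A a = a \<Longrightarrow> f \<in> {Ide X (Dom X e), e} \<Longrightarrow>
      \<exists>!t. t \<in> ar A \<and> par A t = f \<and> Dom (Tot A) t = a \<and> Cod (Tot A) t = a"
    by (rule E[OF a, THEN conjunct2, THEN conjunct2, THEN conjunct2, rule_format])
qed

section \<open>Idempotents are atoms\<close>

context base_cat
begin

context
  fixes e and P :: "('p, 'b, 'o, 'a) over" and u and \<F> :: "('q, 'c, 'o, 'a) over \<Rightarrow> bool" and \<kappa>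
  assumes P: "idem_like X e P u" and \<kappa>: "fibre_retraction X e \<F> \<kappa>"
begin

text \<open>\<open>mor\<close> lifts from the codomain and so is suited to fibrations; naming both
  ends of the arrow treats opfibrations as well.\<close>

definition elt :: "('q, 'c, 'o, 'a) over \<Rightarrow> 'q \<Rightarrow> ('p, 'b, 'q, 'c) funct" where
  "elt A b = \<lparr>OnObj = restrict (\<lambda>_. b) (ob P), OnArr = restrict (\<lambda>s. THE t. t \<in> ar A \<and> par A t = par P s \<and>
      Dom (Tot A) t = b \<and> Cod (Tot A) t = b) (ar P)\<rparr>"

lemma elt_ex1:
  assumes "\<F> A" "b \<in> over_fibre A (Dom X e)" "\<kappa> A b = b" "f = Ide X (Dom X e) \<or> f = e"
  shows "\<exists>!t. t \<in> ar A \<and> par A t = f \<and> Dom (Tot A) t = b \<and> Cod (Tot A) t = b"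
  by (rule fibre_retractionD(5)[OF \<kappa> assms(1-3)]) (use assms(4) in simp)

lemma elt_eqI:
  assumes "\<F> A" "b \<in> over_fibre A (Dom X e)" "\<kappa> A b = b" "s \<in> ar P" "t \<in> ar A" "par A t = par P s"
    "Dom (Tot A) t = b" "Cod (Tot A) t = b"
  shows "OnArr (elt A b) s = t"
  using the1_equality[OF elt_ex1[OF assms(1-3) idem_likeD(6)[OF P assms(4)]], of t] assms(4-)
  by (simp add: elt_def)

lemma elt_arr:
  assumes "\<F> A" "b \<in> over_fibre A (Dom X e)" "\<kappa> A b = b" "s \<in> ar P"
  shows "OnArr (elt A b) s \<in> ar A" "par A (OnArr (elt A b) s) = par P s"
    "Dom (Tot A) (OnArr (elt A b) s) = b" "Cod (Tot A) (OnArr (elt A b) s) = b"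
  using theI'[OF elt_ex1[OF assms(1-3) idem_likeD(6)[OF P assms(4)]]] assms(4)
  by (simp_all add: elt_def)

lemma elt_hom:
  assumes A: "\<F> A" and b: "b \<in> over_fibre A (Dom X e)" "\<kappa> A b = b"
  shows "elt A b \<in> over_hom P A" "OnObj (elt A b) u = b"
proof -
  note P' = idem_likeD[OF P]
  interpret P: base_cat "Tot P" using is_overD(1)[OF P'(1)] .
  have Ao: "is_over X A" by (rule fibre_retractionD(1)[OF \<kappa> A])
  interpret A: base_cat "Tot A" using is_overD(1)[OF Ao] .
  have bA: "b \<in> ob A" "pob A b = Dom X e" using b by (auto simp: over_fibre_def)
  note arr = elt_arr[OF A b]
  have obj: "OnObj (elt A b) p = b" if "p \<in> ob P" for p using that by (simp add: elt_def)
  then show "OnObj (elt A b) u = b" using P'(2) by simp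
  show "elt A b \<in> over_hom P A"
  proof (rule over_homI[OF P'(1) Ao])
    show "is_functor (Tot P) (Tot A) (elt A b)"
      unfolding is_functor_def
    proof (intro conjI ballI impI)
      show "OnObj (elt A b) \<in> ob P \<rightarrow>\<^sub>E ob A" using bA by (simp add: elt_def)
      show "OnArr (elt A b) \<in> ar P \<rightarrow>\<^sub>E ar A"
        using arr(1) by (auto simp: elt_def)
    next
      fix p assume "p \<in> ob P"
      then show "OnArr (elt A b) (Ide (Tot P) p) = Ide (Tot A) (OnObj (elt A b) p)"
        using bA P'(2,3) is_overD(8)[OF P'(1)] is_overD(8)[OF Ao] obj by (intro elt_eqI[OF A b]) simp_all
    next
      fix f g assume fg: "f \<in> ar P" "g \<in> ar P" "Dom (Tot P) g = Cod (Tot P) f"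
      then show "OnArr (elt A b) (Comp (Tot P) g f) = Comp (Tot A) (OnArr (elt A b) g) (OnArr (elt A b) f)"
        using arr[OF fg(1)] arr[OF fg(2)] is_overD(9)[OF P'(1) fg]
          is_overD(9)[OF Ao arr(1)[OF fg(1)] arr(1)[OF fg(2)]]
        by (intro elt_eqI[OF A b]) simp_all
    qed (use arr obj P'(2,4,5) in simp_all)
  qed (use arr obj bA P'(2,3) in simp_all)
qed

text \<open>An arrow of \<open>P\<close> over \<open>e\<close> goes to a loop over \<open>e\<close>,
  whose vertex \<open>\<kappa>\<close> fixes. The values on arrows are then forced, since that
  vertex has only one loop over the identity and one over \<open>e\<close>.\<close>

lemma hom_elt:
  assumes A: "\<F> A" and F: "F \<in> over_hom P A"
  shows "OnObj F u \<in> over_fibre A (Dom X e)" "\<kappa> A (OnObj F u) = OnObj F u" "F = elt A (OnObj F u)"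
proof -
  note P' = idem_likeD[OF P]
  show b: "OnObj F u \<in> over_fibre A (Dom X e)"
    using over_homD(2,4)[OF F, of u] P'(2,3) by (simp add: over_fibre_def)
  obtain s where s: "s \<in> ar P" "par P s = e" using P'(7) by blast
  show k: "\<kappa> A (OnObj F u) = OnObj F u"
    using fibre_retractionD(7)[OF \<kappa> A over_homD(3)[OF F s(1)]] over_homD(5-7)[OF F s(1)] s P'(4,5)[OF s(1)]
    by simp
  show "F = elt A (OnObj F u)"
  proof (rule functor_eqI[OF over_homD(1)[OF F] over_homD(1)[OF elt_hom(1)[OF A b k]]])
    fix s assume s: "s \<in> ar P"
    show "OnArr F s = OnArr (elt A (OnObj F u)) s"
      using over_homD(3,5,6,7)[OF F s] P'(4,5)[OF s] s by (intro elt_eqI[OF A b k, symmetric]) simp_all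
  qed (use P'(2) elt_hom(2)[OF A b k] in simp)
qed

text \<open>\<open>P\<close> has arrows only over the identity and over \<open>e\<close>, and
  \<open>\<kappa>\<close> agrees at the two ends of every arrow of \<open>A\<close> over one of
  these. Conversely, every \<open>a\<close> is joined to \<open>\<kappa> A a\<close> by an arrow
  over \<open>e\<close>.\<close>

lemma connected_fibre:
  assumes A: "\<F> A" and a: "a \<in> over_fibre A (Dom X e)" and b: "b \<in> over_fibre A (Dom X e)"
  shows "((u, a), (u, b)) \<in> connected_rel (fibre_product P A) \<longleftrightarrow> \<kappa> A a = \<kappa> A b"
proof
  note P' = idem_likeD[OF P]
  let ?R = "connected_rel (fibre_product P A)"
  note eq = connected_rel_equiv[of "fibre_product P A"]
  {
    assume "((u, a), (u, b)) \<in> ?R"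
    then have "\<kappa> A (snd (u, a)) = \<kappa> A (snd (u, b))"
    proof (induction rule: connected_rel_induct)
      case (step f)
      obtain s t where f: "f = (s, t)" "s \<in> ar P" "t \<in> ar A" "par P s = par A t"
        using step by (cases f) (auto simp: fibre_product_simps)
      have "\<kappa> A (Dom (Tot A) t) = \<kappa> A (Cod (Tot A) t)"
        using fibre_retractionD(6)[OF \<kappa> A f(3)] P'(6)[OF f(2)] f(4) by simp
      then show ?case using f by (simp add: fibre_product_simps)
    qed simp
    then show "\<kappa> A a = \<kappa> A b" by simp
  }
  have conn: "((u, a), (u, \<kappa> A a)) \<in> ?R" if a: "a \<in> over_fibre A (Dom X e)" for a
  proof -
    have k: "\<kappa> A a \<in> over_fibre A (Dom X e)"
      "\<exists>t\<in>ar A. par A t = e \<and> {Dom (Tot A) t, Cod (Tot A) t} = {a, \<kappa> A a}"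
      using fibre_retractionD(2,4)[OF \<kappa> A a] by simp_all
    then obtain t where t: "t \<in> ar A" "par A t = e" "{Dom (Tot A) t, Cod (Tot A) t} = {a, \<kappa> A a}" by blast
    obtain s where s: "s \<in> ar P" "par P s = e" using P'(7) by blast
    have ob: "(u, a) \<in> Obj (fibre_product P A)" "(u, \<kappa> A a) \<in> Obj (fibre_product P A)"
      using a k P'(2,3) by (auto simp: fibre_product_simps over_fibre_def)
    have st: "(s, t) \<in> Arr (fibre_product P A)" "Dom (fibre_product P A) (s, t) = (u, Dom (Tot A) t)"
      "Cod (fibre_product P A) (s, t) = (u, Cod (Tot A) t)"
      using s t P'(4,5)[OF s(1)] by (simp_all add: fibre_product_simps)
    \<comment> \<open>In a fibration the arrow over \<open>e\<close> starts at
      \<open>\<kappa> A a\<close>; in an opfibration it ends there.\<close>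
    from t(3) consider "Dom (Tot A) t = a" "Cod (Tot A) t = \<kappa> A a" | "Dom (Tot A) t = \<kappa> A a" "Cod (Tot A) t = a"
      by (auto simp: doubleton_eq_iff)
    then show ?thesis
    proof cases
      case 1
      then show ?thesis using connected_relI[OF st(1)] st ob by simp
    next
      case 2
      then have "((u, \<kappa> A a), (u, a)) \<in> ?R" using connected_relI[OF st(1)] st ob by simp
      then show ?thesis using eq by (auto simp: equiv_def sym_def)
    qed
  qed
  assume "\<kappa> A a = \<kappa> A b"
  then have "?R `` {(u, a)} = ?R `` {(u, b)}"
    using equiv_class_eq[OF eq conn[OF a]] equiv_class_eq[OF eq conn[OF b]] by simp
  moreover have "(u, b) \<in> Obj (fibre_product P A)"
    using b P'(2,3) by (auto simp: fibre_product_simps over_fibre_def)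
  ultimately show "((u, a), (u, b)) \<in> ?R" using eq_equiv_class[OF _ eq] by blast
qed

lemma idem_like_ten_iso_hom: "ten_iso_hom P \<F>"
proof -
  note P' = idem_likeD[OF P]
  let ?R = "\<lambda>A. connected_rel (fibre_product P A)"
  \<comment> \<open>An arbitrary member of the component is chosen; \<open>\<kappa>\<close> takes
    one value on all of them.\<close>
  define \<phi> where "\<phi> A c = elt A (\<kappa> A (snd (SOME d. d \<in> c)))" for A and c :: "('p \<times> 'q) set"
  have ob: "(p, a) \<in> Obj (fibre_product P A) \<longleftrightarrow> p = u \<and> a \<in> over_fibre A (Dom X e)" for p and a and A :: "('q, 'c, 'o, 'a) over"
    using P'(2,3) by (auto simp: fibre_product_simps over_fibre_def)
  have cls: "\<exists>a. a \<in> over_fibre A (Dom X e) \<and> c = ?R A `` {(u, a)}" if "c \<in> ten P A" for c and A :: "('q, 'c, 'o, 'a) over"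
    using that by (rule tenE) (auto simp: ob)
  have \<phi>: "\<phi> A (?R A `` {(u, a)}) = elt A (\<kappa> A a)" if A: "\<F> A" and a: "a \<in> over_fibre A (Dom X e)" for A a
  proof -
    let ?c = "?R A `` {(u, a)}"
    note eq = connected_rel_equiv[of "fibre_product P A"]
    have "(u, a) \<in> ?c" using eq ob[of u a A] a by (auto simp: equiv_def refl_on_def)
    then have d: "(SOME d. d \<in> ?c) \<in> ?c" by (rule someI)
    have "(SOME d. d \<in> ?c) \<in> Obj (fibre_product P A)"
      using d by (auto simp: connected_rel_def Let_def)
    then obtain b where b: "(SOME d. d \<in> ?c) = (u, b)" "b \<in> over_fibre A (Dom X e)"
      using ob by (cases "SOME d. d \<in> ?c") auto
    then have "\<kappa> A a = \<kappa> A b" using d connected_fibre[OF A a b(2)] by simp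
    then show ?thesis using b by (simp add: \<phi>_def)
  qed
  have k: "\<kappa> A a \<in> over_fibre A (Dom X e)" "\<kappa> A (\<kappa> A a) = \<kappa> A a" if "\<F> A" "a \<in> over_fibre A (Dom X e)" for A a
    using fibre_retractionD(2,3)[OF \<kappa> that] by simp_all
  have "bij_betw (\<phi> A) (ten P A) (over_hom P A)" if A: "\<F> A" for A
  proof (rule bij_betwI')
    fix c c' assume "c \<in> ten P A" "c' \<in> ten P A"
    then obtain a a' where a: "a \<in> over_fibre A (Dom X e)" "c = ?R A `` {(u, a)}"
      and a': "a' \<in> over_fibre A (Dom X e)" "c' = ?R A `` {(u, a')}"
      using cls by metis
    show "\<phi> A c = \<phi> A c' \<longleftrightarrow> c = c'"
    proof
      assume "\<phi> A c = \<phi> A c'"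
      then have "OnObj (elt A (\<kappa> A a)) u = OnObj (elt A (\<kappa> A a')) u"
        using \<phi>[OF A a(1)] \<phi>[OF A a'(1)] a a' by simp
      then have "\<kappa> A a = \<kappa> A a'"
        using elt_hom(2)[OF A k[OF A a(1)]] elt_hom(2)[OF A k[OF A a'(1)]] by simp
      then have "((u, a), (u, a')) \<in> ?R A" using connected_fibre[OF A a(1) a'(1)] by simp
      then show "c = c'" unfolding a(2) a'(2) by (rule equiv_class_eq[OF connected_rel_equiv])
    qed simp
  next
    fix c assume "c \<in> ten P A"
    then obtain a where a: "a \<in> over_fibre A (Dom X e)" "c = ?R A `` {(u, a)}" using cls by metis
    show "\<phi> A c \<in> over_hom P A" unfolding a(2) \<phi>[OF A a(1)] by (rule elt_hom(1)[OF A k[OF A a(1)]])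
  next
    fix F assume F: "F \<in> over_hom P A"
    note b = hom_elt[OF A F]
    have "?R A `` {(u, OnObj F u)} \<in> ten P A" by (rule ten_class) (simp add: ob b(1))
    moreover have "F = \<phi> A (?R A `` {(u, OnObj F u)})"
      unfolding \<phi>[OF A b(1)] b(2) by (rule b(3))
    ultimately show "\<exists>c\<in>ten P A. F = \<phi> A c" by blast
  qed
  moreover have "\<phi> B (ten_map P B G c) = comp_functor (Tot P) G (\<phi> A c)"
    if A: "\<F> A" and B: "\<F> B" and G: "G \<in> over_hom A B" and c: "c \<in> ten P A" for A B G c
  proof -
    obtain a where a: "a \<in> over_fibre A (Dom X e)" "c = ?R A `` {(u, a)}" using cls[OF c] by blast
    have Ao: "is_over X A" by (rule fibre_retractionD(1)[OF \<kappa> A])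
    have Ga: "OnObj G a \<in> over_fibre B (Dom X e)"
      using a(1) over_homD(2,4)[OF G] by (simp add: over_fibre_def)
    have Gk: "OnObj G (\<kappa> A a) = \<kappa> B (OnObj G a)"
      by (rule fibre_retractionD(8)[OF \<kappa> A B G a(1)])
    have "\<phi> B (ten_map P B G c) = elt B (\<kappa> B (OnObj G a))"
      using ten_map_class[OF G _ P'(1) Ao, of u a] a(1) ob \<phi>[OF B Ga] by (simp add: a(2))
    moreover have h: "elt A (\<kappa> A a) \<in> over_hom P A" "OnObj (elt A (\<kappa> A a)) u = \<kappa> A a"
      using elt_hom[OF A k[OF A a(1)]] by simp_all
    have "comp_functor (Tot P) G (elt A (\<kappa> A a)) = elt B (\<kappa> B (OnObj G a))"
      using hom_elt(3)[OF B over_hom_comp[OF P'(1) h(1) G]] h(2) Gk P'(2) by simp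
    ultimately show ?thesis using \<phi>[OF A a(1)] a(2) by simp
  qed
  ultimately show ?thesis unfolding ten_iso_hom_def by blast
qed

end

text \<open>Idempotence of \<open>e\<close> makes the action of \<open>e\<close> a retraction of the
  fibre onto its fixed points, and a loop over \<open>e\<close> witnesses that its vertex is
  fixed.\<close>

lemma fibre_retraction_fibration:
  assumes e: "idempotent X e"
  shows "fibre_retraction X e (discrete_fibration X :: ('p, 'b, 'o, 'a) over \<Rightarrow> bool) (\<lambda>A a. act A a e)"
proof -
  note e' = idempotentD[OF e]
  show ?thesis
    unfolding fibre_retraction_def
  proof (intro conjI allI impI ballI)
    fix A :: "('p, 'b, 'o, 'a) over" assume A: "discrete_fibration X A"
    show Ao: "is_over X A" by (rule fib_over[OF A])
    fix a assume "a \<in> over_fibre A (Dom X e)"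
    then have a: "a \<in> ob A" "pob A a = Dom X e" by (simp_all add: over_fibre_def)
    have ae: "act A a e \<in> ob A" "pob A (act A a e) = Dom X e"
      using act[OF A a(1) e'(1)] a e' by simp_all
    then show "act A a e \<in> over_fibre A (Dom X e)" by (simp add: over_fibre_def)
    show "act A (act A a e) e = act A a e"
      using act_comp[OF A a(1) e'(1) _ e'(1)] e' a by simp
    have "{Dom (Tot A) (lift A e a), Cod (Tot A) (lift A e a)} = {a, act A a e}"
      using lift(2)[OF A a(1) e'(1)] e' a by (auto simp: act_def)
    then show "\<exists>t\<in>ar A. par A t = e \<and> {Dom (Tot A) t, Cod (Tot A) t} = {a, act A a e}"
      using lift(1,3)[OF A a(1) e'(1)] e' a by auto
    fix f assume k: "act A a e = a" and "f \<in> {Ide X (Dom X e), e}"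
    then have f: "f \<in> Arr X" "Cod X f = Dom X e" "act A a f = a"
      using e' act_ide[OF A a(1)] a by auto
    show "\<exists>!t. t \<in> ar A \<and> par A t = f \<and> Dom (Tot A) t = a \<and> Cod (Tot A) t = a"
    proof (rule ex1I[of _ "lift A f a"])
      show "lift A f a \<in> ar A \<and> par A (lift A f a) = f \<and> Dom (Tot A) (lift A f a) = a \<and> Cod (Tot A) (lift A f a) = a"
        using lift[OF A a(1) f(1)] f a by (simp add: act_def)
    next
      fix t assume "t \<in> ar A \<and> par A t = f \<and> Dom (Tot A) t = a \<and> Cod (Tot A) t = a"
      then show "t = lift A f a" using lift_eq[OF A, of t a f] by simp
    qed
  next
    fix A :: "('p, 'b, 'o, 'a) over" and t assume A: "discrete_fibration X A" and t: "t \<in> ar A"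
      "par A t \<in> {Ide X (Dom X e), e}"
    have Ao: "is_over X A" by (rule fib_over[OF A])
    have c: "Cod (Tot A) t \<in> ob A" "pob A (Cod (Tot A) t) = Dom X e"
      using is_overD(5,7)[OF Ao t(1)] t(2) e' by auto
    have "act A (act A (Cod (Tot A) t) e) e = act A (Cod (Tot A) t) e"
      using act_comp[OF A c(1) e'(1) _ e'(1)] e' c by simp
    moreover have "act A (Cod (Tot A) t) (Ide X (Dom X e)) = Cod (Tot A) t"
      using act_ide[OF A c(1)] c by simp
    ultimately show "act A (Dom (Tot A) t) e = act A (Cod (Tot A) t) e"
      using act_eq[OF A t(1)] t(2) by auto
  next
    fix A :: "('p, 'b, 'o, 'a) over" and t assume A: "discrete_fibration X A" and t: "t \<in> ar A"
      "par A t = e" "Dom (Tot A) t = Cod (Tot A) t"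
    then show "act A (Dom (Tot A) t) e = Dom (Tot A) t"
      using act_eq[OF A t(1)] by simp
  next
    fix A B :: "('p, 'b, 'o, 'a) over" and G a
    assume AB: "discrete_fibration X A" "discrete_fibration X B" and G: "G \<in> over_hom A B"
      and a: "a \<in> over_fibre A (Dom X e)"
    then show "OnObj G (act A a e) = act B (OnObj G a) e"
      using hom_act[OF AB G _ e'(1)] e' by (simp add: over_fibre_def)
  qed
qed

end

section \<open>Opfibrations as fibrations over the opposite category\<close>

lemma opposite_simps [simp]:
  "Obj (opposite C) = Obj C" "Arr (opposite C) = Arr C" "Dom (opposite C) = Cod C" "Cod (opposite C) = Dom C"
  "Ide (opposite C) = Ide C" "Comp (opposite C) g f = Comp C f g"
  by (simp_all add: opposite_def)

lemma category_opposite: "category C \<Longrightarrow> category (opposite C)"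
  by (auto simp: category_def Hom_def)

lemma is_functor_opposite: "is_functor C D F \<Longrightarrow> is_functor (opposite C) (opposite D) F"
  by (auto simp: is_functor_def)

definition opp_over :: "('p, 'b, 'o, 'a) over \<Rightarrow> ('p, 'b, 'o, 'a) over" where
  "opp_over A = \<lparr>Tot = opposite (Tot A), Proj = Proj A\<rparr>"

lemma opp_over_simps [simp]: "Tot (opp_over A) = opposite (Tot A)" "Proj (opp_over A) = Proj A"
  by (simp_all add: opp_over_def)

lemma discrete_opfibration_opp:
  "discrete_opfibration X A \<Longrightarrow> discrete_fibration (opposite X) (opp_over A)"
  by (simp add: discrete_opfibration_def discrete_fibration_def is_over_def category_opposite is_functor_opposite)

lemma over_hom_opp: "G \<in> over_hom A B \<Longrightarrow> G \<in> over_hom (opp_over A) (opp_over B)"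
  by (simp add: over_hom_def is_functor_opposite comp_functor_def)

context base_cat
begin

text \<open>Lifting by codomain in \<open>opp_over A\<close> is lifting by domain in
  \<open>A\<close>, so \<open>act (opp_over A) a e\<close> is the covariant action, and all
  conditions are inherited from the fibration case over \<open>opposite X\<close>.\<close>

lemma fibre_retraction_opfibration:
  assumes e: "idempotent X e"
  shows "fibre_retraction X e (discrete_opfibration X :: ('p, 'b, 'o, 'a) over \<Rightarrow> bool) (\<lambda>A a. act (opp_over A) a e)"
proof -
  interpret op: base_cat "opposite X" by unfold_locales (rule category_opposite[OF category])
  have e': "idempotent (opposite X) e" using e by (simp add: idempotent_def)
  have d: "Cod X e = Dom X e" using idempotentD[OF e] by simp
  have fr: "fibre_retraction (opposite X) e (discrete_fibration (opposite X) :: ('p, 'b, 'o, 'a) over \<Rightarrow> bool) (\<lambda>A a. act A a e)"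
    by (rule op.fibre_retraction_fibration[OF e'])
  have F: "over_fibre (opp_over A) = over_fibre A" for A :: "('p, 'b, 'o, 'a) over"
    by (simp add: over_fibre_def fun_eq_iff)
  have ov: "is_over X A" if "discrete_opfibration X A" for A :: "('p, 'b, 'o, 'a) over"
    using that by (simp add: discrete_opfibration_def)
  note all = fibre_retractionD[OF fr discrete_opfibration_opp, unfolded F, simplified d opposite_simps opp_over_simps]
  show ?thesis
    unfolding fibre_retraction_def
  proof (intro conjI allI impI ballI)
    fix A :: "('p, 'b, 'o, 'a) over" and a assume A: "discrete_opfibration X A"
    show "is_over X A" by (rule ov[OF A])
    assume a: "a \<in> over_fibre A (Dom X e)"
    show "act (opp_over A) a e \<in> over_fibre A (Dom X e)" "act (opp_over A) (act (opp_over A) a e) e = act (opp_over A) a e"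
      using all(2,3)[OF A] a by simp_all
    show "\<exists>t\<in>ar A. par A t = e \<and> {Dom (Tot A) t, Cod (Tot A) t} = {a, act (opp_over A) a e}"
      using all(4)[OF A] a by (simp add: insert_commute)
    fix f assume f: "act (opp_over A) a e = a" "f \<in> {Ide X (Dom X e), e}"
    have "\<exists>!t. t \<in> ar A \<and> par A t = f \<and> Cod (Tot A) t = a \<and> Dom (Tot A) t = a"
      using fibre_retractionD(5)[OF fr discrete_opfibration_opp[OF A], unfolded F, of a f] a f d by simp
    then show "\<exists>!t. t \<in> ar A \<and> par A t = f \<and> Dom (Tot A) t = a \<and> Cod (Tot A) t = a"
      by (simp add: conj_commute)
  next
    fix A :: "('p, 'b, 'o, 'a) over" and t assume A: "discrete_opfibration X A" and t: "t \<in> ar A"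
    { assume "par A t \<in> {Ide X (Dom X e), e}"
      then show "act (opp_over A) (Dom (Tot A) t) e = act (opp_over A) (Cod (Tot A) t) e"
        using fibre_retractionD(6)[OF fr discrete_opfibration_opp[OF A], of t] t d by simp }
    assume "par A t = e" "Dom (Tot A) t = Cod (Tot A) t"
    then show "act (opp_over A) (Dom (Tot A) t) e = Dom (Tot A) t"
      using fibre_retractionD(7)[OF fr discrete_opfibration_opp[OF A], of t] t d by simp
  next
    fix A B :: "('p, 'b, 'o, 'a) over" and G a
    assume AB: "discrete_opfibration X A" "discrete_opfibration X B" and G: "G \<in> over_hom A B"
      and a: "a \<in> over_fibre A (Dom X e)"
    show "OnObj G (act (opp_over A) a e) = act (opp_over B) (OnObj G a) e"
      using fibre_retractionD(8)[OF fr discrete_opfibration_opp[OF AB(1)] discrete_opfibration_opp[OF AB(2)] over_hom_opp[OF G], of a] a d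
      by (simp add: F)
  qed
qed

text \<open>A copy of the idempotent atom with objects and arrows in the universe of \<open>X\<close> (the one-object
  category is the terminal one if \<open>e\<close> is an identity).\<close>

definition idem_subcat :: "'a \<Rightarrow> ('o, 'a, 'o, 'a) over" where
  "idem_subcat e = (let C = X\<lparr>Obj := {Dom X e}, Arr := {Ide X (Dom X e), e}\<rparr> in \<lparr>Tot = C, Proj = id_functor C\<rparr>)"

lemma idem_like_idem_subcat:
  assumes e: "idempotent X e"
  shows "idem_like X e (idem_subcat e) (Dom X e)"
proof -
  note e' = idempotentD[OF e]
  have "category (Tot (idem_subcat e))"
    using e' by (auto simp: idem_subcat_def Let_def category_def Hom_def)
  moreover have "is_functor (Tot (idem_subcat e)) X (Proj (idem_subcat e))"
    using e' by (auto simp: idem_subcat_def Let_def is_functor_def id_functor_def)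
  ultimately show ?thesis
    by (simp add: idem_like_def is_over_def) (auto simp: idem_subcat_def Let_def id_functor_def)
qed

end

lemma (in small_cat) atom_idem_subcat:
  assumes e: "idempotent X e"
  shows "atom X (idem_subcat e)"
  unfolding atom_def using idem_likeD(1)[OF idem_like_idem_subcat[OF e]]
    idem_like_ten_iso_hom[OF idem_like_idem_subcat[OF e] fibre_retraction_fibration[OF e]]
    idem_like_ten_iso_hom[OF idem_like_idem_subcat[OF e] fibre_retraction_opfibration[OF e]]
  by blast

section \<open>Equivalences of categories\<close>

context base_cat
begin

lemma Hom_arr: "f \<in> Hom X x y \<Longrightarrow> f \<in> Arr X \<and> Dom X f = x \<and> Cod X f = y \<and> x \<in> Obj X \<and> y \<in> Obj X"
  by (auto simp: Hom_def)

lemma arr_Hom: "f \<in> Arr X \<Longrightarrow> f \<in> Hom X (Dom X f) (Cod X f)"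
  by (simp add: Hom_def)

lemma ide_Hom: "x \<in> Obj X \<Longrightarrow> Ide X x \<in> Hom X x x"
  by (simp add: Hom_def)

lemma comp_Hom: "f \<in> Hom X x y \<Longrightarrow> g \<in> Hom X y z \<Longrightarrow> Comp X g f \<in> Hom X x z"
  by (simp add: Hom_def)

lemma Hom_assoc:
  "f \<in> Hom X x y \<Longrightarrow> g \<in> Hom X y z \<Longrightarrow> h \<in> Hom X z w \<Longrightarrow> Comp X (Comp X h g) f = Comp X h (Comp X g f)"
  by (simp add: Hom_def comp_assoc)

lemma Hom_ide: "f \<in> Hom X x y \<Longrightarrow> Comp X f (Ide X x) = f" "f \<in> Hom X x y \<Longrightarrow> Comp X (Ide X y) f = f"
  by (simp_all add: Hom_def)

lemma retract_iso:
  assumes "retract X x y" "iso_objects X y z"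
  shows "retract X x z"
proof -
  obtain s r where s: "s \<in> Hom X x y" and r: "r \<in> Hom X y x" and rs: "Comp X r s = Ide X x"
    using assms(1) unfolding retract_def by blast
  obtain f g where f: "f \<in> Hom X y z" and g: "g \<in> Hom X z y" and gf: "Comp X g f = Ide X y"
    using assms(2) unfolding iso_objects_def by blast
  have "Comp X (Comp X r g) (Comp X f s) = Comp X r (Comp X (Comp X g f) s)"
    using Hom_assoc[OF comp_Hom[OF s f] g r] Hom_assoc[OF s f g] by simp
  also have "\<dots> = Ide X x" using gf Hom_ide(2)[OF s] rs by simp
  finally show ?thesis
    unfolding retract_def using comp_Hom[OF s f] comp_Hom[OF g r] by blast
qed

lemma iso_objects_refl: "x \<in> Obj X \<Longrightarrow> iso_objects X x x"
  unfolding iso_objects_def using ide_Hom Hom_ide by blast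

end

lemma category_full_subcat:
  assumes "category C" "S \<subseteq> Obj C"
  shows "category (full_subcat C S)"
  using assms unfolding category_def full_subcat_def Hom_def by auto

lemma Hom_full_subcat:
  assumes "x \<in> S" "y \<in> S"
  shows "Hom (full_subcat C S) x y = Hom C x y"
  using assms by (auto simp: full_subcat_def Hom_def)

text \<open>Naturality is asked of \<open>i\<close> only: that of the pointwise inverse
  \<open>j\<close> follows by composing with \<open>j\<close> on both sides.\<close>

lemma iso_functorsI:
  assumes C: "category C" and D: "category D" and F: "is_functor C D F" and G: "is_functor C D G"
    and i: "\<And>x. x \<in> Obj C \<Longrightarrow> i x \<in> Hom D (OnObj F x) (OnObj G x)"
    and j: "\<And>x. x \<in> Obj C \<Longrightarrow> j x \<in> Hom D (OnObj G x) (OnObj F x)"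
    and ji: "\<And>x. x \<in> Obj C \<Longrightarrow> Comp D (j x) (i x) = Ide D (OnObj F x)"
    and ij: "\<And>x. x \<in> Obj C \<Longrightarrow> Comp D (i x) (j x) = Ide D (OnObj G x)"
    and nat: "\<And>f. f \<in> Arr C \<Longrightarrow> Comp D (i (Cod C f)) (OnArr F f) = Comp D (OnArr G f) (i (Dom C f))"
  shows "iso_objects (functor_cat C D) F G"
proof -
  interpret C: base_cat C by unfold_locales (rule C)
  interpret D: base_cat D by unfold_locales (rule D)
  have Fa: "OnArr F f \<in> Hom D (OnObj F (Dom C f)) (OnObj F (Cod C f))"
    and Ga: "OnArr G f \<in> Hom D (OnObj G (Dom C f)) (OnObj G (Cod C f))" if "f \<in> Arr C" for f
    using F G that by (auto simp: is_functor_def Hom_def)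
  have nat': "Comp D (j (Cod C f)) (OnArr G f) = Comp D (OnArr F f) (j (Dom C f))" if f: "f \<in> Arr C" for f
  proof -
    note d = C.dom_obj[OF f] and c = C.cod_obj[OF f]
    note GH = Ga[OF f] and FH = Fa[OF f] and idom = i[OF d] and jdom = j[OF d] and icod = i[OF c] and jcod = j[OF c]
    have "Comp D (j (Cod C f)) (OnArr G f)
      = Comp D (j (Cod C f)) (Comp D (OnArr G f) (Comp D (i (Dom C f)) (j (Dom C f))))"
      using ij[OF d] D.Hom_ide(1)[OF GH] by simp
    also have "\<dots> = Comp D (j (Cod C f)) (Comp D (Comp D (i (Cod C f)) (OnArr F f)) (j (Dom C f)))"
      using D.Hom_assoc[OF jdom idom GH] nat[OF f] by simp
    also have "\<dots> = Comp D (Comp D (j (Cod C f)) (i (Cod C f))) (Comp D (OnArr F f) (j (Dom C f)))"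
      using D.Hom_assoc[OF jdom FH icod] D.Hom_assoc[OF D.comp_Hom[OF jdom FH] icod jcod] by simp
    also have "\<dots> = Comp D (OnArr F f) (j (Dom C f))"
      using ji[OF c] D.Hom_ide(2)[OF D.comp_Hom[OF jdom FH]] by simp
    finally show ?thesis .
  qed
  let ?t = "\<lparr>Source = F, Target = G, At = restrict i (Obj C)\<rparr>"
  let ?s = "\<lparr>Source = G, Target = F, At = restrict j (Obj C)\<rparr>"
  have "is_nattr C D ?t" "is_nattr C D ?s"
    using F G i j nat nat' by (auto simp: is_nattr_def intro: D.Hom_arr[THEN conjunct1])
  then have "?t \<in> Hom (functor_cat C D) F G" "?s \<in> Hom (functor_cat C D) G F"
    by (simp_all add: functor_cat_def Hom_def)
  moreover have "Comp (functor_cat C D) ?s ?t = Ide (functor_cat C D) F"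
    "Comp (functor_cat C D) ?t ?s = Ide (functor_cat C D) G"
    using ji ij by (simp_all add: functor_cat_def fun_eq_iff restrict_def)
  ultimately show ?thesis unfolding iso_objects_def by blast
qed

lemma category_functor_cat:
  assumes C: "category C" and D: "category D"
  shows "category (functor_cat C D)"
proof -
  interpret C: base_cat C by unfold_locales (rule C)
  interpret D: base_cat D by unfold_locales (rule D)
  have at: "At t x \<in> Hom D (OnObj (Source t) x) (OnObj (Target t) x)" if "is_nattr C D t" "x \<in> Obj C" for t x
    using that by (simp add: is_nattr_def)
  have nat: "Comp D (At t (Cod C f)) (OnArr (Source t) f) = Comp D (OnArr (Target t) f) (At t (Dom C f))"
    if "is_nattr C D t" "f \<in> Arr C" for t f
    using that by (simp add: is_nattr_def)
  have fa: "OnArr F f \<in> Hom D (OnObj F (Dom C f)) (OnObj F (Cod C f))" if "is_functor C D F" "f \<in> Arr C" for F f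
    using that by (auto simp: is_functor_def Hom_def)
  have ob: "OnObj F x \<in> Obj D" if "is_functor C D F" "x \<in> Obj C" for F x
    using that by (auto simp: is_functor_def)
  have ft: "is_functor C D (Source t)" "is_functor C D (Target t)" if "is_nattr C D t" for t
    using that by (simp_all add: is_nattr_def)
  have ext: "At t \<in> extensional (Obj C)" if "is_nattr C D t" for t
    using that by (simp add: is_nattr_def PiE_def)
  have comp: "is_nattr C D \<lparr>Source = Source s, Target = Target t, At = restrict (\<lambda>x. Comp D (At t x) (At s x)) (Obj C)\<rparr>"
    if s: "is_nattr C D s" and t: "is_nattr C D t" and st: "Source t = Target s" for s t
  proof -
    have c: "Comp D (At t x) (At s x) \<in> Hom D (OnObj (Source s) x) (OnObj (Target t) x)" if "x \<in> Obj C" for x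
      using D.comp_Hom[OF at[OF s that]] at[OF t that] st by simp
    have n: "Comp D (Comp D (At t (Cod C f)) (At s (Cod C f))) (OnArr (Source s) f) =
      Comp D (OnArr (Target t) f) (Comp D (At t (Dom C f)) (At s (Dom C f)))" if f: "f \<in> Arr C" for f
    proof -
      note d = C.dom_obj[OF f] and cd = C.cod_obj[OF f]
      note sd = at[OF s d] and sc = at[OF s cd] and td = at[OF t d, unfolded st] and tc = at[OF t cd, unfolded st]
      have "Comp D (Comp D (At t (Cod C f)) (At s (Cod C f))) (OnArr (Source s) f)
        = Comp D (At t (Cod C f)) (Comp D (OnArr (Target s) f) (At s (Dom C f)))"
        using D.Hom_assoc[OF fa[OF ft(1)[OF s] f] sc tc] nat[OF s f] by simp
      also have "\<dots> = Comp D (Comp D (OnArr (Target t) f) (At t (Dom C f))) (At s (Dom C f))"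
        using D.Hom_assoc[OF sd fa[OF ft(2)[OF s] f] tc] nat[OF t f] st by simp
      also have "\<dots> = Comp D (OnArr (Target t) f) (Comp D (At t (Dom C f)) (At s (Dom C f)))"
        by (rule D.Hom_assoc[OF sd td fa[OF ft(2)[OF t] f]])
      finally show ?thesis .
    qed
    show ?thesis
      using ft[OF s] ft[OF t] c n by (auto simp: is_nattr_def intro: D.Hom_arr[THEN conjunct1])
  qed
  have ide: "is_nattr C D \<lparr>Source = F, Target = F, At = restrict (\<lambda>x. Ide D (OnObj F x)) (Obj C)\<rparr>"
    if F: "is_functor C D F" for F
    using F ob[OF F] D.Hom_ide[OF fa[OF F]] D.ide_Hom by (auto simp: is_nattr_def)
  show ?thesis
    unfolding category_def
  proof (intro conjI ballI impI)
    fix t assume "t \<in> Arr (functor_cat C D)"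
    then have t: "is_nattr C D t" by (simp add: functor_cat_def)
    show "Dom (functor_cat C D) t \<in> Obj (functor_cat C D)" "Cod (functor_cat C D) t \<in> Obj (functor_cat C D)"
      using ft[OF t] by (simp_all add: functor_cat_def)
    have "restrict (\<lambda>x. Comp D (At t x) (Ide D (OnObj (Source t) x))) (Obj C) = At t"
      "restrict (\<lambda>x. Comp D (Ide D (OnObj (Target t) x)) (At t x)) (Obj C) = At t"
      using D.Hom_ide[OF at[OF t]] ext[OF t] by (auto intro!: extensionalityI[of _ "Obj C"])
    then show "Comp (functor_cat C D) t (Ide (functor_cat C D) (Dom (functor_cat C D) t)) = t"
      "Comp (functor_cat C D) (Ide (functor_cat C D) (Cod (functor_cat C D) t)) t = t"
      by (simp_all add: functor_cat_def cong: restrict_cong)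
  next
    fix F assume "F \<in> Obj (functor_cat C D)"
    then show "Ide (functor_cat C D) F \<in> Hom (functor_cat C D) F F"
      using ide by (simp add: functor_cat_def Hom_def)
  next
    fix s t assume "s \<in> Arr (functor_cat C D)" "t \<in> Arr (functor_cat C D)"
      "Dom (functor_cat C D) t = Cod (functor_cat C D) s"
    then show "Comp (functor_cat C D) t s \<in> Hom (functor_cat C D) (Dom (functor_cat C D) s) (Cod (functor_cat C D) t)"
      using comp by (simp add: functor_cat_def Hom_def)
  next
    fix r s t assume a: "r \<in> Arr (functor_cat C D)" "s \<in> Arr (functor_cat C D)" "t \<in> Arr (functor_cat C D)"
      "Dom (functor_cat C D) s = Cod (functor_cat C D) r" "Dom (functor_cat C D) t = Cod (functor_cat C D) s"
    then have n: "is_nattr C D r" "is_nattr C D s" "is_nattr C D t" and e: "Source s = Target r" "Source t = Target s"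
      by (simp_all add: functor_cat_def)
    have "Comp D (At t x) (Comp D (At s x) (At r x)) = Comp D (Comp D (At t x) (At s x)) (At r x)" if "x \<in> Obj C" for x
      using D.Hom_assoc[OF at[OF n(1) that] at[OF n(2) that, unfolded e] at[OF n(3) that, unfolded e]] by simp
    then show "Comp (functor_cat C D) t (Comp (functor_cat C D) s r) =
      Comp (functor_cat C D) (Comp (functor_cat C D) t s) r"
      by (simp add: functor_cat_def fun_eq_iff restrict_def)
  qed
qed

text \<open>Choosing for each object of \<open>D\<close> a preimage up to isomorphism gives the
  quasi-inverse \<open>G\<close>; on arrows it conjugates by the chosen isomorphisms and takes the
  unique preimage under \<open>F\<close>.\<close>

lemma equivalent_catsI:
  assumes C: "category C" and D: "category D" and F: "is_functor C D F"
    and ff: "\<And>x y g. x \<in> Obj C \<Longrightarrow> y \<in> Obj C \<Longrightarrow> g \<in> Hom D (OnObj F x) (OnObj F y) \<Longrightarrow>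
      \<exists>!f. f \<in> Hom C x y \<and> OnArr F f = g"
    and eso: "\<And>d. d \<in> Obj D \<Longrightarrow> \<exists>c\<in>Obj C. iso_objects D (OnObj F c) d"
  shows "equivalent_cats D C"
proof -
  interpret C: base_cat C by unfold_locales (rule C)
  interpret D: base_cat D by unfold_locales (rule D)
  have Fa: "OnArr F f \<in> Hom D (OnObj F x) (OnObj F y)" if "f \<in> Hom C x y" for f x y
    using F that by (auto simp: is_functor_def Hom_def)
  have Fo: "OnObj F x \<in> Obj D" if "x \<in> Obj C" for x using F that by (auto simp: is_functor_def)
  have Fc: "OnArr F (Comp C g f) = Comp D (OnArr F g) (OnArr F f)" if "f \<in> Hom C x y" "g \<in> Hom C y z" for f g x y z
    using F that by (auto simp: is_functor_def Hom_def)
  have Fi: "OnArr F (Ide C x) = Ide D (OnObj F x)" if "x \<in> Obj C" for x using F that by (simp add: is_functor_def)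
  have faith: "f = f'" if "f \<in> Hom C x y" "f' \<in> Hom C x y" "OnArr F f = OnArr F f'" for f f' x y
    using ff[OF _ _ Fa[OF that(1)]] C.Hom_arr[OF that(1)] that by auto
  have "\<forall>d\<in>Obj D. \<exists>c i j. c \<in> Obj C \<and> i \<in> Hom D (OnObj F c) d \<and> j \<in> Hom D d (OnObj F c) \<and>
      Comp D j i = Ide D (OnObj F c) \<and> Comp D i j = Ide D d"
    using eso unfolding iso_objects_def by blast
  then obtain c i j where c: "\<And>d. d \<in> Obj D \<Longrightarrow> c d \<in> Obj C" and i: "\<And>d. d \<in> Obj D \<Longrightarrow> i d \<in> Hom D (OnObj F (c d)) d"
    and j: "\<And>d. d \<in> Obj D \<Longrightarrow> j d \<in> Hom D d (OnObj F (c d))"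
    and ji: "\<And>d. d \<in> Obj D \<Longrightarrow> Comp D (j d) (i d) = Ide D (OnObj F (c d))"
    and ij: "\<And>d. d \<in> Obj D \<Longrightarrow> Comp D (i d) (j d) = Ide D d"
    by metis
  define m where "m u = Comp D (j (Cod D u)) (Comp D u (i (Dom D u)))" for u
  define p where "p x y g = (THE f. f \<in> Hom C x y \<and> OnArr F f = g)" for x y g
  have p: "p x y g \<in> Hom C x y" "OnArr F (p x y g) = g"
    if "x \<in> Obj C" "y \<in> Obj C" "g \<in> Hom D (OnObj F x) (OnObj F y)" for x y g
    using theI'[OF ff[OF that]] by (simp_all add: p_def)
  have m: "m u \<in> Hom D (OnObj F (c x)) (OnObj F (c y))" "m u = Comp D (j y) (Comp D u (i x))" if u: "u \<in> Hom D x y" for u x y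
    using D.comp_Hom[OF D.comp_Hom[OF i u] j] D.Hom_arr[OF u] by (simp_all add: m_def)
  have im: "Comp D (i y) (m u) = Comp D u (i x)" if u: "u \<in> Hom D x y" for u x y
  proof -
    have xy: "x \<in> Obj D" "y \<in> Obj D" using D.Hom_arr[OF u] by auto
    have "Comp D (i y) (m u) = Comp D (Comp D (i y) (j y)) (Comp D u (i x))"
      using D.Hom_assoc[OF D.comp_Hom[OF i[OF xy(1)] u] j[OF xy(2)] i[OF xy(2)]] m(2)[OF u] by simp
    also have "\<dots> = Comp D u (i x)"
      using ij[OF xy(2)] D.Hom_ide(2)[OF D.comp_Hom[OF i[OF xy(1)] u]] by simp
    finally show ?thesis .
  qed
  have m_ide: "m (Ide D x) = Ide D (OnObj F (c x))" if x: "x \<in> Obj D" for x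
    using m(2)[OF D.ide_Hom[OF x]] D.Hom_ide(2)[OF i[OF x]] ji[OF x] by simp
  have m_comp: "m (Comp D v u) = Comp D (m v) (m u)" if u: "u \<in> Hom D x y" and v: "v \<in> Hom D y z" for u v x y z
  proof -
    have xyz: "x \<in> Obj D" "y \<in> Obj D" "z \<in> Obj D" using D.Hom_arr[OF u] D.Hom_arr[OF v] by auto
    have "m (Comp D v u) = Comp D (j z) (Comp D v (Comp D u (i x)))"
      using m(2)[OF D.comp_Hom[OF u v]] D.Hom_assoc[OF i[OF xyz(1)] u v] by simp
    also have "\<dots> = Comp D (j z) (Comp D v (Comp D (i y) (m u)))" using im[OF u] by simp
    also have "\<dots> = Comp D (Comp D (j z) (Comp D v (i y))) (m u)"
      using D.Hom_assoc[OF m(1)[OF u] i[OF xyz(2)] v]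
        D.Hom_assoc[OF m(1)[OF u] D.comp_Hom[OF i[OF xyz(2)] v] j[OF xyz(3)]] by simp
    finally show ?thesis using m(2)[OF v] by simp
  qed
  define G where "G = \<lparr>OnObj = restrict c (Obj D), OnArr = restrict (\<lambda>u. p (c (Dom D u)) (c (Cod D u)) (m u)) (Arr D)\<rparr>"
  have Ga: "OnArr G u \<in> Hom C (c x) (c y)" "OnArr F (OnArr G u) = m u" if u: "u \<in> Hom D x y" for u x y
    using p[OF c c m(1)[OF u]] D.Hom_arr[OF u] by (simp_all add: G_def)
  have Go: "OnObj G x = c x" if "x \<in> Obj D" for x using that by (simp add: G_def)
  have G: "is_functor D C G"
    unfolding is_functor_def
  proof (intro conjI ballI impI)
    show "OnObj G \<in> Obj D \<rightarrow>\<^sub>E Obj C" using c by (auto simp: G_def)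
    show "OnArr G \<in> Arr D \<rightarrow>\<^sub>E Arr C"
      using Ga(1)[OF D.arr_Hom] C.Hom_arr by (auto simp: G_def)
  next
    fix u assume u: "u \<in> Arr D"
    show "Dom C (OnArr G u) = OnObj G (Dom D u)" "Cod C (OnArr G u) = OnObj G (Cod D u)"
      using C.Hom_arr[OF Ga(1)[OF D.arr_Hom[OF u]]] u by (simp_all add: Go)
  next
    fix x assume x: "x \<in> Obj D"
    show "OnArr G (Ide D x) = Ide C (OnObj G x)"
      unfolding Go[OF x] using Ga[OF D.ide_Hom[OF x]] m_ide[OF x] Fi[OF c[OF x]]
      by (intro faith[OF _ C.ide_Hom[OF c[OF x]]]) simp_all
  next
    fix u v assume uv: "u \<in> Arr D" "v \<in> Arr D" "Dom D v = Cod D u"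
    have u: "u \<in> Hom D (Dom D u) (Cod D u)" and v: "v \<in> Hom D (Cod D u) (Cod D v)"
      using uv by (simp_all add: Hom_def)
    show "OnArr G (Comp D v u) = Comp C (OnArr G v) (OnArr G u)"
      using Ga[OF u] Ga[OF v] Ga[OF D.comp_Hom[OF u v]] m_comp[OF u v] Fc[OF Ga(1)[OF u] Ga(1)[OF v]]
      by (intro faith[OF _ C.comp_Hom[OF Ga(1)[OF u] Ga(1)[OF v]]]) simp_all
  qed
  have "iso_objects (functor_cat D D) (comp_functor D F G) (id_functor D)"
  proof (rule iso_functorsI[OF D D is_functor_comp[OF D G F] is_functor_id[OF D], of i j])
    fix u assume u: "u \<in> Arr D"
    show "Comp D (i (Cod D u)) (OnArr (comp_functor D F G) u) = Comp D (OnArr (id_functor D) u) (i (Dom D u))"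
      using im[OF D.arr_Hom[OF u]] Ga(2)[OF D.arr_Hom[OF u]] u by simp
  qed (use i j ij ji Go in simp_all)
  moreover have "iso_objects (functor_cat C C) (comp_functor C G F) (id_functor C)"
  proof -
    \<comment> \<open>The components are the preimages of \<open>i\<close> and \<open>j\<close> at
      \<open>OnObj F x\<close>; their equations are checked after applying \<open>F\<close>, which
      is faithful.\<close>
    define k where "k x = p (c (OnObj F x)) x (i (OnObj F x))" for x
    define l where "l x = p x (c (OnObj F x)) (j (OnObj F x))" for x
    have k: "k x \<in> Hom C (c (OnObj F x)) x" "OnArr F (k x) = i (OnObj F x)" if x: "x \<in> Obj C" for x
      using p[OF c[OF Fo[OF x]] x i[OF Fo[OF x]]] by (simp_all add: k_def)
    have l: "l x \<in> Hom C x (c (OnObj F x))" "OnArr F (l x) = j (OnObj F x)" if x: "x \<in> Obj C" for x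
      using p[OF x c[OF Fo[OF x]] j[OF Fo[OF x]]] by (simp_all add: l_def)
    have ob: "OnObj (comp_functor C G F) x = c (OnObj F x)" if "x \<in> Obj C" for x
      using that Fo Go by simp
    show ?thesis
    proof (rule iso_functorsI[OF C C is_functor_comp[OF C F G] is_functor_id[OF C], of k l])
      fix x assume x: "x \<in> Obj C"
      show "k x \<in> Hom C (OnObj (comp_functor C G F) x) (OnObj (id_functor C) x)"
        "l x \<in> Hom C (OnObj (id_functor C) x) (OnObj (comp_functor C G F) x)"
        using k(1)[OF x] l(1)[OF x] ob[OF x] x by simp_all
      show "Comp C (l x) (k x) = Ide C (OnObj (comp_functor C G F) x)"
        unfolding ob[OF x]
      proof (rule faith[OF C.comp_Hom[OF k(1)[OF x] l(1)[OF x]] C.ide_Hom[OF c[OF Fo[OF x]]]])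
        show "OnArr F (Comp C (l x) (k x)) = OnArr F (Ide C (c (OnObj F x)))"
          using Fc[OF k(1)[OF x] l(1)[OF x]] k(2)[OF x] l(2)[OF x] ji[OF Fo[OF x]] Fi[OF c[OF Fo[OF x]]] by simp
      qed
      have "Comp C (k x) (l x) = Ide C x"
      proof (rule faith[OF C.comp_Hom[OF l(1)[OF x] k(1)[OF x]] C.ide_Hom[OF x]])
        show "OnArr F (Comp C (k x) (l x)) = OnArr F (Ide C x)"
          using Fc[OF l(1)[OF x] k(1)[OF x]] k(2)[OF x] l(2)[OF x] ij[OF Fo[OF x]] Fi[OF x] by simp
      qed
      then show "Comp C (k x) (l x) = Ide C (OnObj (id_functor C) x)" using x by simp
    next
      fix f assume fA: "f \<in> Arr C"
      define x y where xy: "x = Dom C f" "y = Cod C f"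
      have f: "f \<in> Hom C x y" using fA by (simp add: Hom_def xy)
      have ob: "x \<in> Obj C" "y \<in> Obj C" using fA by (simp_all add: xy)
      note g = Ga[OF Fa[OF f]]
      have "Comp C (k y) (OnArr G (OnArr F f)) = Comp C f (k x)"
      proof (rule faith[OF C.comp_Hom[OF g(1) k(1)[OF ob(2)]] C.comp_Hom[OF k(1)[OF ob(1)] f]])
        show "OnArr F (Comp C (k y) (OnArr G (OnArr F f))) = OnArr F (Comp C f (k x))"
          using Fc[OF g(1) k(1)[OF ob(2)]] Fc[OF k(1)[OF ob(1)] f] g(2) k(2) ob im[OF Fa[OF f]] by simp
      qed
      then show "Comp C (k (Cod C f)) (OnArr (comp_functor C G F) f) = Comp C (OnArr (id_functor C) f) (k (Dom C f))"
        using fA by (simp add: xy)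
    qed
  qed
  ultimately show ?thesis unfolding equivalent_cats_def using F G by blast
qed

section \<open>Presheaves and their categories of elements\<close>

lemma category_set_cat: "category set_cat"
  unfolding category_def
proof (intro conjI ballI impI)
  fix f :: "'u set_map" assume "f \<in> Arr set_cat"
  then have f: "SFun f \<in> extensional (SDom f)" "SFun f ` SDom f \<subseteq> SCod f"
    by (auto simp: set_cat_def PiE_def)
  have "compose (SDom f) (SFun f) (restrict (\<lambda>a. a) (SDom f)) = SFun f"
    "compose (SDom f) (restrict (\<lambda>a. a) (SCod f)) (SFun f) = SFun f"
    using f by (auto intro!: extensionalityI[of _ "SDom f"] simp: compose_def)
  then show "Comp set_cat f (Ide set_cat (Dom set_cat f)) = f" "Comp set_cat (Ide set_cat (Cod set_cat f)) f = f"
    by (simp_all add: set_cat_def)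
next
  fix f g h :: "'u set_map" assume "f \<in> Arr set_cat" "g \<in> Arr set_cat" "h \<in> Arr set_cat"
    "Dom set_cat g = Cod set_cat f" "Dom set_cat h = Cod set_cat g"
  then show "Comp set_cat h (Comp set_cat g f) = Comp set_cat (Comp set_cat h g) f"
    using compose_assoc[of "SFun f" "SDom f" "SDom g" "SFun h" "SFun g"] by (simp add: set_cat_def PiE_def)
qed (auto simp: set_cat_def Hom_def compose_def)

abbreviation pres :: "('o, 'a, 'u) presheaf \<Rightarrow> 'a \<Rightarrow> 'u \<Rightarrow> 'u" where
  "pres A f \<equiv> SFun (OnArr A f)"

lemma presheaves_obj: "A \<in> Obj (presheaves X) \<longleftrightarrow> is_functor (opposite X) set_cat A"
  by (simp add: presheaves_def functor_cat_def)

lemma set_cat_simps [simp]: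
  "Obj set_cat = UNIV" "Dom set_cat = SDom" "Cod set_cat = SCod" "m \<in> Arr set_cat \<longleftrightarrow> SFun m \<in> SDom m \<rightarrow>\<^sub>E SCod m"
  by (simp_all add: set_cat_def)

lemma presheafD:
  assumes "A \<in> Obj (presheaves X)"
  shows "f \<in> Arr X \<Longrightarrow> SDom (OnArr A f) = OnObj A (Cod X f)"
    and "f \<in> Arr X \<Longrightarrow> SCod (OnArr A f) = OnObj A (Dom X f)"
    and "f \<in> Arr X \<Longrightarrow> a \<in> OnObj A (Cod X f) \<Longrightarrow> pres A f a \<in> OnObj A (Dom X f)"
    and "z \<in> Obj X \<Longrightarrow> a \<in> OnObj A z \<Longrightarrow> pres A (Ide X z) a = a"
    and "f \<in> Arr X \<Longrightarrow> g \<in> Arr X \<Longrightarrow> Cod X g = Dom X f \<Longrightarrow> a \<in> OnObj A (Cod X f) \<Longrightarrow>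
      pres A (Comp X f g) a = pres A g (pres A f a)"
proof -
  have A: "is_functor (opposite X) set_cat A" using assms by (simp add: presheaves_obj)
  show d: "SDom (OnArr A f) = OnObj A (Cod X f)" "SCod (OnArr A f) = OnObj A (Dom X f)" if "f \<in> Arr X" for f
    using A that by (simp_all add: is_functor_def)
  have "OnArr A f \<in> Arr set_cat" if "f \<in> Arr X"
    using A that by (auto simp only: is_functor_def opposite_simps)
  then show "f \<in> Arr X \<Longrightarrow> a \<in> OnObj A (Cod X f) \<Longrightarrow> pres A f a \<in> OnObj A (Dom X f)"
    using d[of f] by auto
  show "z \<in> Obj X \<Longrightarrow> a \<in> OnObj A z \<Longrightarrow> pres A (Ide X z) a = a"
    using A by (simp add: is_functor_def set_cat_def)
  show "f \<in> Arr X \<Longrightarrow> g \<in> Arr X \<Longrightarrow> Cod X g = Dom X f \<Longrightarrow> a \<in> OnObj A (Cod X f) \<Longrightarrow>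
      pres A (Comp X f g) a = pres A g (pres A f a)"
    using A d(1)[of f] by (simp add: is_functor_def) (simp add: set_cat_def compose_def)
qed

context base_cat
begin

interpretation op: base_cat "opposite X"
  by unfold_locales (rule category_opposite[OF category])

lemma category_presheaves: "category (presheaves X)"
  unfolding presheaves_def by (rule category_functor_cat[OF op.category category_set_cat])

lemma elements_simps:
  "(z, a) \<in> ob (elements X A) \<longleftrightarrow> z \<in> Obj X \<and> a \<in> OnObj A z"
  "(f, a) \<in> ar (elements X A) \<longleftrightarrow> f \<in> Arr X \<and> a \<in> OnObj A (Cod X f)"
  "Dom (Tot (elements X A)) (f, a) = (Dom X f, pres A f a)"
  "Cod (Tot (elements X A)) (f, a) = (Cod X f, a)"
  "(z, a) \<in> ob (elements X A) \<Longrightarrow> pob (elements X A) (z, a) = z"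
  "(f, a) \<in> ar (elements X A) \<Longrightarrow> par (elements X A) (f, a) = f"
  by (auto simp: elements_def Let_def)

context
  fixes A :: "('o, 'a, 'u) presheaf"
  assumes A: "A \<in> Obj (presheaves X)"
begin

lemma elements_fibration: "discrete_fibration X (elements X A)"
proof -
  note A' = presheafD[OF A]
  have "category (Tot (elements X A))"
    using A'(3,4) A'(5)[symmetric]
    by (auto simp: elements_def Let_def category_def Hom_def comp_assoc)
  moreover have "is_functor (Tot (elements X A)) X (Proj (elements X A))"
    using A'(3,4) by (auto simp: elements_def Let_def is_functor_def)
  ultimately have o: "is_over X (elements X A)" by (simp add: is_over_def)
  show ?thesis
    unfolding discrete_fibration_def
  proof (intro conjI ballI impI o)
    fix b f assume b: "b \<in> ob (elements X A)" and f: "f \<in> Arr X" "Cod X f = pob (elements X A) b"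
    obtain z a where za: "b = (z, a)" by (cases b)
    show "\<exists>!t. t \<in> ar (elements X A) \<and> Cod (Tot (elements X A)) t = b \<and> par (elements X A) t = f"
    proof (rule ex1I[of _ "(f, a)"])
      show "(f, a) \<in> ar (elements X A) \<and> Cod (Tot (elements X A)) (f, a) = b \<and> par (elements X A) (f, a) = f"
        using b f unfolding za by (simp add: elements_simps)
    next
      fix t assume "t \<in> ar (elements X A) \<and> Cod (Tot (elements X A)) t = b \<and> par (elements X A) t = f"
      then show "t = (f, a)" unfolding za by (cases t) (auto simp: elements_simps)
    qed
  qed
qed

lemma elements_act:
  assumes "a \<in> OnObj A (Cod X f)" "f \<in> Arr X"
  shows "act (elements X A) (Cod X f, a) f = (Dom X f, pres A f a)"
  using act_eq[OF elements_fibration, of "(f, a)"] assms by (simp add: elements_simps)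

end

text \<open>Natural transformations as plain functions whose values outside the carriers are
  ignored; \<open>fam_nattr\<close> restores extensionality, so composites and identities can be
  computed without restrictions.\<close>

definition nat_fam :: "('o, 'a, 'u) presheaf \<Rightarrow> ('o, 'a, 'u) presheaf \<Rightarrow> ('o \<Rightarrow> 'u \<Rightarrow> 'u) \<Rightarrow> bool" where
  "nat_fam A B h \<longleftrightarrow> (\<forall>z\<in>Obj X. \<forall>a\<in>OnObj A z. h z a \<in> OnObj B z) \<and>
     (\<forall>f\<in>Arr X. \<forall>a\<in>OnObj A (Cod X f). h (Dom X f) (pres A f a) = pres B f (h (Cod X f) a))"

definition fam_nattr :: "('o, 'a, 'u) presheaf \<Rightarrow> ('o, 'a, 'u) presheaf \<Rightarrow> ('o \<Rightarrow> 'u \<Rightarrow> 'u) \<Rightarrow> ('o, 'a, 'u) presheaf_map" where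
  "fam_nattr A B h = \<lparr>Source = A, Target = B,
     At = restrict (\<lambda>z. \<lparr>SDom = OnObj A z, SCod = OnObj B z, SFun = restrict (h z) (OnObj A z)\<rparr>) (Obj X)\<rparr>"

lemma fam_nattr_cong:
  "(\<And>z a. z \<in> Obj X \<Longrightarrow> a \<in> OnObj A z \<Longrightarrow> h z a = k z a) \<Longrightarrow> fam_nattr A B h = fam_nattr A B k"
  by (auto simp: fam_nattr_def fun_eq_iff restrict_def)

lemma fam_nattr_at:
  "z \<in> Obj X \<Longrightarrow> a \<in> OnObj A z \<Longrightarrow> SFun (At (fam_nattr A B h) z) a = h z a"
  by (simp add: fam_nattr_def)

lemma nat_fam_Hom:
  assumes A: "A \<in> Obj (presheaves X)" and B: "B \<in> Obj (presheaves X)" and h: "nat_fam A B h"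
  shows "fam_nattr A B h \<in> Hom (presheaves X) A B"
proof -
  note A' = presheafD[OF A] and B' = presheafD[OF B]
  have "is_nattr (opposite X) set_cat (fam_nattr A B h)"
    unfolding is_nattr_def
  proof (intro conjI ballI)
    show "is_functor (opposite X) set_cat (Source (fam_nattr A B h))" "is_functor (opposite X) set_cat (Target (fam_nattr A B h))"
      using A B by (simp_all add: presheaves_obj fam_nattr_def)
    show "At (fam_nattr A B h) \<in> Obj (opposite X) \<rightarrow>\<^sub>E Arr set_cat"
      using h by (auto simp: fam_nattr_def nat_fam_def)
  next
    fix z assume "z \<in> Obj (opposite X)"
    then show "At (fam_nattr A B h) z \<in> Hom set_cat (OnObj (Source (fam_nattr A B h)) z) (OnObj (Target (fam_nattr A B h)) z)"
      using h by (auto simp: fam_nattr_def nat_fam_def Hom_def)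
  next
    fix f assume "f \<in> Arr (opposite X)"
    then have f: "f \<in> Arr X" by simp
    show "Comp set_cat (At (fam_nattr A B h) (Cod (opposite X) f)) (OnArr (Source (fam_nattr A B h)) f) =
        Comp set_cat (OnArr (Target (fam_nattr A B h)) f) (At (fam_nattr A B h) (Dom (opposite X) f))"
      using f h A'(1-3)[OF f] B'(1-3)[OF f]
      by (auto simp: fam_nattr_def set_cat_def compose_def fun_eq_iff nat_fam_def)
  qed
  then show ?thesis by (simp add: presheaves_def functor_cat_def Hom_def fam_nattr_def)
qed

lemma Hom_nat_fam:
  assumes A: "A \<in> Obj (presheaves X)" and B: "B \<in> Obj (presheaves X)" and t: "t \<in> Hom (presheaves X) A B"
  shows "nat_fam A B (\<lambda>z. SFun (At t z))" and "fam_nattr A B (\<lambda>z. SFun (At t z)) = t"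
proof -
  note A' = presheafD[OF A]
  have t': "is_nattr (opposite X) set_cat t" "Source t = A" "Target t = B"
    using t by (simp_all add: presheaves_def functor_cat_def Hom_def)
  have at: "SFun (At t z) \<in> OnObj A z \<rightarrow>\<^sub>E OnObj B z" "SDom (At t z) = OnObj A z" "SCod (At t z) = OnObj B z"
    if "z \<in> Obj X" for z
  proof -
    have "At t z \<in> Hom set_cat (OnObj A z) (OnObj B z)" using t' that by (simp add: is_nattr_def)
    then show "SFun (At t z) \<in> OnObj A z \<rightarrow>\<^sub>E OnObj B z" "SDom (At t z) = OnObj A z" "SCod (At t z) = OnObj B z"
      by (auto simp: Hom_def)
  qed
  have nat: "Comp set_cat (At t (Dom X f)) (OnArr A f) = Comp set_cat (OnArr B f) (At t (Cod X f))" if "f \<in> Arr X" for f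
    using t' that by (simp add: is_nattr_def)
  show "nat_fam A B (\<lambda>z. SFun (At t z))"
    unfolding nat_fam_def
  proof (intro conjI ballI)
    fix f a assume f: "f \<in> Arr X" and a: "a \<in> OnObj A (Cod X f)"
    have "SFun (Comp set_cat (At t (Dom X f)) (OnArr A f)) a = SFun (Comp set_cat (OnArr B f) (At t (Cod X f))) a"
      using nat[OF f] by simp
    then show "SFun (At t (Dom X f)) (pres A f a) = pres B f (SFun (At t (Cod X f)) a)"
      using a f at[of "Cod X f"] A'(1)[OF f] by (simp add: set_cat_def compose_def)
  qed (use at in auto)
  have "At (fam_nattr A B (\<lambda>z. SFun (At t z))) z = At t z" if z: "z \<in> Obj X" for z
    using at[OF z] z by (cases "At t z") (simp add: fam_nattr_def PiE_def extensional_restrict)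
  moreover have "At t \<in> extensional (Obj X)" using t' by (simp add: is_nattr_def PiE_def)
  ultimately have "At (fam_nattr A B (\<lambda>z. SFun (At t z))) = At t"
    by (intro extensionalityI[of _ "Obj X"]) (simp_all add: fam_nattr_def)
  then show "fam_nattr A B (\<lambda>z. SFun (At t z)) = t"
    using t' by (cases t) (simp add: fam_nattr_def)
qed

lemma fam_nattr_comp:
  assumes "nat_fam A B h"
  shows "Comp (presheaves X) (fam_nattr B C k) (fam_nattr A B h) = fam_nattr A C (\<lambda>z a. k z (h z a))"
  using assms
  by (auto simp: presheaves_def functor_cat_def fam_nattr_def set_cat_def compose_def nat_fam_def fun_eq_iff restrict_def)

lemma fam_nattr_id: "Ide (presheaves X) A = fam_nattr A A (\<lambda>z a. a)"
  by (simp add: presheaves_def functor_cat_def fam_nattr_def set_cat_def)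

lemma fam_nattr_eqD:
  "fam_nattr A B h = fam_nattr A B k \<Longrightarrow> z \<in> Obj X \<Longrightarrow> a \<in> OnObj A z \<Longrightarrow> h z a = k z a"
  by (metis fam_nattr_at)

text \<open>Together with \<open>fam_of_elements_hom\<close> this makes the category of elements
  fully faithful, so retracts and isomorphisms of presheaves can be tested between
  fibrations.\<close>

lemma elements_hom_of_fam:
  assumes A: "A \<in> Obj (presheaves X)" and B: "B \<in> Obj (presheaves X)" and h: "nat_fam A B h"
  obtains F where "F \<in> over_hom (elements X A) (elements X B)"
    "\<And>z a. z \<in> Obj X \<Longrightarrow> a \<in> OnObj A z \<Longrightarrow> OnObj F (z, a) = (z, h z a)"
proof -
  let ?h = "\<lambda>(z, a). (z, h z a)"
  have "compat (elements X A) (elements X B) ?h"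
    unfolding compat_def
  proof (intro conjI ballI)
    fix p assume "p \<in> ob (elements X A)"
    then show "?h p \<in> ob (elements X B)" "pob (elements X B) (?h p) = pob (elements X A) p"
      using h by (cases p; simp add: elements_simps nat_fam_def)+
  next
    fix u assume u: "u \<in> ar (elements X A)"
    then show "?h (Dom (Tot (elements X A)) u) = act (elements X B) (?h (Cod (Tot (elements X A)) u)) (par (elements X A) u)"
      using h by (cases u) (simp add: elements_simps nat_fam_def elements_act[OF B])
  qed
  from mor_hom[OF elements_fibration[OF B] fib_over[OF elements_fibration[OF A]] this]
  show ?thesis by (rule that) (simp add: elements_simps)
qed

lemma fam_of_elements_hom:
  assumes A: "A \<in> Obj (presheaves X)" and B: "B \<in> Obj (presheaves X)"
    and F: "F \<in> over_hom (elements X A) (elements X B)"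
  obtains h where "nat_fam A B h" "\<And>z a. z \<in> Obj X \<Longrightarrow> a \<in> OnObj A z \<Longrightarrow> OnObj F (z, a) = (z, h z a)"
proof -
  note A' = presheafD[OF A] and c = hom_compat[OF elements_fibration[OF B] F, unfolded compat_def]
  define h where "h z a = snd (OnObj F (z, a))" for z a
  have F_ob: "OnObj F (z, a) = (z, h z a) \<and> h z a \<in> OnObj B z" if "z \<in> Obj X" "a \<in> OnObj A z" for z a
  proof -
    have "(z, a) \<in> ob (elements X A)" using that by (simp add: elements_simps)
    then have "OnObj F (z, a) \<in> ob (elements X B)" "pob (elements X B) (OnObj F (z, a)) = z"
      using c that by (auto simp: elements_simps)
    then show ?thesis by (cases "OnObj F (z, a)") (auto simp: elements_simps h_def)
  qed
  have "h (Dom X f) (pres A f a) = pres B f (h (Cod X f) a)" if f: "f \<in> Arr X" "a \<in> OnObj A (Cod X f)" for f a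
  proof -
    have u: "(f, a) \<in> ar (elements X A)" using f by (simp add: elements_simps)
    have "OnObj F (Dom X f, pres A f a) = act (elements X B) (OnObj F (Cod X f, a)) f"
      using conjunct2[OF c, rule_format, OF u] f u by (simp add: elements_simps)
    then show ?thesis
      using F_ob[OF dom_obj[OF f(1)] A'(3)[OF f]] F_ob[OF cod_obj[OF f(1)] f(2)] elements_act[OF B _ f(1)] by simp
  qed
  then have "nat_fam A B h" using F_ob by (simp add: nat_fam_def)
  then show ?thesis using that F_ob by blast
qed

lemma retract_elements:
  assumes A: "A \<in> Obj (presheaves X)" and B: "B \<in> Obj (presheaves X)"
  shows "retract (presheaves X) A B \<longleftrightarrow>
    (\<exists>s\<in>over_hom (elements X A) (elements X B). \<exists>h\<in>over_hom (elements X B) (elements X A).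
      \<forall>r\<in>ob (elements X A). OnObj h (OnObj s r) = r)"
proof
  assume "retract (presheaves X) A B"
  then obtain s r where s: "s \<in> Hom (presheaves X) A B" and r: "r \<in> Hom (presheaves X) B A"
    and rs: "Comp (presheaves X) r s = Ide (presheaves X) A" unfolding retract_def by blast
  note s' = Hom_nat_fam[OF A B s] and r' = Hom_nat_fam[OF B A r]
  have "fam_nattr A A (\<lambda>z a. SFun (At r z) (SFun (At s z) a)) = fam_nattr A A (\<lambda>z a. a)"
    using rs fam_nattr_comp[OF s'(1), of A "\<lambda>z. SFun (At r z)"] unfolding s'(2) r'(2) fam_nattr_id by simp
  note eq = fam_nattr_eqD[OF this]
  obtain S where S: "S \<in> over_hom (elements X A) (elements X B)"
    "\<And>z a. z \<in> Obj X \<Longrightarrow> a \<in> OnObj A z \<Longrightarrow> OnObj S (z, a) = (z, SFun (At s z) a)"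
    using elements_hom_of_fam[OF A B s'(1)] by metis
  obtain H where H: "H \<in> over_hom (elements X B) (elements X A)"
    "\<And>z a. z \<in> Obj X \<Longrightarrow> a \<in> OnObj B z \<Longrightarrow> OnObj H (z, a) = (z, SFun (At r z) a)"
    using elements_hom_of_fam[OF B A r'(1)] by metis
  have "OnObj H (OnObj S p) = p" if "p \<in> ob (elements X A)" for p
    using that S(2) H(2) eq s'(1) by (cases p) (simp add: elements_simps nat_fam_def)
  then show "\<exists>s\<in>over_hom (elements X A) (elements X B). \<exists>h\<in>over_hom (elements X B) (elements X A).
      \<forall>r\<in>ob (elements X A). OnObj h (OnObj s r) = r" using S H by blast
next
  assume "\<exists>s\<in>over_hom (elements X A) (elements X B). \<exists>h\<in>over_hom (elements X B) (elements X A).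
      \<forall>r\<in>ob (elements X A). OnObj h (OnObj s r) = r"
  then obtain S H where S: "S \<in> over_hom (elements X A) (elements X B)" and H: "H \<in> over_hom (elements X B) (elements X A)"
    and HS: "\<And>r. r \<in> ob (elements X A) \<Longrightarrow> OnObj H (OnObj S r) = r" by blast
  obtain s where s: "nat_fam A B s" "\<And>z a. z \<in> Obj X \<Longrightarrow> a \<in> OnObj A z \<Longrightarrow> OnObj S (z, a) = (z, s z a)"
    using fam_of_elements_hom[OF A B S] by metis
  obtain h where h: "nat_fam B A h" "\<And>z a. z \<in> Obj X \<Longrightarrow> a \<in> OnObj B z \<Longrightarrow> OnObj H (z, a) = (z, h z a)"
    using fam_of_elements_hom[OF B A H] by metis
  have "h z (s z a) = a" if "z \<in> Obj X" "a \<in> OnObj A z" for z a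
    using HS[of "(z, a)"] s h that by (simp add: elements_simps nat_fam_def)
  then have "Comp (presheaves X) (fam_nattr B A h) (fam_nattr A B s) = Ide (presheaves X) A"
    unfolding fam_nattr_comp[OF s(1)] fam_nattr_id by (intro fam_nattr_cong) simp
  then show "retract (presheaves X) A B"
    unfolding retract_def using nat_fam_Hom[OF A B s(1)] nat_fam_Hom[OF B A h(1)] by blast
qed

lemma iso_elements:
  assumes A: "A \<in> Obj (presheaves X)" and B: "B \<in> Obj (presheaves X)"
    and "over_iso (elements X A) (elements X B)"
  shows "iso_objects (presheaves X) A B"
proof -
  obtain S H where S: "S \<in> over_hom (elements X A) (elements X B)" and H: "H \<in> over_hom (elements X B) (elements X A)"
    and HS: "\<And>r. r \<in> ob (elements X A) \<Longrightarrow> OnObj H (OnObj S r) = r"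
    and SH: "\<And>r. r \<in> ob (elements X B) \<Longrightarrow> OnObj S (OnObj H r) = r" using over_isoE[OF assms(3)] by metis
  obtain s where s: "nat_fam A B s" "\<And>z a. z \<in> Obj X \<Longrightarrow> a \<in> OnObj A z \<Longrightarrow> OnObj S (z, a) = (z, s z a)"
    using fam_of_elements_hom[OF A B S] by metis
  obtain h where h: "nat_fam B A h" "\<And>z a. z \<in> Obj X \<Longrightarrow> a \<in> OnObj B z \<Longrightarrow> OnObj H (z, a) = (z, h z a)"
    using fam_of_elements_hom[OF B A H] by metis
  have "h z (s z a) = a" if "z \<in> Obj X" "a \<in> OnObj A z" for z a
    using HS[of "(z, a)"] s h that by (simp add: elements_simps nat_fam_def)
  then have 1: "Comp (presheaves X) (fam_nattr B A h) (fam_nattr A B s) = Ide (presheaves X) A"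
    unfolding fam_nattr_comp[OF s(1)] fam_nattr_id by (intro fam_nattr_cong) simp
  have "s z (h z a) = a" if "z \<in> Obj X" "a \<in> OnObj B z" for z a
    using SH[of "(z, a)"] s h that by (simp add: elements_simps nat_fam_def)
  then have 2: "Comp (presheaves X) (fam_nattr A B s) (fam_nattr B A h) = Ide (presheaves X) B"
    unfolding fam_nattr_comp[OF h(1)] fam_nattr_id by (intro fam_nattr_cong) simp
  show ?thesis
    unfolding iso_objects_def using nat_fam_Hom[OF A B s(1)] nat_fam_Hom[OF B A h(1)] 1 2 by blast
qed

end

section \<open>The Cauchy completion and the Karoubi envelope\<close>

context base_cat
begin

lemma idem_homD:
  assumes "f \<in> idem_hom X e e'"
  shows "f \<in> Arr X" "Dom X f = Dom X e" "Cod X f = Dom X e'" "Comp X f e = f" "Comp X e' f = f"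
  using assms by (auto simp: idem_hom_def Hom_def)

lemma idem_hom_comp:
  assumes "idempotent X e" "idempotent X e'" "idempotent X e''" "f \<in> idem_hom X e e'" "g \<in> idem_hom X e' e''"
  shows "Comp X g f \<in> idem_hom X e e''"
  using idem_homD[OF assms(4)] idem_homD[OF assms(5)] idempotentD[OF assms(1)] idempotentD[OF assms(3)]
    comp_assoc[of e f g] comp_assoc[of f g e'']
  by (simp add: idem_hom_def Hom_def)

lemma idem_hom_ide: "idempotent X e \<Longrightarrow> e \<in> idem_hom X e e"
  using idempotentD[of X e] by (auto simp: idem_hom_def Hom_def)

lemma category_karoubi: "category (karoubi X)"
  unfolding category_def
proof (intro conjI ballI impI)
  fix t assume "t \<in> Arr (karoubi X)"
  then obtain e f e' where t: "t = (e, f, e')" "idempotent X e" "idempotent X e'" "f \<in> idem_hom X e e'"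
    by (auto simp: karoubi_def)
  then show "Dom (karoubi X) t \<in> Obj (karoubi X)" "Cod (karoubi X) t \<in> Obj (karoubi X)"
    "Comp (karoubi X) t (Ide (karoubi X) (Dom (karoubi X) t)) = t"
    "Comp (karoubi X) (Ide (karoubi X) (Cod (karoubi X) t)) t = t"
    using idem_homD[OF t(4)] by (simp_all add: karoubi_def)
next
  fix e assume "e \<in> Obj (karoubi X)"
  then show "Ide (karoubi X) e \<in> Hom (karoubi X) e e"
    using idem_hom_ide by (simp add: karoubi_def Hom_def)
next
  fix s t assume st: "s \<in> Arr (karoubi X)" "t \<in> Arr (karoubi X)" "Dom (karoubi X) t = Cod (karoubi X) s"
  then show "Comp (karoubi X) t s \<in> Hom (karoubi X) (Dom (karoubi X) s) (Cod (karoubi X) t)"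
    by (auto simp: karoubi_def Hom_def intro: idem_hom_comp)
next
  fix r s t assume st: "r \<in> Arr (karoubi X)" "s \<in> Arr (karoubi X)" "t \<in> Arr (karoubi X)"
    "Dom (karoubi X) s = Cod (karoubi X) r" "Dom (karoubi X) t = Cod (karoubi X) s"
  then obtain e f e1 g e2 h e3 where r: "r = (e, f, e1)" "s = (e1, g, e2)" "t = (e2, h, e3)"
    and f: "f \<in> idem_hom X e e1" and g: "g \<in> idem_hom X e1 e2" and h: "h \<in> idem_hom X e2 e3"
    by (auto simp: karoubi_def)
  show "Comp (karoubi X) t (Comp (karoubi X) s r) = Comp (karoubi X) (Comp (karoubi X) t s) r"
    using idem_homD[OF f] idem_homD[OF g] idem_homD[OF h] by (simp add: karoubi_def r comp_assoc)
qed

text \<open>\<open>Comp X f e = f\<close> makes \<open>act S b f\<close> a fixed point of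
  \<open>e\<close>, hence an admissible image for the generator of \<open>R\<close>.\<close>

lemma free_on_idem_hom:
  assumes R: "free_on X e R a" and S: "free_on X e' S b" and f: "f \<in> idem_hom X e e'"
  shows "act S b f \<in> ob S" "pob S (act S b f) = Dom X e" "act S (act S b f) e = act S b f"
proof -
  note S' = free_onD[OF S] and f' = idem_homD[OF f] and e = idempotentD[OF free_onD(1)[OF R]]
  show "act S b f \<in> ob S" "pob S (act S b f) = Dom X e"
    using act[OF S'(2,3) f'(1)] f' S' by simp_all
  show "act S (act S b f) e = act S b f"
    using act_comp[OF S'(2,3) f'(1) _ e(1)] f' S' e by simp
qed

text \<open>Morphisms out of \<open>R\<close> are points of \<open>S\<close> fixed by
  \<open>e\<close>. Points of \<open>S\<close> have normal forms \<open>f\<close> with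
  \<open>Comp X e' f = f\<close>, and being fixed by \<open>e\<close> is the remaining equation
  \<open>Comp X f e = f\<close>. Prescribing \<open>\<phi> f\<close> on the generator determines
  it.\<close>

lemma free_on_bij_betw:
  assumes R: "free_on X e R a" and S: "free_on X e' S b"
    and \<phi>: "\<And>f. f \<in> idem_hom X e e' \<Longrightarrow> \<phi> f \<in> over_hom R S \<and> OnObj (\<phi> f) a = act S b f"
  shows "bij_betw \<phi> (idem_hom X e e') (over_hom R S)"
proof (rule bij_betwI')
  note S' = free_onD[OF S] and R' = free_onD[OF R]
  fix f g assume f: "f \<in> idem_hom X e e'" and g: "g \<in> idem_hom X e e'"
  show "\<phi> f = \<phi> g \<longleftrightarrow> f = g"
  proof
    assume "\<phi> f = \<phi> g"
    then have eq: "act S b f = act S b g" using \<phi>[OF f] \<phi>[OF g] by simp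
    show "f = g"
      by (rule free_on_unique[OF S]) (use idem_homD[OF f] idem_homD[OF g] eq in simp_all)
  qed simp
next
  fix f assume "f \<in> idem_hom X e e'"
  then show "\<phi> f \<in> over_hom R S" using \<phi> by simp
next
  note S' = free_onD[OF S] and R' = free_onD[OF R] and e = idempotentD[OF free_onD(1)[OF R]]
  fix G assume G: "G \<in> over_hom R S"
  have Ga: "OnObj G a \<in> ob S" "pob S (OnObj G a) = Dom X e" using over_homD(2,4)[OF G R'(3)] R'(4) by simp_all
  have Gae: "act S (OnObj G a) e = OnObj G a"
    using hom_act[OF R'(2) S'(2) G R'(3) e(1)] R' e by simp
  obtain f where f: "f \<in> Arr X" "Cod X f = Dom X e'" "Comp X e' f = f" "act S b f = OnObj G a"
    using free_on_exists[OF S Ga(1)] .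
  have d: "Dom X f = Dom X e"
    using act(2)[OF S'(2,3) f(1)] f S' Ga by simp
  note e'' = idempotentD[OF S'(1)]
  have eq: "act S b (Comp X f e) = act S b f"
    using act_comp[OF S'(2,3) f(1) _ e(1)] f e d S' Gae by simp
  \<comment> \<open>Both sides are normal forms of the point \<open>OnObj G a\<close>, which is
    fixed by \<open>e\<close>.\<close>
  have "Comp X f e = f"
    by (rule free_on_unique[OF S])
      (use f e e'' d eq comp_assoc[of e f e', symmetric] in simp_all)
  then have fh: "f \<in> idem_hom X e e'" using f d by (simp add: idem_hom_def Hom_def)
  moreover have "G = \<phi> f"
    using \<phi>[OF fh] f G by (intro free_on_hom_eqI[OF R S'(2)]) simp_all
  ultimately show "\<exists>f\<in>idem_hom X e e'. G = \<phi> f" by blast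
qed

end

section \<open>Presheaves of arrows fixed by an idempotent\<close>

context small_cat
begin

text \<open>The subpresheaf of \<open>yoneda X (Dom X e)\<close> through which the endomorphism
  induced by \<open>e\<close> splits.\<close>

definition idem_presheaf :: "'u \<Rightarrow> ('u, 'u, 'u) presheaf" where
  "idem_presheaf e = (let E = (\<lambda>z. {g \<in> Hom X z (Dom X e). Comp X e g = g}) in
     \<lparr>OnObj = restrict E (Obj X),
      OnArr = restrict (\<lambda>f. \<lparr>SDom = E (Cod X f), SCod = E (Dom X f),
                             SFun = restrict (\<lambda>g. Comp X g f) (E (Cod X f))\<rparr>) (Arr X)\<rparr>)"

lemma idem_presheaf_obj:
  "z \<in> Obj X \<Longrightarrow> g \<in> OnObj (idem_presheaf e) z \<longleftrightarrow> g \<in> Arr X \<and> Dom X g = z \<and> Cod X g = Dom X e \<and> Comp X e g = g"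
  by (auto simp: idem_presheaf_def Let_def Hom_def)

lemma idem_presheaf_act:
  "f \<in> Arr X \<Longrightarrow> g \<in> OnObj (idem_presheaf e) (Cod X f) \<Longrightarrow> pres (idem_presheaf e) f g = Comp X g f"
  by (simp add: idem_presheaf_def Let_def)

text \<open>An equality and not just an isomorphism, so representables are treated as the case of an
  identity.\<close>

lemma yoneda_idem_presheaf:
  assumes "x \<in> Obj X"
  shows "yoneda X x = idem_presheaf (Ide X x)"
proof -
  have "{g \<in> Hom X z (Dom X (Ide X x)). Comp X (Ide X x) g = g} = Hom X z x" for z
    using assms by (auto simp: Hom_def)
  then show ?thesis by (simp add: yoneda_def idem_presheaf_def)
qed

context
  fixes e
  assumes e: "idempotent X e"
begin

lemma idem_presheaf: "idem_presheaf e \<in> Obj (presheaves X)"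
proof -
  note e' = idempotentD[OF e]
  let ?E = "\<lambda>z. {g \<in> Hom X z (Dom X e). Comp X e g = g}"
  have m: "Comp X g f \<in> ?E (Dom X f)" if "g \<in> ?E (Cod X f)" "f \<in> Arr X" for f g
    using that e' by (auto simp: Hom_def comp_assoc[symmetric])
  have "is_functor (opposite X) set_cat (idem_presheaf e)"
    unfolding is_functor_def
  proof (intro conjI ballI impI)
    show "OnObj (idem_presheaf e) \<in> Obj (opposite X) \<rightarrow>\<^sub>E Obj set_cat"
      by (simp add: idem_presheaf_def)
    show "OnArr (idem_presheaf e) \<in> Arr (opposite X) \<rightarrow>\<^sub>E Arr set_cat"
      using m by (auto simp: idem_presheaf_def)
  next
    fix f assume "f \<in> Arr (opposite X)"
    then show "Dom set_cat (OnArr (idem_presheaf e) f) = OnObj (idem_presheaf e) (Dom (opposite X) f)"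
      "Cod set_cat (OnArr (idem_presheaf e) f) = OnObj (idem_presheaf e) (Cod (opposite X) f)"
      by (simp_all add: idem_presheaf_def)
  next
    fix z assume "z \<in> Obj (opposite X)"
    then show "OnArr (idem_presheaf e) (Ide (opposite X) z) = Ide set_cat (OnObj (idem_presheaf e) z)"
      by (auto simp: idem_presheaf_def set_cat_def Hom_def fun_eq_iff restrict_def)
  next
    fix f g assume "f \<in> Arr (opposite X)" "g \<in> Arr (opposite X)" "Dom (opposite X) g = Cod (opposite X) f"
    then show "OnArr (idem_presheaf e) (Comp (opposite X) g f)
      = Comp set_cat (OnArr (idem_presheaf e) g) (OnArr (idem_presheaf e) f)"
      using m[of _ f] by (auto simp: idem_presheaf_def set_cat_def Hom_def fun_eq_iff compose_def comp_assoc)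
  qed
  then show ?thesis by (simp add: presheaves_obj)
qed

text \<open>The generator is \<open>e\<close> as an element over its own domain; the identity need
  not belong to the presheaf.\<close>

lemma free_on_idem_presheaf: "free_on X e (elements X (idem_presheaf e)) (Dom X e, e)"
proof -
  note e' = idempotentD[OF e]
  have eo: "e \<in> OnObj (idem_presheaf e) (Dom X e)" using e' idem_presheaf_obj[of "Dom X e" e e] by simp
  have a: "act (elements X (idem_presheaf e)) (Dom X e, e) f = (Dom X f, Comp X e f)"
    if "f \<in> Arr X" "Cod X f = Dom X e" for f
    using elements_act[OF idem_presheaf, of e f] idem_presheaf_act[OF that(1), of e e] that eo by simp
  show ?thesis
    unfolding free_on_def
  proof (intro conjI ballI impI e elements_fibration[OF idem_presheaf])
    show "(Dom X e, e) \<in> ob (elements X (idem_presheaf e))" using eo e' by (simp add: elements_simps)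
    then show "pob (elements X (idem_presheaf e)) (Dom X e, e) = Dom X e" by (simp add: elements_simps)
    show "act (elements X (idem_presheaf e)) (Dom X e, e) e = (Dom X e, e)" using a[OF e'(1,2)] e' by simp
  next
    fix r assume r: "r \<in> ob (elements X (idem_presheaf e))"
    obtain z g where zg: "r = (z, g)" by (cases r)
    then have g: "g \<in> Arr X" "Dom X g = z" "Cod X g = Dom X e" "Comp X e g = g"
      using r idem_presheaf_obj[of z g e] by (simp_all add: elements_simps)
    then show "\<exists>f\<in>Arr X. Cod X f = Dom X e \<and> Comp X e f = f \<and> act (elements X (idem_presheaf e)) (Dom X e, e) f = r"
      using a[OF g(1,3)] zg by auto
  next
    fix f g assume "f \<in> Arr X" "g \<in> Arr X" "Cod X f = Dom X e" "Cod X g = Dom X e" "Comp X e f = f" "Comp X e g = g"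
      "act (elements X (idem_presheaf e)) (Dom X e, e) f = act (elements X (idem_presheaf e)) (Dom X e, e) g"
    then show "f = g" using a by simp
  qed
qed

end

lemma representable_yoneda:
  assumes "x \<in> Obj X"
  shows "representable X (yoneda X x)"
proof -
  interpret Psh: base_cat "presheaves X :: (('u, 'u, 'u) presheaf, ('u, 'u, 'u) presheaf_map) cat"
    by unfold_locales (rule category_presheaves)
  have "yoneda X x \<in> Obj (presheaves X)"
    unfolding yoneda_idem_presheaf[OF assms] by (rule idem_presheaf[OF idempotent_ide[OF assms]])
  then show ?thesis
    unfolding representable_def using assms Psh.iso_objects_refl by blast
qed

text \<open>The category of elements of a representable is, up to isomorphism, free on an identity,
  so \<open>retract_free_on\<close> turns a retract into a fibration free on an idempotent.
  Conversely, the generator of the slice maps onto the generator \<open>a\<close>, and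
  \<open>e\<close> provides the section.\<close>

lemma retract_representable_iff:
  assumes A: "A \<in> Obj (presheaves X)"
  shows "(\<exists>B. representable X B \<and> retract (presheaves X) A B) \<longleftrightarrow> (\<exists>e a. free_on X e (elements X A) a)"
proof
  interpret Psh: base_cat "presheaves X :: (('u, 'u, 'u) presheaf, ('u, 'u, 'u) presheaf_map) cat"
    by unfold_locales (rule category_presheaves)
  assume "\<exists>B. representable X B \<and> retract (presheaves X) A B"
  then obtain B x where x: "x \<in> Obj X" and B: "iso_objects (presheaves X) B (yoneda X x)" "retract (presheaves X) A B"
    unfolding representable_def by blast
  note i = idempotent_ide[OF x]
  have "retract (presheaves X) A (idem_presheaf (Ide X x))"
    using Psh.retract_iso[OF B(2,1)] yoneda_idem_presheaf[OF x] by simp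
  then obtain s h where s: "s \<in> over_hom (elements X A) (elements X (idem_presheaf (Ide X x)))"
    and h: "h \<in> over_hom (elements X (idem_presheaf (Ide X x))) (elements X A)"
    and hs: "\<And>r. r \<in> ob (elements X A) \<Longrightarrow> OnObj h (OnObj s r) = r"
    using retract_elements[OF A idem_presheaf[OF i]] by blast
  show "\<exists>e a. free_on X e (elements X A) a"
    using retract_free_on[OF free_on_idem_presheaf[OF i] x elements_fibration[OF A] s h hs] by blast
next
  assume "\<exists>e a. free_on X e (elements X A) a"
  then obtain e a where a: "free_on X e (elements X A) a" by blast
  note a' = free_onD[OF a] and e = idempotentD[OF free_onD(1)[OF a]]
  define x where "x = Dom X e"
  have x: "x \<in> Obj X" using e by (simp add: x_def)
  define Q where "Q = idem_presheaf (Ide X x)"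
  have Q: "Q \<in> Obj (presheaves X)" unfolding Q_def by (rule idem_presheaf[OF idempotent_ide[OF x]])
  have q: "free_on X (Ide X x) (elements X Q) (x, Ide X x)"
    using free_on_idem_presheaf[OF idempotent_ide[OF x]] x by (simp add: Q_def)
  note q' = free_onD[OF q]
  have ae: "act (elements X A) a (Ide X x) = a" using act_ide[OF a'(2,3)] a'(4) by (simp add: x_def)
  obtain h where h: "h \<in> over_hom (elements X Q) (elements X A)" "OnObj h (x, Ide X x) = a"
    by (rule free_on_hom[OF q a'(2,3)]) (use ae a' x in \<open>simp_all add: x_def\<close>)
  \<comment> \<open>As an arrow from \<open>e\<close> to the identity of \<open>x\<close> in the
    Karoubi envelope, \<open>e\<close> is the split monomorphism; it yields the section
    \<open>s\<close>.\<close>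
  have eH: "e \<in> idem_hom X e (Ide X x)" using e by (simp add: idem_hom_def Hom_def x_def)
  obtain s where s: "s \<in> over_hom (elements X A) (elements X Q)" "OnObj s a = act (elements X Q) (x, Ide X x) e"
    using free_on_hom[OF a q'(2) free_on_idem_hom[OF a q eH]] .
  have hs: "OnObj h (act (elements X Q) (x, Ide X x) e) = a"
    using hom_act[OF q'(2) a'(2) h(1) q'(3) e(1)] h(2) a'(5) q'(4) x e by (simp add: x_def)
  note Ao = fib_over[OF a'(2)]
  have "comp_functor (Tot (elements X A)) h s = id_functor (Tot (elements X A))"
    using a'(3) s(2) hs
    by (intro free_on_hom_eqI[OF a a'(2) over_hom_comp[OF Ao s(1) h(1)] over_hom_id[OF Ao]]) simp
  then have "OnObj h (OnObj s r) = r" if "r \<in> ob (elements X A)" for r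
    using that by (metis comp_functor_at(1) id_functor_at(1))
  then have "retract (presheaves X) A (yoneda X x)"
    unfolding yoneda_idem_presheaf[OF x] Q_def[symmetric] retract_elements[OF A Q] using s h by blast
  then show "\<exists>B. representable X B \<and> retract (presheaves X) A B"
    using representable_yoneda[OF x] by blast
qed

text \<open>Freeness identifies a fibration up to isomorphism, so the family \<open>R\<close> is
  kept abstract; its carriers need not be those of \<open>elements X A\<close>.\<close>

lemma over_iso_down_iff:
  assumes A: "A \<in> Obj (presheaves X)" and P: "\<And>e. idempotent X e \<Longrightarrow> free_on X e (R e) (b e)"
  shows "(\<exists>e. idempotent X e \<and> over_iso (elements X A) (R e)) \<longleftrightarrow> (\<exists>e a. free_on X e (elements X A) a)"
proof
  assume "\<exists>e. idempotent X e \<and> over_iso (elements X A) (R e)"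
  then obtain e where e: "idempotent X e" "over_iso (elements X A) (R e)" by blast
  then have "over_iso (R e) (elements X A)" unfolding over_iso_def by blast
  then show "\<exists>e a. free_on X e (elements X A) a"
    using over_iso_free_on[OF _ elements_fibration[OF A] P[OF e(1)]] by metis
next
  assume "\<exists>e a. free_on X e (elements X A) a"
  then show "\<exists>e. idempotent X e \<and> over_iso (elements X A) (R e)"
    using free_on_over_iso P free_onD(1) by metis
qed

text \<open>\<open>atom_free_on\<close> extracts an idempotent from an atom; conversely
  \<open>idem_subcat e\<close> is an atom inside the universe whose reflection is free on the given
  \<open>e\<close>.\<close>

lemma atom_over_iso_iff:
  assumes A: "A \<in> Obj (presheaves X)"
  shows "(\<exists>T :: ('u, 'u, 'u, 'u) over. atom X T \<and> over_iso (elements X A) (down X T))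
    \<longleftrightarrow> (\<exists>e a. free_on X e (elements X A) a)"
proof
  assume "\<exists>T :: ('u, 'u, 'u, 'u) over. atom X T \<and> over_iso (elements X A) (down X T)"
  then obtain T :: "('u, 'u, 'u, 'u) over" where T: "atom X T" "over_iso (down X T) (elements X A)"
    unfolding over_iso_def by blast
  obtain e a where "free_on X e (down X T) a" using atom_free_on[OF T(1)] .
  then show "\<exists>e a. free_on X e (elements X A) a"
    using over_iso_free_on[OF T(2) elements_fibration[OF A]] by metis
next
  assume "\<exists>e a. free_on X e (elements X A) a"
  then obtain e a where a: "free_on X e (elements X A) a" by blast
  note e = free_onD(1)[OF a]
  show "\<exists>T :: ('u, 'u, 'u, 'u) over. atom X T \<and> over_iso (elements X A) (down X T)"
    using atom_idem_subcat[OF e] free_on_over_iso[OF a free_on_down[OF e idem_like_idem_subcat[OF e]]] by blast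
qed

section \<open>The equivalence with the Karoubi envelope\<close>

definition idem_fam :: "'u \<Rightarrow> 'u \<Rightarrow> 'u \<Rightarrow> ('u, 'u, 'u) presheaf_map" where
  "idem_fam e f e' = fam_nattr (idem_presheaf e) (idem_presheaf e') (\<lambda>z g. Comp X f g)"

lemma idem_fam:
  assumes e: "idempotent X e" and e': "idempotent X e'" and f: "f \<in> idem_hom X e e'"
  shows "nat_fam (idem_presheaf e) (idem_presheaf e') (\<lambda>z g. Comp X f g)"
proof -
  note f' = idem_homD[OF f]
  have 1: "Comp X f a \<in> OnObj (idem_presheaf e') z" if "z \<in> Obj X" "a \<in> OnObj (idem_presheaf e) z" for z a
    using that f' idempotentD[OF e'] comp_assoc[of a f e', symmetric] by (simp add: idem_presheaf_obj)
  have "Comp X f (pres (idem_presheaf e) k a) = pres (idem_presheaf e') k (Comp X f a)"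
    if k: "k \<in> Arr X" "a \<in> OnObj (idem_presheaf e) (Cod X k)" for k a
  proof -
    have "a \<in> Arr X" "Dom X a = Cod X k" "Cod X a = Dom X e" using k by (simp_all add: idem_presheaf_obj)
    then show ?thesis
      using k f' 1[OF cod_obj[OF k(1)] k(2)] comp_assoc[of k a f] by (simp add: idem_presheaf_act)
  qed
  with 1 show ?thesis unfolding nat_fam_def by blast
qed

text \<open>A Yoneda argument: every \<open>g\<close> in \<open>idem_presheaf e\<close> is the
  restriction of the element \<open>e\<close> along \<open>g\<close>, so naturality gives
  \<open>h z g = Comp X f g\<close> with \<open>f\<close> the image of \<open>e\<close>. Taking
  \<open>g = e\<close> yields \<open>Comp X f e = f\<close>.\<close>

lemma idem_fam_full:
  assumes e: "idempotent X e" and e': "idempotent X e'"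
    and t: "t \<in> Hom (presheaves X) (idem_presheaf e) (idem_presheaf e')"
  shows "\<exists>!f. f \<in> idem_hom X e e' \<and> idem_fam e f e' = t"
proof -
  note E = idempotentD[OF e]
  define x where "x = Dom X e"
  have x: "x \<in> Obj X" using E by (simp add: x_def)
  define h where "h = (\<lambda>z. SFun (At t z))"
  have h: "nat_fam (idem_presheaf e) (idem_presheaf e') h" "fam_nattr (idem_presheaf e) (idem_presheaf e') h = t"
    using Hom_nat_fam[OF idem_presheaf[OF e] idem_presheaf[OF e'] t] by (simp_all add: h_def)
  have eo: "e \<in> OnObj (idem_presheaf e) x" using E x by (simp add: idem_presheaf_obj x_def)
  define f where "f = h x e"
  have fo: "f \<in> OnObj (idem_presheaf e') x" using h(1) eo x by (simp add: nat_fam_def f_def)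
  have hg: "h z g = Comp X f g" if "z \<in> Obj X" "g \<in> OnObj (idem_presheaf e) z" for z g
  proof -
    have g: "g \<in> Arr X" "Dom X g = z" "Cod X g = x" "Comp X e g = g"
      using that by (simp_all add: idem_presheaf_obj x_def)
    have "h (Dom X g) (pres (idem_presheaf e) g e) = pres (idem_presheaf e') g (h (Cod X g) e)"
      by (rule conjunct2[OF h(1)[unfolded nat_fam_def], rule_format, OF g(1)]) (use eo g(3) in simp)
    then show ?thesis using g eo fo by (simp add: idem_presheaf_act f_def)
  qed
  have f: "f \<in> idem_hom X e e'"
    using fo x hg[OF x eo] by (simp add: idem_presheaf_obj idem_hom_def Hom_def x_def f_def)
  have "idem_fam e f e' = t"
    unfolding idem_fam_def h(2)[symmetric] using hg by (intro fam_nattr_cong) simp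
  moreover have "f' = f" if f': "f' \<in> idem_hom X e e'" "idem_fam e f' e' = t" for f'
  proof -
    have "Comp X f' e = h x e"
      using f'(2) h(2) by (intro fam_nattr_eqD[OF _ x eo, of "idem_presheaf e'" "\<lambda>z g. Comp X f' g"]) (simp add: idem_fam_def)
    then show ?thesis using idem_homD(4)[OF f'(1)] by (simp add: f_def)
  qed
  ultimately show ?thesis using f by blast
qed

text \<open>The functor sends \<open>e\<close> to \<open>idem_presheaf e\<close>. It is essentially
  surjective because a retract of a representable has its category of elements free on some
  \<open>e\<close>, and fibrations free on the same idempotent are isomorphic.\<close>

lemma cauchy_completion_karoubi: "equivalent_cats (cauchy_completion X) (karoubi X)"
proof -
  define S where "S = {A \<in> Obj (presheaves X). \<exists>B. representable X B \<and> retract (presheaves X) A B}"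
  have cc: "cauchy_completion X = full_subcat (presheaves X) S" by (simp add: cauchy_completion_def S_def)
  have K: "idem_presheaf e \<in> S" if "idempotent X e" for e
    using retract_representable_iff[OF idem_presheaf[OF that]] free_on_idem_presheaf[OF that] idem_presheaf[OF that]
    by (auto simp: S_def)
  have H: "idem_fam e f e' \<in> Hom (presheaves X) (idem_presheaf e) (idem_presheaf e')"
    if "idempotent X e" "idempotent X e'" "f \<in> idem_hom X e e'" for e f e'
    unfolding idem_fam_def by (rule nat_fam_Hom[OF idem_presheaf[OF that(1)] idem_presheaf[OF that(2)] idem_fam[OF that]])
  let ?D = "full_subcat (presheaves X) S"
  define F where "F = \<lparr>OnObj = restrict idem_presheaf (Obj (karoubi X)),
    OnArr = restrict (\<lambda>(e, f, e'). idem_fam e f e') (Arr (karoubi X))\<rparr>"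
  have obj: "e \<in> Obj (karoubi X) \<longleftrightarrow> idempotent X e" for e by (simp add: karoubi_def)
  have arr: "t \<in> Arr (karoubi X) \<longleftrightarrow> (\<exists>e f e'. t = (e, f, e') \<and> idempotent X e \<and> idempotent X e' \<and> f \<in> idem_hom X e e')" for t
    by (auto simp: karoubi_def)
  have Fo: "OnObj F e = idem_presheaf e" if "idempotent X e" for e using that by (simp add: F_def obj)
  have Fa: "OnArr F (e, f, e') = idem_fam e f e'" if "idempotent X e" "idempotent X e'" "f \<in> idem_hom X e e'" for e f e'
    using that by (simp add: F_def karoubi_def)
  have D: "category ?D"
    by (rule category_full_subcat[OF category_presheaves]) (auto simp: S_def)
  have HD: "idem_fam e f e' \<in> Hom ?D (idem_presheaf e) (idem_presheaf e')"
    if "idempotent X e" "idempotent X e'" "f \<in> idem_hom X e e'" for e f e'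
    using H[OF that] K that by (simp add: Hom_full_subcat)
  have F: "is_functor (karoubi X) ?D F"
    unfolding is_functor_def
  proof (intro conjI ballI impI)
    show "OnObj F \<in> Obj (karoubi X) \<rightarrow>\<^sub>E Obj ?D"
      using K by (auto simp: F_def obj full_subcat_def)
    show "OnArr F \<in> Arr (karoubi X) \<rightarrow>\<^sub>E Arr ?D"
    proof (rule PiE_I)
      fix t assume "t \<in> Arr (karoubi X)"
      then obtain e f e' where t: "t = (e, f, e')" "idempotent X e" "idempotent X e'" "f \<in> idem_hom X e e'"
        unfolding arr by blast
      show "OnArr F t \<in> Arr ?D" using HD[OF t(2-4)] Fa[OF t(2-4)] t(1) by (simp add: Hom_def)
    qed (simp add: F_def)
  next
    fix t assume "t \<in> Arr (karoubi X)"
    then obtain e f e' where t: "t = (e, f, e')" "idempotent X e" "idempotent X e'" "f \<in> idem_hom X e e'"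
      unfolding arr by blast
    show "Dom ?D (OnArr F t) = OnObj F (Dom (karoubi X) t)" "Cod ?D (OnArr F t) = OnObj F (Cod (karoubi X) t)"
      using HD[OF t(2-4)] Fa[OF t(2-4)] Fo t by (simp_all add: Hom_def karoubi_def)
  next
    fix e assume "e \<in> Obj (karoubi X)"
    then have e: "idempotent X e" by (simp add: obj)
    \<comment> \<open>The identity of \<open>e\<close> in the Karoubi envelope is \<open>e\<close>
      itself; it acts trivially because \<open>Comp X e g = g\<close> throughout
      \<open>idem_presheaf e\<close>.\<close>
    have "idem_fam e e e = fam_nattr (idem_presheaf e) (idem_presheaf e) (\<lambda>z g. g)"
      unfolding idem_fam_def by (rule fam_nattr_cong) (simp add: idem_presheaf_obj)
    then show "OnArr F (Ide (karoubi X) e) = Ide ?D (OnObj F e)"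
      using Fa[OF e e idem_hom_ide[OF e]] Fo[OF e]
      by (simp add: karoubi_def full_subcat_def fam_nattr_id)
  next
    fix s t assume st: "s \<in> Arr (karoubi X)" "t \<in> Arr (karoubi X)" "Dom (karoubi X) t = Cod (karoubi X) s"
    then obtain e f e' g e'' where s: "s = (e, f, e')" and t: "t = (e', g, e'')"
      and e: "idempotent X e" "idempotent X e'" "idempotent X e''" and f: "f \<in> idem_hom X e e'" and g: "g \<in> idem_hom X e' e''"
      by (auto simp: karoubi_def)
    have "Comp (presheaves X) (idem_fam e' g e'') (idem_fam e f e') = idem_fam e (Comp X g f) e''"
      unfolding idem_fam_def fam_nattr_comp[OF idem_fam[OF e(1,2) f]]
      using idem_homD[OF f] idem_homD[OF g] by (intro fam_nattr_cong) (simp add: idem_presheaf_obj comp_assoc)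
    then show "OnArr F (Comp (karoubi X) t s) = Comp ?D (OnArr F t) (OnArr F s)"
      using Fa[OF e(1,2) f] Fa[OF e(2,3) g] Fa[OF e(1,3) idem_hom_comp[OF e f g]] s t
      by (simp add: karoubi_def full_subcat_def)
  qed
  show ?thesis
    unfolding cc
  proof (rule equivalent_catsI[OF category_karoubi D F])
    fix e e' t assume "e \<in> Obj (karoubi X)" "e' \<in> Obj (karoubi X)" and t: "t \<in> Hom ?D (OnObj F e) (OnObj F e')"
    then have e: "idempotent X e" "idempotent X e'" by (simp_all add: obj)
    have "t \<in> Hom (presheaves X) (idem_presheaf e) (idem_presheaf e')"
      using t K e by (simp add: Fo Hom_full_subcat)
    from idem_fam_full[OF e this] obtain f where f: "f \<in> idem_hom X e e'" "idem_fam e f e' = t"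
      and un: "\<And>f'. f' \<in> idem_hom X e e' \<Longrightarrow> idem_fam e f' e' = t \<Longrightarrow> f' = f" by blast
    show "\<exists>!f. f \<in> Hom (karoubi X) e e' \<and> OnArr F f = t"
    proof (rule ex1I[of _ "(e, f, e')"])
      show "(e, f, e') \<in> Hom (karoubi X) e e' \<and> OnArr F (e, f, e') = t"
        using f e Fa[OF e f(1)] by (simp add: karoubi_def Hom_def)
    next
      fix k assume k: "k \<in> Hom (karoubi X) e e' \<and> OnArr F k = t"
      then obtain f' where "k = (e, f', e')" "f' \<in> idem_hom X e e'" by (auto simp: karoubi_def Hom_def)
      then show "k = (e, f, e')" using un[of f'] Fa[OF e, of f'] k by simp
    qed
  next
    fix A assume "A \<in> Obj ?D"
    then have A: "A \<in> S" by (simp add: full_subcat_def)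
    then have Ao: "A \<in> Obj (presheaves X)" by (simp add: S_def)
    obtain e a where a: "free_on X e (elements X A) a"
      using A retract_representable_iff[OF Ao] by (auto simp: S_def)
    note e = free_onD(1)[OF a]
    have "iso_objects (presheaves X) (idem_presheaf e) A"
      by (rule iso_elements[OF idem_presheaf[OF e] Ao free_on_over_iso[OF free_on_idem_presheaf[OF e] a]])
    then have "iso_objects ?D (OnObj F e) A"
      unfolding iso_objects_def Hom_full_subcat[OF K[OF e] A] Hom_full_subcat[OF A K[OF e]] Fo[OF e]
      by (simp add: full_subcat_def)
    then show "\<exists>e\<in>Obj (karoubi X). iso_objects ?D (OnObj F e) A" using e obj by blast
  qed
qed

end

theorem proposition32:
  fixes X :: "('u::infinite, 'u) cat"
  assumes "category X"
  shows
    "full_subcat (presheaves X)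
       {A \<in> Obj (presheaves X).
          \<exists>T :: ('u, 'u, 'u, 'u) over. atom X T \<and> over_iso (elements X A) (down X T)}
       = cauchy_completion X \<and>
     full_subcat (presheaves X)
       {A \<in> Obj (presheaves X).
          \<exists>e. idempotent X e \<and> over_iso (elements X A) (down X (idem_over X e))}
       = cauchy_completion X \<and>
     (\<exists>\<phi>.
        (\<forall>e e'. idempotent X e \<longrightarrow> idempotent X e' \<longrightarrow>
           bij_betw (\<phi> e e') (idem_hom X e e')
             (over_hom (down X (idem_over X e)) (down X (idem_over X e'))) \<and>
           (\<forall>f\<in>idem_hom X e e'. \<exists>t\<in>Arr (Tot (down X (idem_over X e'))).
              OnArr (Proj (down X (idem_over X e'))) t = f \<and>
              Cod (Tot (down X (idem_over X e'))) t = OnObj (down_unit X (idem_over X e')) () \<and>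
              Dom (Tot (down X (idem_over X e'))) t =
                OnObj (\<phi> e e' f) (OnObj (down_unit X (idem_over X e)) ()))) \<and>
        (\<forall>e. idempotent X e \<longrightarrow>
           \<phi> e e e = id_functor (Tot (down X (idem_over X e)))) \<and>
        (\<forall>e e' e'' f g. idempotent X e \<longrightarrow> idempotent X e' \<longrightarrow> idempotent X e'' \<longrightarrow>
           f \<in> idem_hom X e e' \<longrightarrow> g \<in> idem_hom X e' e'' \<longrightarrow>
           \<phi> e e'' (Comp X g f) =
             comp_functor (Tot (down X (idem_over X e))) (\<phi> e' e'' g) (\<phi> e e' f))) \<and>
     equivalent_cats (cauchy_completion X) (karoubi X)"
proof -
  interpret small_cat X by unfold_locales (rule assms)
  define R where "R e = down X (idem_over X e)" for e
  define a where "a e = OnObj (down_unit X (idem_over X e)) ()" for e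
  have free: "free_on X e (R e) (a e)" if "idempotent X e" for e
    unfolding R_def a_def by (rule free_on_down[OF that idem_like_idem_over[OF that]])
  have 1: "full_subcat (presheaves X) {A \<in> Obj (presheaves X).
      \<exists>T :: ('u, 'u, 'u, 'u) over. atom X T \<and> over_iso (elements X A) (down X T)} = cauchy_completion X"
    unfolding cauchy_completion_def
    by (rule arg_cong[of _ _ "full_subcat (presheaves X)"], rule Collect_cong)
      (use atom_over_iso_iff retract_representable_iff in blast)
  have 2: "full_subcat (presheaves X) {A \<in> Obj (presheaves X).
      \<exists>e. idempotent X e \<and> over_iso (elements X A) (R e)} = cauchy_completion X"
    unfolding cauchy_completion_def
    by (rule arg_cong[of _ _ "full_subcat (presheaves X)"], rule Collect_cong)
      (use over_iso_down_iff[where R = R and b = a, OF _ free] retract_representable_iff in blast)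
  \<comment> \<open>For \<open>f\<close> in \<open>idem_hom X e e'\<close> the point
    \<open>act (R e') (a e') f\<close> is fixed by \<open>e\<close>, so exactly one morphism sends
    the generator there and the choice is determined.\<close>
  define \<phi> where "\<phi> e e' f = (SOME G. G \<in> over_hom (R e) (R e') \<and> OnObj G (a e) = act (R e') (a e') f)" for e e' f
  have \<phi>: "\<phi> e e' f \<in> over_hom (R e) (R e')" "OnObj (\<phi> e e' f) (a e) = act (R e') (a e') f"
    if "idempotent X e" "idempotent X e'" "f \<in> idem_hom X e e'" for e e' f
  proof -
    note s = free_onD[OF free[OF that(2)]]
    have "\<exists>G. G \<in> over_hom (R e) (R e') \<and> OnObj G (a e) = act (R e') (a e') f"
      using free_on_hom[OF free[OF that(1)] s(2) free_on_idem_hom[OF free[OF that(1)] free[OF that(2)] that(3)]] by metis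
    from someI_ex[OF this] show "\<phi> e e' f \<in> over_hom (R e) (R e')" "OnObj (\<phi> e e' f) (a e) = act (R e') (a e') f"
      by (simp_all add: \<phi>_def)
  qed
  have bij: "bij_betw (\<phi> e e') (idem_hom X e e') (over_hom (R e) (R e'))" if "idempotent X e" "idempotent X e'" for e e'
    using \<phi>[OF that] by (intro free_on_bij_betw[OF free[OF that(1)] free[OF that(2)]]) simp
  \<comment> \<open>The witness is the lift of \<open>f\<close> at the generator of
    \<open>R e'\<close>; its domain is \<open>act (R e') (a e') f\<close>, where the generator of
    \<open>R e\<close> is sent.\<close>
  have t: "\<exists>t\<in>ar (R e'). par (R e') t = f \<and> Cod (Tot (R e')) t = a e' \<and> Dom (Tot (R e')) t = OnObj (\<phi> e e' f) (a e)"
    if "idempotent X e" "idempotent X e'" "f \<in> idem_hom X e e'" for e e' f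
  proof -
    note s = free_onD[OF free[OF that(2)]] and f = idem_homD[OF that(3)]
    have "Cod X f = pob (R e') (a e')" using f s by simp
    note l = lift[OF s(2,3) f(1) this]
    show ?thesis using l \<phi>(2)[OF that] by (auto simp: act_def)
  qed
  have id: "\<phi> e e e = id_functor (Tot (R e))" if e: "idempotent X e" for e
  proof -
    note s = free_onD[OF free[OF e]] and p = \<phi>[OF e e idem_hom_ide[OF e]]
    show ?thesis
      using p(2) s(3,5)
      by (intro free_on_hom_eqI[OF free[OF e] s(2) p(1) over_hom_id[OF fib_over[OF s(2)]]]) simp
  qed
  have comp: "\<phi> e e'' (Comp X g f) = comp_functor (Tot (R e)) (\<phi> e' e'' g) (\<phi> e e' f)"
    if e: "idempotent X e" "idempotent X e'" "idempotent X e''" and f: "f \<in> idem_hom X e e'" and g: "g \<in> idem_hom X e' e''"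
    for e e' e'' f g
  proof -
    note s = free_onD[OF free[OF e(1)]] and s' = free_onD[OF free[OF e(2)]] and s'' = free_onD[OF free[OF e(3)]]
    note pf = \<phi>[OF e(1,2) f] and pg = \<phi>[OF e(2,3) g] and pgf = \<phi>[OF e(1,3) idem_hom_comp[OF e f g]]
    note f' = idem_homD[OF f] and g' = idem_homD[OF g]
    \<comment> \<open>Acting on the right by \<open>g\<close> and then by \<open>f\<close> is acting
      by \<open>Comp X g f\<close>, which makes \<open>\<phi>\<close> covariant.\<close>
    have "OnObj (\<phi> e' e'' g) (act (R e') (a e') f) = act (R e'') (act (R e'') (a e'') g) f"
      using hom_act[OF s'(2) s''(2) pg(1) s'(3) f'(1)] f'(3) s'(4) pg(2) by simp
    also have "\<dots> = act (R e'') (a e'') (Comp X g f)"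
      using act_comp[OF s''(2,3) g'(1) _ f'(1)] g' f' s''(4) by simp
    finally show ?thesis
      using pf(2) pgf(2) s(3)
      by (intro free_on_hom_eqI[OF free[OF e(1)] s''(2) pgf(1) over_hom_comp[OF fib_over[OF s(2)] pf(1) pg(1)]]) simp
  qed
  show ?thesis
    unfolding R_def[symmetric] a_def[symmetric]
    by (intro conjI exI[of _ \<phi>] allI impI ballI 1 2 bij t id comp cauchy_completion_karoubi)
qed

end
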